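(* Let $\bar M_{\bar c}=-I\times_\varrho F$ be a Lorentzian warped product of dimension $n+2$ with constant sectional curvature $\bar c\in\{-1,0,1\}$, and let $(M,g,S^*(TM))$ be a null screen isoparametric hypersurface of $\bar M_{\bar c}$, where $M$ is given as the graph of a transnormal function $f$. Let $\lambda_1,\dots,\lambda_l$ be the distinct screen principal curvatures of $M$ (at a given point), with multiplicities $m_1,\dots,m_l$. If $l>1$, then for each $i=1,\dots,l$, $$\sum_{j\neq i} m_j\,\frac{\bar c+2\lambda_i\lambda_j+\psi(\lambda_i+\lambda_j)}{\lambda_i-\lambda_j}=0,\qquad \text{where } \psi=\sqrt2\,\frac{\varrho'}{\varrho}.$$
   Context: Warped product: $I\subset\mathbb R$ is an interval, $\varrho:I\to(0,\infty)$ is smooth, $F$ is an $(n+1)$-dimensional Riemannian manifold with metric $g_F$, and $-I\times_\varrho F$ is $I\times F$ with the Lorentzian metric $\bar g=-dt^2+\varrho(t)^2g_F$ and Levi-Civita connection $\bar\nabla$. Transnormal graph: $f:F\to\mathbb R$ is a smooth function (with values in $I$) satisfying $|\mathrm{grad} f|=\varrho\circ f$, with gradient and norm taken with respect to $g_F$. Then $M=\{(f(p),p): p\in F\}$ is a null hypersurface, i.e. the restriction $g$ of $\bar g$ to $M$ has rank $n$ everywhere. Along $M$ write $\varrho$, $\varrho'$ for $\varrho\circ f$, $\varrho'\circ f$. Along $M$ set $\xi=\frac1{\sqrt2}\left(1,\frac{\mathrm{grad} f}{\varrho^2}\right)$ and $N=\frac1{\sqrt2}\left(-1,\frac{\mathrm{grad}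 f}{\varrho^2}\right)$; $\xi$ is tangent to $M$ and spans the radical $TM\cap TM^\perp$. The screen distribution $S^*(TM)$ is the family of tangent bundles of the level hypersurfaces $S_t=M\cap(\{t\}\times F)$, so $TM=S^*(TM)\oplus_{\mathrm{orth}}\mathrm{span}(\xi)$ and $T\bar M|_M=TM\oplus\mathrm{span}(N)$. Screen shape operator: the induced connection $\nabla$ on $M$ is defined by $\bar\nabla_XY=\nabla_XY+B(X,Y)N$ with $\nabla_XY$ tangent to $M$. The operator $A_\xi^*$ is defined by $\nabla_X\xi=-A_\xi^*X-\tau(X)\xi$ with $A_\xi^*X\in S^*(TM)$, where $\tau(X)=\bar g(\bar\nabla_XN,\xi)$. It satisfies $A^*_\xi\xi=0$ and is $g$-symmetric, so its restriction to $S^*(TM)$ is diagonalizable. Its eigenvalues on $S^*(TM)$ are the screen principal curvatures of $M$. $M$ is screen isoparametric if all screen principal curvatures are constant along $S^*(TM)$, i.e. along the slices $S_t$ (they may depend on $t$). *)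

theory Defs
  imports "HOL-Analysis.Analysis"
begin

text \<open>C-infinity maps; only ever used on open sets \<open>S\<close>.\<close>

fun Ck_on :: "nat \<Rightarrow> 'a::real_normed_vector set \<Rightarrow> ('a \<Rightarrow> 'b::real_normed_vector) \<Rightarrow> bool" where
  "Ck_on 0 S h \<longleftrightarrow> continuous_on S h"
| "Ck_on (Suc k) S h \<longleftrightarrow>
     (\<forall>x\<in>S. h differentiable (at x)) \<and> (\<forall>v. Ck_on k S (\<lambda>x. frechet_derivative h (at x) v))"

definition smooth_on :: "'a::real_normed_vector set \<Rightarrow> ('a \<Rightarrow> 'b::real_normed_vector) \<Rightarrow> bool" where
  "smooth_on S h \<longleftrightarrow> (\<forall>k. Ck_on k S h)"


text \<open>
  A smooth manifold with a metric tensor is presented by an atlas indexed by the type \<open>'i\<close>: a patch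
  (an open set of points), a coordinate map into the Euclidean space \<open>'a\<close>, and the components
  \<open>metric F i x v w\<close> of the metric at the coordinate point \<open>x\<close>, evaluated on the
  coordinate vectors \<open>v\<close> and \<open>w\<close>. The underlying point set is the union of the patches.
\<close>

record ('m, 'i, 'a) metric_manifold =
  patch :: "'i \<Rightarrow> 'm set"
  coord :: "'i \<Rightarrow> 'm \<Rightarrow> 'a"
  metric :: "'i \<Rightarrow> 'a \<Rightarrow> 'a \<Rightarrow> 'a \<Rightarrow> real"

definition points :: "('m, 'i, 'a) metric_manifold \<Rightarrow> 'm set" where
  "points F = (\<Union>i. patch F i)"

definition coord_image :: "('m, 'i, 'a) metric_manifold \<Rightarrow> 'i \<Rightarrow> 'a set" where
  "coord_image F i = coord F i ` patch F i"

definition coord_inv :: "('m, 'i, 'a) metric_manifold \<Rightarrow> 'i \<Rightarrow> 'a \<Rightarrow> 'm" where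
  "coord_inv F i = inv_into (patch F i) (coord F i)"

definition transition :: "('m, 'i, 'a) metric_manifold \<Rightarrow> 'i \<Rightarrow> 'i \<Rightarrow> 'a \<Rightarrow> 'a" where
  "transition F i j = coord F j \<circ> coord_inv F i"

text \<open>Expression of a function on the manifold in the coordinates of patch \<open>i\<close>.\<close>

definition local_rep :: "('m, 'i, 'a) metric_manifold \<Rightarrow> 'i \<Rightarrow> ('m \<Rightarrow> 'b) \<Rightarrow> 'a \<Rightarrow> 'b" where
  "local_rep F i f = f \<circ> coord_inv F i"

definition smooth_manifold ::
  "('m::{t2_space,second_countable_topology}, 'i, 'a::euclidean_space) metric_manifold \<Rightarrow> bool" where
  "smooth_manifold F \<longleftrightarrow>
     (\<forall>i. open (patch F i) \<and> open (coord_image F i) \<and>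
          homeomorphism (patch F i) (coord_image F i) (coord F i) (coord_inv F i)) \<and>
     (\<forall>i j. smooth_on (coord F i ` (patch F i \<inter> patch F j)) (transition F i j))"

definition riemannian_manifold ::
  "('m::{t2_space,second_countable_topology}, 'i, 'a::euclidean_space) metric_manifold \<Rightarrow> bool" where
  "riemannian_manifold F \<longleftrightarrow>
     smooth_manifold F \<and>
     (\<forall>i. \<forall>x\<in>coord_image F i.
        bilinear (metric F i x) \<and>
        (\<forall>v w. metric F i x v w = metric F i x w v) \<and>
        (\<forall>v. v \<noteq> 0 \<longrightarrow> metric F i x v v > 0)) \<and>
     (\<forall>i v w. smooth_on (coord_image F i) (\<lambda>x. metric F i x v w)) \<and>
     (\<forall>i j. \<forall>p \<in> patch F i \<inter> patch F j. \<forall>v w.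
        metric F i (coord F i p) v w =
        metric F j (coord F j p)
          (frechet_derivative (transition F i j) (at (coord F i p)) v)
          (frechet_derivative (transition F i j) (at (coord F i p)) w))"

definition smooth_function :: "('m, 'i, 'a::euclidean_space) metric_manifold \<Rightarrow> ('m \<Rightarrow> real) \<Rightarrow> bool" where
  "smooth_function F f \<longleftrightarrow> (\<forall>i. smooth_on (coord_image F i) (local_rep F i f))"


text \<open>
  Local semi-Riemannian geometry of a metric \<open>G\<close> on an open subset of a Euclidean space.
  \<open>levi_civita G x u v\<close> is the value at \<open>x\<close> of \<open>\<nabla>\<^sub>u v\<close> for the constant
  coordinate fields \<open>u\<close>, \<open>v\<close> (the Christoffel symbols); as such fields commute, vanishing of the
  torsion is symmetry in \<open>u\<close> and \<open>v\<close>.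
\<close>

definition levi_civita ::
  "('a::euclidean_space \<Rightarrow> 'a \<Rightarrow> 'a \<Rightarrow> real) \<Rightarrow> 'a \<Rightarrow> 'a \<Rightarrow> 'a \<Rightarrow> 'a" where
  "levi_civita G x = (THE \<Gamma>. bilinear \<Gamma> \<and>
     (\<forall>u v. \<Gamma> u v = \<Gamma> v u) \<and>
     (\<forall>u v w. frechet_derivative (\<lambda>y. G y v w) (at x) u = G x (\<Gamma> u v) w + G x v (\<Gamma> u w)))"

text \<open>
  Covariant derivative, in the direction of \<open>v\<close>, of a vector field \<open>V\<close> along the map \<open>\<Phi>\<close>
  (so that \<open>V y\<close> is a vector at \<open>\<Phi> y\<close>).
\<close>

definition cov_deriv_along ::
  "('b::euclidean_space \<Rightarrow> 'b \<Rightarrow> 'b \<Rightarrow> real) \<Rightarrow> ('a::euclidean_space \<Rightarrow> 'b) \<Rightarrow> ('a \<Rightarrow> 'b) \<Rightarrow> 'a \<Rightarrow> 'a \<Rightarrow> 'b"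
  where
  "cov_deriv_along G \<Phi> V x v =
     frechet_derivative V (at x) v +
     levi_civita G (\<Phi> x) (frechet_derivative \<Phi> (at x) v) (V x)"

definition cov_deriv ::
  "('a::euclidean_space \<Rightarrow> 'a \<Rightarrow> 'a \<Rightarrow> real) \<Rightarrow> 'a \<Rightarrow> ('a \<Rightarrow> 'a) \<Rightarrow> 'a \<Rightarrow> 'a" where
  "cov_deriv G u V = (\<lambda>x. cov_deriv_along G (\<lambda>y. y) V x u)"

text \<open>
  \<open>R(u,v)w = \<nabla>\<^sub>u \<nabla>\<^sub>v w - \<nabla>\<^sub>v \<nabla>\<^sub>u w\<close>, computed on constant coordinate
  fields, whose brackets vanish.
\<close>

definition curvature ::
  "('a::euclidean_space \<Rightarrow> 'a \<Rightarrow> 'a \<Rightarrow> real) \<Rightarrow> 'a \<Rightarrow> 'a \<Rightarrow> 'a \<Rightarrow> 'a \<Rightarrow> 'a" where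
  "curvature G x u v w =
     cov_deriv G u (cov_deriv G v (\<lambda>_. w)) x - cov_deriv G v (cov_deriv G u (\<lambda>_. w)) x"

definition nondegenerate_pair :: "('a \<Rightarrow> 'a \<Rightarrow> 'a \<Rightarrow> real) \<Rightarrow> 'a \<Rightarrow> 'a \<Rightarrow> 'a \<Rightarrow> bool" where
  "nondegenerate_pair G x u v \<longleftrightarrow> G x u u * G x v v - (G x u v)\<^sup>2 \<noteq> 0"

definition sectional_curvature ::
  "('a::euclidean_space \<Rightarrow> 'a \<Rightarrow> 'a \<Rightarrow> real) \<Rightarrow> 'a \<Rightarrow> 'a \<Rightarrow> 'a \<Rightarrow> real" where
  "sectional_curvature G x u v =
     G x (curvature G x u v v) u / (G x u u * G x v v - (G x u v)\<^sup>2)"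

definition constant_sectional_curvature ::
  "('m, 'i, 'a::euclidean_space) metric_manifold \<Rightarrow> real \<Rightarrow> bool" where
  "constant_sectional_curvature M c \<longleftrightarrow>
     (\<forall>i. \<forall>x\<in>coord_image M i. \<forall>u v.
        nondegenerate_pair (metric M i) x u v \<longrightarrow> sectional_curvature (metric M i) x u v = c)"

definition gradient ::
  "('a::euclidean_space \<Rightarrow> 'a \<Rightarrow> 'a \<Rightarrow> real) \<Rightarrow> ('a \<Rightarrow> real) \<Rightarrow> 'a \<Rightarrow> 'a" where
  "gradient G h x = (THE w. \<forall>v. G x w v = frechet_derivative h (at x) v)"


text \<open>The Lorentzian warped product \<open>-I \<times>\<^sub>\<rho> F\<close>, with the product charts.\<close>

definition warped_metric ::
  "(real \<Rightarrow> real) \<Rightarrow> ('a \<Rightarrow> 'a \<Rightarrow> 'a \<Rightarrow> real) \<Rightarrow> real \<times> 'a \<Rightarrow> real \<times> 'a \<Rightarrow> real \<times> 'a \<Rightarrow> real" where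
  "warped_metric \<rho> G = (\<lambda>(t, x) (a, v) (b, w). - (a * b) + (\<rho> t)\<^sup>2 * G x v w)"

definition warped_product ::
  "real set \<Rightarrow> (real \<Rightarrow> real) \<Rightarrow> ('m, 'i, 'a) metric_manifold \<Rightarrow> (real \<times> 'm, 'i, real \<times> 'a) metric_manifold"
  where
  "warped_product I \<rho> F =
     \<lparr>patch = (\<lambda>i. I \<times> patch F i),
      coord = (\<lambda>i (t, p). (t, coord F i p)),
      metric = (\<lambda>i. warped_metric \<rho> (metric F i))\<rparr>"

definition transnormal ::
  "real set \<Rightarrow> (real \<Rightarrow> real) \<Rightarrow> ('m, 'i, 'a::euclidean_space) metric_manifold \<Rightarrow> ('m \<Rightarrow> real) \<Rightarrow> bool"
  where
  "transnormal I \<rho> F f \<longleftrightarrow>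
     smooth_function F f \<and> f ` points F \<subseteq> I \<and>
     (\<forall>i. \<forall>p\<in>patch F i.
        (let w = gradient (metric F i) (local_rep F i f) (coord F i p)
         in sqrt (metric F i (coord F i p) w w) = \<rho> (f p)))"


text \<open>
  The hypersurface \<open>M\<close> and its slices. In the coordinates of patch \<open>i\<close>, fields along \<open>M\<close> are
  regarded as functions of \<open>x \<in> coord_image F i\<close> through the parametrisation \<open>graph_map F f i\<close>.
\<close>

definition graph_of :: "('m, 'i, 'a) metric_manifold \<Rightarrow> ('m \<Rightarrow> real) \<Rightarrow> (real \<times> 'm) set" where
  "graph_of F f = {(f p, p) |p. p \<in> points F}"

definition slice :: "('m, 'i, 'a) metric_manifold \<Rightarrow> ('m \<Rightarrow> real) \<Rightarrow> real \<Rightarrow> (real \<times> 'm) set" where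
  "slice F f t = graph_of F f \<inter> ({t} \<times> points F)"

definition graph_map ::
  "('m, 'i, 'a) metric_manifold \<Rightarrow> ('m \<Rightarrow> real) \<Rightarrow> 'i \<Rightarrow> 'a \<Rightarrow> real \<times> 'a" where
  "graph_map F f i x = (local_rep F i f x, x)"

definition tangent_M ::
  "('m, 'i, 'a::euclidean_space) metric_manifold \<Rightarrow> ('m \<Rightarrow> real) \<Rightarrow> 'i \<Rightarrow> 'a \<Rightarrow> (real \<times> 'a) set" where
  "tangent_M F f i x = range (frechet_derivative (graph_map F f i) (at x))"

text \<open>Tangent space of the slice \<open>M \<inter> ({t} \<times> F)\<close>, which is a transversal intersection.\<close>

definition screen ::
  "('m, 'i, 'a::euclidean_space) metric_manifold \<Rightarrow> ('m \<Rightarrow> real) \<Rightarrow> 'i \<Rightarrow> 'a \<Rightarrow> (real \<times> 'a) set" where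
  "screen F f i x = tangent_M F f i x \<inter> ({0} \<times> UNIV)"

text \<open>The radical field \<open>\<xi>\<close> and the null transversal field \<open>N\<close> (here \<open>nu\<close>) along \<open>M\<close>.\<close>

definition xi ::
  "(real \<Rightarrow> real) \<Rightarrow> ('m, 'i, 'a::euclidean_space) metric_manifold \<Rightarrow> ('m \<Rightarrow> real) \<Rightarrow> 'i \<Rightarrow> 'a \<Rightarrow> real \<times> 'a"
  where
  "xi \<rho> F f i x = (1 / sqrt 2) *\<^sub>R
     (1, (1 / (\<rho> (local_rep F i f x))\<^sup>2) *\<^sub>R gradient (metric F i) (local_rep F i f) x)"

definition nu ::
  "(real \<Rightarrow> real) \<Rightarrow> ('m, 'i, 'a::euclidean_space) metric_manifold \<Rightarrow> ('m \<Rightarrow> real) \<Rightarrow> 'i \<Rightarrow> 'a \<Rightarrow> real \<times> 'a"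
  where
  "nu \<rho> F f i x = (1 / sqrt 2) *\<^sub>R
     (- 1, (1 / (\<rho> (local_rep F i f x))\<^sup>2) *\<^sub>R gradient (metric F i) (local_rep F i f) x)"

text \<open>
  The ambient derivative of a field \<open>V\<close> along \<open>M\<close> in the direction of a tangent vector \<open>X\<close> of \<open>M\<close>;
  \<open>X\<close> is the image of \<open>snd X\<close> under the derivative of \<open>graph_map F f i\<close>.
\<close>

definition ambient_deriv ::
  "(real \<Rightarrow> real) \<Rightarrow> ('m, 'i, 'a::euclidean_space) metric_manifold \<Rightarrow> ('m \<Rightarrow> real) \<Rightarrow> 'i \<Rightarrow>
   ('a \<Rightarrow> real \<times> 'a) \<Rightarrow> 'a \<Rightarrow> real \<times> 'a \<Rightarrow> real \<times> 'a" where
  "ambient_deriv \<rho> F f i V x X =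
     cov_deriv_along (warped_metric \<rho> (metric F i)) (graph_map F f i) V x (snd X)"

text \<open>The component tangent to \<open>M\<close> with respect to the splitting \<open>TM \<oplus> span N\<close>.\<close>

definition induced_deriv ::
  "(real \<Rightarrow> real) \<Rightarrow> ('m, 'i, 'a::euclidean_space) metric_manifold \<Rightarrow> ('m \<Rightarrow> real) \<Rightarrow> 'i \<Rightarrow>
   ('a \<Rightarrow> real \<times> 'a) \<Rightarrow> 'a \<Rightarrow> real \<times> 'a \<Rightarrow> real \<times> 'a" where
  "induced_deriv \<rho> F f i V x X =
     (THE Y. Y \<in> tangent_M F f i x \<and> (\<exists>b. ambient_deriv \<rho> F f i V x X = Y + b *\<^sub>R nu \<rho> F f i x))"

definition tau ::
  "(real \<Rightarrow> real) \<Rightarrow> ('m, 'i, 'a::euclidean_space) metric_manifold \<Rightarrow> ('m \<Rightarrow> real) \<Rightarrow> 'i \<Rightarrow>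
   'a \<Rightarrow> real \<times> 'a \<Rightarrow> real" where
  "tau \<rho> F f i x X =
     warped_metric \<rho> (metric F i) (graph_map F f i x)
       (ambient_deriv \<rho> F f i (nu \<rho> F f i) x X) (xi \<rho> F f i x)"

definition screen_shape ::
  "(real \<Rightarrow> real) \<Rightarrow> ('m, 'i, 'a::euclidean_space) metric_manifold \<Rightarrow> ('m \<Rightarrow> real) \<Rightarrow> 'i \<Rightarrow>
   'a \<Rightarrow> real \<times> 'a \<Rightarrow> real \<times> 'a" where
  "screen_shape \<rho> F f i x X =
     (THE Y. Y \<in> screen F f i x \<and>
        induced_deriv \<rho> F f i (xi \<rho> F f i) x X = - Y - tau \<rho> F f i x X *\<^sub>R xi \<rho> F f i x)"

text \<open>
  Screen principal curvatures and their multiplicities at the point \<open>z\<close> of \<open>M\<close>, computed in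
  a patch \<open>i\<close> around \<open>z\<close>; as eigenvalues of an invariantly defined operator they do not depend
  on \<open>i\<close>. The multiplicity is \<open>0\<close> at numbers that are not eigenvalues.
\<close>

definition screen_eigenspace ::
  "(real \<Rightarrow> real) \<Rightarrow> ('m, 'i, 'a::euclidean_space) metric_manifold \<Rightarrow> ('m \<Rightarrow> real) \<Rightarrow> 'i \<Rightarrow>
   real \<times> 'm \<Rightarrow> real \<Rightarrow> (real \<times> 'a) set" where
  "screen_eigenspace \<rho> F f i z \<mu> =
     (let x = coord F i (snd z) in {X \<in> screen F f i x. screen_shape \<rho> F f i x X = \<mu> *\<^sub>R X})"

definition screen_principal_curvatures ::
  "(real \<Rightarrow> real) \<Rightarrow> ('m, 'i, 'a::euclidean_space) metric_manifold \<Rightarrow> ('m \<Rightarrow> real) \<Rightarrow> 'i \<Rightarrow>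
   real \<times> 'm \<Rightarrow> real set" where
  "screen_principal_curvatures \<rho> F f i z = {\<mu>. \<exists>X \<in> screen_eigenspace \<rho> F f i z \<mu>. X \<noteq> 0}"

definition screen_multiplicity ::
  "(real \<Rightarrow> real) \<Rightarrow> ('m, 'i, 'a::euclidean_space) metric_manifold \<Rightarrow> ('m \<Rightarrow> real) \<Rightarrow> 'i \<Rightarrow>
   real \<times> 'm \<Rightarrow> real \<Rightarrow> nat" where
  "screen_multiplicity \<rho> F f i z \<mu> = dim (screen_eigenspace \<rho> F f i z \<mu>)"

text \<open>
  Constancy along each slice of all screen principal curvatures, that is, of the ordered eigenvalues
  counted with multiplicity, or equivalently of the multiplicity function.
\<close>

definition screen_isoparametric ::
  "(real \<Rightarrow> real) \<Rightarrow> ('m, 'i, 'a::euclidean_space) metric_manifold \<Rightarrow> ('m \<Rightarrow> real) \<Rightarrow> bool" where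
  "screen_isoparametric \<rho> F f \<longleftrightarrow>
     (\<forall>t. \<forall>z \<in> slice F f t. \<forall>z' \<in> slice F f t. \<forall>i j.
        snd z \<in> patch F i \<longrightarrow> snd z' \<in> patch F j \<longrightarrow>
        screen_multiplicity \<rho> F f i z = screen_multiplicity \<rho> F f j z')"

end

(*
  Writing nu = grad f / rho for the unit normal of the level sets of f in F and S = nabla nu for their
  shape operator, the screen shape operator is -(S + rho')/(sqrt 2 rho), and the base F has constant
  curvature kappa = c rho^2 - rho'^2 at the points of the level set. The claim becomes Cartan's identity
  for the level sets of f: sum over j of m_j (kappa + s_i s_j)/(s_i - s_j) vanishes.

  For unit eigenvectors e, f of S with distinct eigenvalues s, t, extend them to fields X, Y that are
  eigenvectors along the level set. By the Codazzi equation <nabla_Y Y, X> and <nabla_X Y, X> vanish there;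
  differentiating both tangentially and inserting the result into <R(X,Y)Y, X> = kappa gives
  kappa + s t = 2 sum_g T(e,f,g)^2 / ((t - s_g)(s - s_g)) with T = <(nabla S) ., .> totally symmetric on tangent vectors.
  Divided by s - t and summed over f, the terms are antisymmetric in f and g.
*)
theory Submission
  imports Defs
begin

text \<open>The curvatures are constant along one slice at a time. An eigenvector therefore extends
  to a smooth field that is an eigenvector only along the level set through the given point, and
  every identity between such fields is differentiated in directions tangent to that level set.
  Transnormality makes |grad f| a function of f. The 1-form dual to nu is then closed, which gives
  the symmetry of S on all vectors. In kappa + s t the product s t is <nabla_Y Y, nabla_X X>: the
  tangential parts lie in different eigenspaces, and the normal parts are -t and -s. The factor 2
  appears because <nabla_X Y, nabla_Y X> and the bracket term of the curvature contribute the same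
  sum. The coefficient psi is what the shift by rho' in s = -(sqrt 2 rho lambda + rho') leaves
  behind once its square has cancelled against kappa. The null fields xi and N enter only through
  this affine change of eigenvalues; the rest is Riemannian geometry of F in one chart.\<close>

subsection \<open>Calculus of smooth maps\<close>

abbreviation deriv_along :: "('a::real_normed_vector \<Rightarrow> 'b::real_normed_vector) \<Rightarrow> 'a \<Rightarrow> 'a \<Rightarrow> 'b" ("\<D>") where
  "\<D> h x \<equiv> frechet_derivative h (at x)"

lemma has_derivative_along:
  assumes "(h has_derivative h') (at x)" shows "\<D> h x u = h' u"
  using frechet_derivative_at[OF assms] by simp

text \<open>\<open>Ck_on\<close> differentiates in the whole space rather than within
  \<open>S\<close>. Agreement on \<open>S\<close> therefore transfers derivatives only because
  \<open>S\<close> is open.\<close>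

lemma Ck_on_cong:
  assumes "open S" "\<And>x. x \<in> S \<Longrightarrow> f x = g x" "Ck_on k S f"
  shows "Ck_on k S g"
  using assms(2,3)
proof (induction k arbitrary: f g)
  case 0
  then show ?case by (simp cong: continuous_on_cong)
next
  case (Suc k)
  have 1: "(g has_derivative \<D> f x) (at x)" if "x \<in> S" for x
  proof (rule has_derivative_transform_within_open[OF _ assms(1) that])
    show "(f has_derivative \<D> f x) (at x)"
      using Suc.prems(2) that by (simp add: frechet_derivative_works)
  qed (use Suc.prems in auto)
  have "Ck_on k S (\<lambda>x. \<D> g x v)" for v
    by (rule Suc.IH[of "\<lambda>x. \<D> f x v"]) (use Suc.prems has_derivative_along[OF 1] in auto)
  then show ?case using 1 by (auto simp: differentiable_def)
qed

lemma Ck_on_Suc_imp: "Ck_on (Suc k) S f \<Longrightarrow> Ck_on k S f"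
proof (induction k arbitrary: f)
  case 0
  then show ?case by (auto intro!: continuous_at_imp_continuous_on differentiable_imp_continuous_within)
next
  case (Suc k)
  then show ?case by (metis Ck_on.simps(2))
qed

text \<open>Lets any explicit formula for the derivative stand in for the chosen
  \<open>frechet_derivative\<close>, so each closure property below is an induction on
  \<open>k\<close> with the usual differentiation rule.\<close>

lemma Ck_on_SucI:
  assumes "open S" "\<And>x. x \<in> S \<Longrightarrow> (f has_derivative f' x) (at x)" "\<And>v. Ck_on k S (\<lambda>x. f' x v)"
  shows "Ck_on (Suc k) S f"
proof -
  have "Ck_on k S (\<lambda>x. \<D> f x v)" for v
    by (rule Ck_on_cong[OF assms(1) _ assms(3)[of v]]) (use has_derivative_along[OF assms(2)] in simp)
  then show ?thesis using assms(2) by (auto simp: differentiable_def)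
qed

lemma Ck_on_SucD:
  assumes "Ck_on (Suc k) S f"
  shows "x \<in> S \<Longrightarrow> (f has_derivative \<D> f x) (at x)" "Ck_on k S (\<lambda>x. \<D> f x v)"
  using assms by (auto simp: frechet_derivative_works)

lemma Ck_on_const: "open S \<Longrightarrow> Ck_on k S (\<lambda>x. c)"
proof (induction k arbitrary: c)
  case (Suc k)
  then show ?case by (intro Ck_on_SucI[where f'="\<lambda>x v. 0"]) auto
qed auto

lemma Ck_on_linear:
  assumes "bounded_linear L" "open S" "Ck_on k S f" shows "Ck_on k S (\<lambda>x. L (f x))"
  using assms(3)
proof (induction k arbitrary: f)
  case 0
  then show ?case using bounded_linear.continuous_on[OF assms(1)] by auto
next
  case (Suc k)
  show ?case
    by (rule Ck_on_SucI[OF assms(2) bounded_linear.has_derivative[OF assms(1) Ck_on_SucD(1)[OF Suc.prems]]])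
       (use Suc.IH Ck_on_SucD(2)[OF Suc.prems] in auto)
qed

lemma Ck_on_add:
  assumes "open S" "Ck_on k S f" "Ck_on k S g" shows "Ck_on k S (\<lambda>x. f x + g x)"
  using assms(2,3)
proof (induction k arbitrary: f g)
  case 0
  then show ?case by (auto intro: continuous_intros)
next
  case (Suc k)
  show ?case
    by (rule Ck_on_SucI[OF assms(1) has_derivative_add[OF Ck_on_SucD(1)[OF Suc.prems(1)] Ck_on_SucD(1)[OF Suc.prems(2)]]])
       (use Suc.IH Ck_on_SucD(2)[OF Suc.prems(1)] Ck_on_SucD(2)[OF Suc.prems(2)] in auto)
qed

lemma Ck_on_sum:
  assumes "open S" "\<And>i. i \<in> A \<Longrightarrow> Ck_on k S (f i)" shows "Ck_on k S (\<lambda>x. \<Sum>i\<in>A. f i x)"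
  using assms(2)
proof (induction A rule: infinite_finite_induct)
  case (insert a A)
  have "Ck_on k S (\<lambda>x. f a x + (\<Sum>i\<in>A. f i x))"
    by (rule Ck_on_add[OF assms(1)]) (use insert in auto)
  then show ?case using insert by simp
qed (use assms(1) Ck_on_const in auto)

lemma Ck_on_bilinear:
  assumes "bounded_bilinear B" "open S" "Ck_on k S f" "Ck_on k S g" shows "Ck_on k S (\<lambda>x. B (f x) (g x))"
  using assms(3,4)
proof (induction k arbitrary: f g)
  case 0
  then show ?case using bounded_bilinear.continuous_on[OF assms(1)] by auto
next
  case (Suc k)
  show ?case
    by (rule Ck_on_SucI[OF assms(2) bounded_bilinear.FDERIV[OF assms(1) Ck_on_SucD(1)[OF Suc.prems(1)] Ck_on_SucD(1)[OF Suc.prems(2)]]])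
       (use Suc.IH Ck_on_SucD(2)[OF Suc.prems(1)] Ck_on_SucD(2)[OF Suc.prems(2)]
         Ck_on_Suc_imp[OF Suc.prems(1)]  Ck_on_Suc_imp[OF Suc.prems(2)] in \<open>auto intro!: Ck_on_add assms(2)\<close>)
qed

text \<open>A linear map on the reals is determined by its value at 1. The chain rule thus becomes
  the product of \<open>\<D> h x v\<close> and \<open>\<D> \<rho> (h x) 1\<close>, and the induction
  closes with \<open>Ck_on_bilinear\<close>.\<close>

lemma Ck_on_compose_real:
  fixes \<rho> :: "real \<Rightarrow> 'b::real_normed_vector"
  assumes "open S" "Ck_on k I \<rho>" "Ck_on k S h" "h ` S \<subseteq> I" shows "Ck_on k S (\<lambda>x. \<rho> (h x))"
  using assms(2,3)
proof (induction k arbitrary: \<rho>)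
  case 0
  then show ?case using continuous_on_compose2 assms(4) by auto
next
  case (Suc k)
  have d: "((\<lambda>x. \<rho> (h x)) has_derivative (\<lambda>v. \<D> h x v *\<^sub>R \<D> \<rho> (h x) 1)) (at x)" if "x \<in> S" for x
  proof -
    have r: "(\<rho> has_derivative \<D> \<rho> (h x)) (at (h x))"
      using Ck_on_SucD(1)[OF Suc.prems(1), of "h x"] assms(4) that by auto
    have "((\<lambda>x. \<rho> (h x)) has_derivative (\<lambda>v. \<D> \<rho> (h x) (\<D> h x v))) (at x)"
      by (rule has_derivative_compose[OF Ck_on_SucD(1)[OF Suc.prems(2) that] r])
    moreover have "\<D> \<rho> (h x) s = s *\<^sub>R \<D> \<rho> (h x) 1" for s
      using linear.scaleR[OF has_derivative_linear[OF r], of s 1] by simp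
    ultimately show ?thesis by (metis (no_types, lifting) has_derivative_eq_rhs ext)
  qed
  show ?case
    by (rule Ck_on_SucI[OF assms(1) d])
       (use Suc.IH Ck_on_SucD(2)[OF Suc.prems(1)] Ck_on_SucD(2)[OF Suc.prems(2)]
        Ck_on_Suc_imp[OF Suc.prems(2)] in \<open>auto intro!: Ck_on_bilinear[OF bounded_bilinear_scaleR] assms(1)\<close>)
qed

lemma smooth_on_has_derivative:
  assumes "smooth_on S f" "x \<in> S" shows "(f has_derivative \<D> f x) (at x)"
proof -
  have "Ck_on (Suc 0) S f" using assms(1) unfolding smooth_on_def by blast
  then show ?thesis using Ck_on_SucD(1) assms(2) by blast
qed

lemma smooth_on_linear_deriv: "smooth_on S f \<Longrightarrow> x \<in> S \<Longrightarrow> linear (\<D> f x)"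
  using smooth_on_has_derivative has_derivative_linear by blast

lemma smooth_on_deriv: "smooth_on S f \<Longrightarrow> smooth_on S (\<lambda>x. \<D> f x v)"
  unfolding smooth_on_def by (metis Ck_on_SucD(2))

lemma smooth_on_continuous: "smooth_on S f \<Longrightarrow> continuous_on S f"
  unfolding smooth_on_def by (metis Ck_on.simps(1))

lemma smooth_on_cong:
  assumes "open S" "\<And>x. x \<in> S \<Longrightarrow> f x = g x" "smooth_on S f" shows "smooth_on S g"
  unfolding smooth_on_def
  by (intro allI Ck_on_cong[OF assms(1,2)]) (use assms(3) in \<open>auto simp: smooth_on_def\<close>)

lemma smooth_on_const: "open S \<Longrightarrow> smooth_on S (\<lambda>x. c)"
  unfolding smooth_on_def using Ck_on_const by blast

lemma smooth_on_bounded_linear: "bounded_linear L \<Longrightarrow> open S \<Longrightarrow> smooth_on S f \<Longrightarrow> smooth_on S (\<lambda>x. L (f x))"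
  unfolding smooth_on_def using Ck_on_linear by blast

lemma smooth_on_add: "open S \<Longrightarrow> smooth_on S f \<Longrightarrow> smooth_on S g \<Longrightarrow> smooth_on S (\<lambda>x. f x + g x)"
  unfolding smooth_on_def using Ck_on_add by blast

lemma smooth_on_bilinear:
  "bounded_bilinear B \<Longrightarrow> open S \<Longrightarrow> smooth_on S f \<Longrightarrow> smooth_on S g \<Longrightarrow> smooth_on S (\<lambda>x. B (f x) (g x))"
  unfolding smooth_on_def using Ck_on_bilinear by blast

lemma smooth_on_scaleR:
  "open S \<Longrightarrow> smooth_on S f \<Longrightarrow> smooth_on S g \<Longrightarrow> smooth_on S (\<lambda>x. f x *\<^sub>R g x)"
  by (rule smooth_on_bilinear[OF bounded_bilinear_scaleR])

lemma smooth_on_mult: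
  fixes f g :: "_ \<Rightarrow> real"
  shows "open S \<Longrightarrow> smooth_on S f \<Longrightarrow> smooth_on S g \<Longrightarrow> smooth_on S (\<lambda>x. f x * g x)"
  by (rule smooth_on_bilinear[OF bounded_bilinear_mult])

lemma smooth_on_uminus: "open S \<Longrightarrow> smooth_on S f \<Longrightarrow> smooth_on S (\<lambda>x. - f x)"
  using smooth_on_bounded_linear[OF bounded_linear_minus[OF bounded_linear_ident]] .

lemma smooth_on_diff: "open S \<Longrightarrow> smooth_on S f \<Longrightarrow> smooth_on S g \<Longrightarrow> smooth_on S (\<lambda>x. f x - g x)"
  using smooth_on_add[of S f "\<lambda>x. - g x"] smooth_on_uminus[of S g] by simp

lemma smooth_on_sum:
  "open S \<Longrightarrow> (\<And>i. i \<in> A \<Longrightarrow> smooth_on S (f i)) \<Longrightarrow> smooth_on S (\<lambda>x. \<Sum>i\<in>A. f i x)"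
  unfolding smooth_on_def by (intro allI Ck_on_sum) auto

lemma smooth_on_compose_real:
  fixes \<rho> :: "real \<Rightarrow> 'b::real_normed_vector"
  shows "open S \<Longrightarrow> smooth_on I \<rho> \<Longrightarrow> smooth_on S h \<Longrightarrow> h ` S \<subseteq> I \<Longrightarrow> smooth_on S (\<lambda>x. \<rho> (h x))"
  unfolding smooth_on_def using Ck_on_compose_real by blast

lemmas smooth_on_intros = smooth_on_const smooth_on_add smooth_on_scaleR smooth_on_mult
  smooth_on_uminus smooth_on_diff smooth_on_sum

section \<open>Families of linear and bilinear maps depending on a point\<close>

lemma linear_family_expand:
  fixes L :: "'b::euclidean_space \<Rightarrow> 'c::real_normed_vector"
  assumes "linear L" shows "L v = (\<Sum>b\<in>Basis. (v \<bullet> b) *\<^sub>R L b)"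
proof -
  have "L v = L (\<Sum>b\<in>Basis. (v \<bullet> b) *\<^sub>R b)" by (simp add: euclidean_representation)
  also have "\<dots> = (\<Sum>b\<in>Basis. (v \<bullet> b) *\<^sub>R L b)"
    by (simp add: linear_sum[OF assms] linear.scaleR[OF assms])
  finally show ?thesis .
qed

text \<open>Expanding \<open>Y y\<close> in the finite basis turns \<open>L y (Y y)\<close> into a
  finite sum of products. Differentiability for each fixed vector is therefore enough, and no norm
  on spaces of linear maps is involved.\<close>

lemma has_derivative_linear_family:
  fixes L :: "'a::real_normed_vector \<Rightarrow> 'b::euclidean_space \<Rightarrow> 'c::real_normed_vector"
  assumes S: "open S" "x \<in> S" and lin: "\<And>y. y \<in> S \<Longrightarrow> linear (L y)"
    and dL: "\<And>v. (\<lambda>y. L y v) differentiable (at x)" and Y: "Y differentiable (at x)"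
  shows "((\<lambda>y. L y (Y y)) has_derivative (\<lambda>u. \<D> (\<lambda>y. L y (Y x)) x u + L x (\<D> Y x u))) (at x)"
proof -
  have dLb: "((\<lambda>y. L y v) has_derivative \<D> (\<lambda>y. L y v) x) (at x)" for v
    using dL frechet_derivative_works by blast
  have dY: "(Y has_derivative \<D> Y x) (at x)" using Y frechet_derivative_works by blast
  have 1: "((\<lambda>y. \<Sum>b\<in>Basis. (Y y \<bullet> b) *\<^sub>R L y b) has_derivative
     (\<lambda>u. \<Sum>b\<in>Basis. (Y x \<bullet> b) *\<^sub>R \<D> (\<lambda>y. L y b) x u + (\<D> Y x u \<bullet> b) *\<^sub>R L x b)) (at x)"
    by (intro derivative_intros dY dLb has_derivative_scaleR)
  have 2: "((\<lambda>y. \<Sum>b\<in>Basis. (Y x \<bullet> b) *\<^sub>R L y b) has_derivative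
     (\<lambda>u. \<Sum>b\<in>Basis. (Y x \<bullet> b) *\<^sub>R \<D> (\<lambda>y. L y b) x u)) (at x)"
    by (intro has_derivative_sum has_derivative_scaleR_right dLb)
  have 3: "((\<lambda>y. L y (Y x)) has_derivative
     (\<lambda>u. \<Sum>b\<in>Basis. (Y x \<bullet> b) *\<^sub>R \<D> (\<lambda>y. L y b) x u)) (at x)"
    by (rule has_derivative_transform_within_open[OF 2 S]) (use linear_family_expand[OF lin] in simp)
  have 4: "((\<lambda>y. L y (Y y)) has_derivative
     (\<lambda>u. \<Sum>b\<in>Basis. (Y x \<bullet> b) *\<^sub>R \<D> (\<lambda>y. L y b) x u + (\<D> Y x u \<bullet> b) *\<^sub>R L x b)) (at x)"
    by (rule has_derivative_transform_within_open[OF 1 S]) (use linear_family_expand[OF lin] in simp)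
  show ?thesis
    by (rule has_derivative_eq_rhs[OF 4])
      (auto simp: has_derivative_along[OF 3] sum.distrib linear_family_expand[OF lin[OF S(2)], symmetric])
qed

lemma smooth_on_linear_family:
  fixes L :: "'a::real_normed_vector \<Rightarrow> 'b::euclidean_space \<Rightarrow> 'c::real_normed_vector"
  assumes "open S" "\<And>y. y \<in> S \<Longrightarrow> linear (L y)" "\<And>v. smooth_on S (\<lambda>y. L y v)" "smooth_on S Y"
  shows "smooth_on S (\<lambda>y. L y (Y y))"
proof (rule smooth_on_cong[OF assms(1)])
  show "smooth_on S (\<lambda>y. \<Sum>b\<in>Basis. (Y y \<bullet> b) *\<^sub>R L y b)"
    by (intro smooth_on_intros assms smooth_on_bounded_linear[OF bounded_linear_inner_left])
qed (use linear_family_expand[OF assms(2)] in simp)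

lemma deriv_linear_family:
  fixes L :: "'a::real_normed_vector \<Rightarrow> 'b::euclidean_space \<Rightarrow> 'c::real_normed_vector"
  assumes "open S" "\<And>y. y \<in> S \<Longrightarrow> linear (L y)" "\<And>v. smooth_on S (\<lambda>y. L y v)" "smooth_on S Y" "x \<in> S"
  shows "\<D> (\<lambda>y. L y (Y y)) x u = \<D> (\<lambda>y. L y (Y x)) x u + L x (\<D> Y x u)"
  by (rule has_derivative_along[OF has_derivative_linear_family[OF assms(1,5,2)]])
    (use smooth_on_has_derivative[OF assms(3,5)] smooth_on_has_derivative[OF assms(4,5)]
      in \<open>auto simp: differentiable_def\<close>)

lemma smooth_on_bilinear_family:
  fixes B :: "'a::real_normed_vector \<Rightarrow> 'b::euclidean_space \<Rightarrow> 'b \<Rightarrow> 'c::real_normed_vector"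
  assumes "open S" "\<And>y. y \<in> S \<Longrightarrow> bilinear (B y)" "\<And>v w. smooth_on S (\<lambda>y. B y v w)"
    "smooth_on S X" "smooth_on S Y"
  shows "smooth_on S (\<lambda>y. B y (X y) (Y y))"
proof (rule smooth_on_linear_family[OF assms(1) _ _ assms(5)])
  show "linear (B y (X y))" if "y \<in> S" for y using assms(2)[OF that] by (simp add: bilinear_def)
  show "smooth_on S (\<lambda>y. B y (X y) v)" for v
    by (rule smooth_on_linear_family[OF assms(1) _ _ assms(4), of "\<lambda>y w. B y w v"])
      (use assms in \<open>auto simp: bilinear_def\<close>)
qed

lemma deriv_bilinear_family:
  fixes B :: "'a::real_normed_vector \<Rightarrow> 'b::euclidean_space \<Rightarrow> 'b \<Rightarrow> 'c::real_normed_vector"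
  assumes "open S" "\<And>y. y \<in> S \<Longrightarrow> bilinear (B y)" "\<And>v w. smooth_on S (\<lambda>y. B y v w)"
    "smooth_on S X" "smooth_on S Y" "x \<in> S"
  shows "\<D> (\<lambda>y. B y (X y) (Y y)) x u =
    \<D> (\<lambda>y. B y (X x) (Y x)) x u + B x (\<D> X x u) (Y x) + B x (X x) (\<D> Y x u)"
proof -
  have 1: "linear (B y w)" if "y \<in> S" for y w using assms(2)[OF that] by (simp add: bilinear_def)
  have 2: "linear (\<lambda>w. B y w v)" if "y \<in> S" for y v using assms(2)[OF that] by (simp add: bilinear_def)
  have 3: "smooth_on S (\<lambda>y. B y (X y) v)" for v
    by (rule smooth_on_linear_family[OF assms(1) 2 assms(3) assms(4)])
  show ?thesis
    using deriv_linear_family[OF assms(1) 1 3 assms(5,6), of u]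
      deriv_linear_family[OF assms(1) 2 assms(3) assms(4,6), of "Y x" u] by simp
qed

text \<open>At a zero of \<open>a\<close> the product rule has no term with the derivative of
  \<open>c\<close>, so continuity of \<open>c\<close> suffices. This allows an inverse family to be
  differentiated before it is known to be differentiable.\<close>

lemma has_derivative_scaleR_vanishing:
  fixes a :: "'a::real_normed_vector \<Rightarrow> real" and c :: "'a \<Rightarrow> 'c::real_normed_vector"
  assumes "(a has_derivative a') (at x)" "a x = 0" "continuous (at x) c"
  shows "((\<lambda>y. a y *\<^sub>R c y) has_derivative (\<lambda>u. a' u *\<^sub>R c x)) (at x)"
proof -
  have lin: "bounded_linear a'" using assms(1) has_derivative_bounded_linear by blast
  obtain K where K: "\<And>u. norm (a' u) \<le> norm u * K" "K > 0"
    using bounded_linear.pos_bounded[OF lin] by auto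
  have e: "((\<lambda>y. (a y - a x - a' (y - x)) /\<^sub>R norm (y - x)) \<longlongrightarrow> 0) (at x)"
    using assms(1) unfolding has_derivative_def by (cases "at x = bot") (auto simp: Lim_ident_at)
  have cc: "(c \<longlongrightarrow> c x) (at x)" using assms(3) continuous_at by auto
  \<comment> \<open>The quotient is split into the remainder of \<open>a\<close> times
    \<open>c y\<close> and the linear part of \<open>a\<close> times
    \<open>c y - c x\<close>.\<close>
  have 1: "((\<lambda>y. ((a y - a x - a' (y - x)) /\<^sub>R norm (y - x)) *\<^sub>R c y) \<longlongrightarrow> 0 *\<^sub>R c x) (at x)"
    by (intro tendsto_intros e cc)
  have 2: "((\<lambda>y. (a' (y - x) / norm (y - x)) *\<^sub>R (c y - c x)) \<longlongrightarrow> 0) (at x)"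
  proof (rule Lim_null_comparison)
    show "((\<lambda>y. K * norm (c y - c x)) \<longlongrightarrow> 0) (at x)"
      using tendsto_mult_right_zero[OF tendsto_norm_zero[OF LIM_zero[OF cc]]] by simp
    show "\<forall>\<^sub>F y in at x. norm ((a' (y - x) / norm (y - x)) *\<^sub>R (c y - c x)) \<le> K * norm (c y - c x)"
    proof (rule eventually_at_filter[THEN iffD2], rule always_eventually, intro allI impI)
      fix y assume "y \<noteq> x"
      then have "\<bar>a' (y - x)\<bar> / norm (y - x) \<le> K"
        using K(1)[of "y - x"] by (simp add: divide_le_eq mult.commute)
      then show "norm ((a' (y - x) / norm (y - x)) *\<^sub>R (c y - c x)) \<le> K * norm (c y - c x)"
        using mult_right_mono[of _ K "norm (c y - c x)"] by simp (metis norm_ge_zero times_divide_eq_left mult_right_mono)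
    qed
  qed
  have "((\<lambda>y. (a y *\<^sub>R c y - a x *\<^sub>R c x - a' (y - x) *\<^sub>R c x) /\<^sub>R norm (y - x)) \<longlongrightarrow> 0) (at x)"
    using tendsto_add[OF 1 2]
    by (simp add: assms(2) divide_inverse scaleR_diff_left scaleR_diff_right algebra_simps)
  then show ?thesis
    unfolding has_derivative_def
    using bounded_linear_compose[OF bounded_linear_scaleR_left lin] by (cases "at x = bot") (auto simp: Lim_ident_at)
qed

text \<open>The derivative of the inverse is \<open>- K\<inverse> (dK) K\<inverse>\<close>, so each order of differentiability of
  the inverse follows from the previous one.\<close>

lemma Ck_on_inverse_family:
  fixes K J :: "'a::real_normed_vector \<Rightarrow> 'b::euclidean_space \<Rightarrow> 'b"
  assumes S: "open S" and lin: "\<And>y. y \<in> S \<Longrightarrow> linear (K y)" "\<And>y. y \<in> S \<Longrightarrow> linear (J y)"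
    and KJ: "\<And>y v. y \<in> S \<Longrightarrow> K y (J y v) = v" and JK: "\<And>y v. y \<in> S \<Longrightarrow> J y (K y v) = v"
    and K: "\<And>v. Ck_on k S (\<lambda>y. K y v)"
  shows "Ck_on k S (\<lambda>y. J y v)"
proof -
  \<comment> \<open>Two forms of the resolvent identity. \<open>eq2\<close> has the fixed operator
    \<open>J x\<close> outside and gives the bound behind continuity; \<open>eq\<close> has
    \<open>K y - K x\<close> applied to a fixed vector and is the one that is
    differentiated.\<close>
  have eq: "J y v = J x v - J y (K y (J x v) - K x (J x v))" if "x \<in> S" "y \<in> S" for x y v
    using that by (simp add: linear_diff[OF lin(2)] JK KJ)
  have eq2: "J y v = J x v - J x (K y (J y v) - K x (J y v))" if "x \<in> S" "y \<in> S" for x y v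
    using that by (simp add: linear_diff[OF lin(2)] JK KJ)
  have cont: "continuous_on S (\<lambda>y. J y v)" if K: "\<And>v. continuous_on S (\<lambda>y. K y v)" for v
  proof (rule continuous_at_imp_continuous_on, rule ballI)
    fix x assume x: "x \<in> S"
    obtain C where C: "\<And>w. norm (J x w) \<le> C * norm w" "C > 0"
      using linear_bounded_pos[OF lin(2)[OF x]] by blast
    define \<eta> where "\<eta> y = (\<Sum>b\<in>Basis. norm (K y b - K x b))" for y
    have Kx: "((\<lambda>y. K y w) \<longlongrightarrow> K x w) (at x)" for w
      using K[of w] x S by (simp add: continuous_on_eq_continuous_at continuous_at)
    have \<eta>0: "(\<eta> \<longlongrightarrow> 0) (at x)"
      unfolding \<eta>_def
      using tendsto_sum[of Basis "\<lambda>b y. norm (K y b - K x b)" "\<lambda>_. 0" "at x"]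
        tendsto_norm_zero[OF LIM_zero[OF Kx]] by simp
    have \<eta>pos: "\<eta> y \<ge> 0" for y unfolding \<eta>_def by (simp add: sum_nonneg)
    have Kd: "norm (K y w - K x w) \<le> \<eta> y * norm w" if y: "y \<in> S" for y w
    proof -
      have "K y w - K x w = (\<Sum>b\<in>Basis. (w \<bullet> b) *\<^sub>R (K y b - K x b))"
        by (subst linear_family_expand[OF lin(1)[OF y]], subst linear_family_expand[OF lin(1)[OF x]])
          (simp add: sum_subtractf scaleR_diff_right)
      also have "norm \<dots> \<le> (\<Sum>b\<in>Basis. norm w * norm (K y b - K x b))"
        by (rule sum_norm_le) (auto intro!: mult_right_mono Basis_le_norm)
      finally show ?thesis by (simp add: \<eta>_def sum_distrib_left mult.commute)
    qed
    have "\<forall>\<^sub>F y in at x. y \<in> S" using S x by (simp add: eventually_at_topological) blast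
    \<comment> \<open>Below this threshold the error term is at most half of
      \<open>norm (J y v)\<close> and can be absorbed on the left.\<close>
    moreover have "\<forall>\<^sub>F y in at x. \<eta> y < 1 / (2 * C)"
      using order_tendstoD(2)[OF \<eta>0] C(2) by simp
    ultimately have ev: "\<forall>\<^sub>F y in at x. norm (J y v - J x v) \<le> C * \<eta> y * (2 * (C * norm v))"
    proof eventually_elim
      case (elim y)
      have b: "norm (J x (K y (J y v) - K x (J y v))) \<le> C * \<eta> y * norm (J y v)"
        using order_trans[OF C(1)[of "K y (J y v) - K x (J y v)"]
          mult_left_mono[OF Kd[OF elim(1), of "J y v"] less_imp_le[OF C(2)]]]
        by (simp add: mult.assoc)
      have "norm (J y v) \<le> norm (J x v) + norm (J x (K y (J y v) - K x (J y v)))"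
        by (subst eq2[OF x elim(1)]) (rule norm_triangle_ineq4)
      also have "\<dots> \<le> C * norm v + C * \<eta> y * norm (J y v)" using b C(1)[of v] by simp
      also have "\<dots> \<le> C * norm v + 1/2 * norm (J y v)"
        using elim(2) C(2) by (intro add_left_mono mult_right_mono) (auto simp: field_simps)
      finally have b2: "norm (J y v) \<le> 2 * (C * norm v)" by simp
      have "norm (J y v - J x v) = norm (J x (K y (J y v) - K x (J y v)))"
        by (subst eq2[OF x elim(1)]) simp
      also have "\<dots> \<le> C * \<eta> y * (2 * (C * norm v))"
        by (rule order_trans[OF b mult_left_mono[OF b2]]) (use C(2) \<eta>pos[of y] in simp)
      finally show ?case .
    qed
    have lim: "((\<lambda>y. C * \<eta> y * (2 * (C * norm v))) \<longlongrightarrow> 0) (at x)"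
      using \<eta>0 by (auto intro!: tendsto_eq_intros)
    have "((\<lambda>y. J y v - J x v) \<longlongrightarrow> 0) (at x)"
      by (rule Lim_null_comparison[OF ev lim])
    then show "continuous (at x) (\<lambda>y. J y v)"
      unfolding continuous_at by (rule LIM_zero_cancel)
  qed
  show ?thesis
    using K
  proof (induction k arbitrary: v)
    case 0
    then show ?case using cont by simp
  next
    case (Suc k)
    have "continuous_on S (\<lambda>y. K y v)" for v
      by (rule continuous_at_imp_continuous_on)
        (use has_derivative_continuous[OF Ck_on_SucD(1)[OF Suc.prems]] in blast)
    then have C: "continuous_on S (\<lambda>y. J y v)" for v by (rule cont)
    have IH: "Ck_on k S (\<lambda>y. J y v)" for v by (rule Suc.IH) (use Suc.prems Ck_on_Suc_imp in blast)
    have d: "((\<lambda>y. J y v) has_derivative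
       (\<lambda>u. - (\<Sum>b\<in>Basis. (\<Sum>a\<in>Basis. (J x v \<bullet> a) * (\<D> (\<lambda>y. K y a) x u \<bullet> b)) *\<^sub>R J x b))) (at x)"
      if x: "x \<in> S" for x
    proof -
      have dK: "((\<lambda>y. K y a) has_derivative \<D> (\<lambda>y. K y a) x) (at x)" for a
        using Ck_on_SucD(1)[OF Suc.prems x] .
      define k where "k y = (\<Sum>a\<in>Basis. (J x v \<bullet> a) *\<^sub>R K y a)" for y
      have dk: "(k has_derivative (\<lambda>u. \<Sum>a\<in>Basis. (J x v \<bullet> a) *\<^sub>R \<D> (\<lambda>y. K y a) x u)) (at x)"
        unfolding k_def by (intro has_derivative_sum has_derivative_scaleR_right dK)
      have k: "K y (J x v) = k y" if "y \<in> S" for y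
        unfolding k_def using linear_family_expand[OF lin(1)[OF that]] .
      \<comment> \<open>The scalar factor vanishes at \<open>x\<close>, so the continuity of
        \<open>J y b\<close> proved above is all that is used about \<open>J\<close> here.\<close>
      have "((\<lambda>y. ((k y - k x) \<bullet> b) *\<^sub>R J y b) has_derivative
        (\<lambda>u. ((\<Sum>a\<in>Basis. (J x v \<bullet> a) *\<^sub>R \<D> (\<lambda>y. K y a) x u) \<bullet> b) *\<^sub>R J x b)) (at x)" for b
        by (rule has_derivative_scaleR_vanishing)
          (use C x S dk in \<open>auto simp: continuous_on_eq_continuous_at intro!: derivative_eq_intros\<close>)
      then have "((\<lambda>y. J x v - (\<Sum>b\<in>Basis. ((k y - k x) \<bullet> b) *\<^sub>R J y b)) has_derivative
        (\<lambda>u. 0 - (\<Sum>b\<in>Basis. ((\<Sum>a\<in>Basis. (J x v \<bullet> a) *\<^sub>R \<D> (\<lambda>y. K y a) x u) \<bullet> b) *\<^sub>R J x b))) (at x)"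
        by (intro derivative_intros)
      then have "((\<lambda>y. J y v) has_derivative
        (\<lambda>u. 0 - (\<Sum>b\<in>Basis. ((\<Sum>a\<in>Basis. (J x v \<bullet> a) *\<^sub>R \<D> (\<lambda>y. K y a) x u) \<bullet> b) *\<^sub>R J x b))) (at x)"
      proof (rule has_derivative_transform_within_open[OF _ S x])
        fix y assume y: "y \<in> S"
        show "J x v - (\<Sum>b\<in>Basis. ((k y - k x) \<bullet> b) *\<^sub>R J y b) = J y v"
          using eq[OF x y, of v] linear_family_expand[OF lin(2)[OF y], of "k y - k x"] k[OF x] k[OF y] by simp
      qed
      then show ?thesis by (simp add: inner_sum_left)
    qed
    have 1: "Ck_on k S (\<lambda>x. J x v \<bullet> a)" for a
      by (rule Ck_on_linear[OF bounded_linear_inner_left S IH])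
    have 2: "Ck_on k S (\<lambda>x. \<D> (\<lambda>y. K y a) x u \<bullet> b)" for a b u
      by (rule Ck_on_linear[OF bounded_linear_inner_left S Ck_on_SucD(2)[OF Suc.prems]])
    have 3: "Ck_on k S (\<lambda>x. (\<Sum>a\<in>Basis. (J x v \<bullet> a) * (\<D> (\<lambda>y. K y a) x u \<bullet> b)) *\<^sub>R J x b)" for b u
      by (rule Ck_on_bilinear[OF bounded_bilinear_scaleR S Ck_on_sum[OF S
            Ck_on_bilinear[OF bounded_bilinear_mult S 1 2]] IH])
    have "Ck_on k S (\<lambda>x. - (\<Sum>b\<in>Basis. (\<Sum>a\<in>Basis. (J x v \<bullet> a) * (\<D> (\<lambda>y. K y a) x u \<bullet> b)) *\<^sub>R J x b))" for u
      by (rule Ck_on_linear[OF bounded_linear_minus[OF bounded_linear_ident] S Ck_on_sum[OF S 3]])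
    then show ?case using Ck_on_SucI[OF S d] by blast
  qed
qed

lemma smooth_on_inverse_family:
  fixes K J :: "'a::real_normed_vector \<Rightarrow> 'b::euclidean_space \<Rightarrow> 'b"
  assumes S: "open S" and lin: "\<And>y. y \<in> S \<Longrightarrow> linear (K y)" "\<And>y. y \<in> S \<Longrightarrow> linear (J y)"
    and KJ: "\<And>y v. y \<in> S \<Longrightarrow> K y (J y v) = v" and JK: "\<And>y v. y \<in> S \<Longrightarrow> J y (K y v) = v"
    and "\<And>v. smooth_on S (\<lambda>y. K y v)"
  shows "smooth_on S (\<lambda>y. J y v)"
  unfolding smooth_on_def
  by (intro allI Ck_on_inverse_family[OF S lin KJ JK]) (use assms(6) in \<open>auto simp: smooth_on_def\<close>)

lemma smooth_on_inverse_real: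
  fixes r :: "'a::real_normed_vector \<Rightarrow> real"
  assumes "open S" "smooth_on S r" "\<And>x. x \<in> S \<Longrightarrow> r x \<noteq> 0" shows "smooth_on S (\<lambda>x. inverse (r x))"
proof -
  have "smooth_on S (\<lambda>x. inverse (r x) * 1)"
    by (rule smooth_on_inverse_family[OF assms(1), of "\<lambda>x v. r x * v" "\<lambda>x v. inverse (r x) * v"])
      (use assms in \<open>auto intro!: linearI smooth_on_intros simp: algebra_simps\<close>)
  then show ?thesis by simp
qed

text \<open>The second difference of \<open>f\<close> over the parallelogram spanned by
  \<open>s u\<close> and \<open>s v\<close> is symmetric in \<open>u\<close> and \<open>v\<close>.
  Two applications of the mean value theorem write it as \<open>s * s\<close> times an iterated
  derivative at a nearby point, in either order; continuity finishes the argument.\<close>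

lemma mixed_partials_real:
  fixes f :: "'a::real_normed_vector \<Rightarrow> real"
  assumes S: "open S" "x \<in> S" and f: "smooth_on S f"
  shows "\<D> (\<lambda>y. \<D> f y v) x u = \<D> (\<lambda>y. \<D> f y u) x v"
proof -
  have *: "\<exists>r>0. \<forall>s. 0 < s \<and> s < r \<longrightarrow> (\<exists>y. dist y x < e \<and> 
      f (x + s *\<^sub>R u + s *\<^sub>R v) - f (x + s *\<^sub>R u) - f (x + s *\<^sub>R v) + f x = s * s * \<D> (\<lambda>y. \<D> f y u) y v)"
    if "e > 0" for e u v
  proof -
    obtain d where d: "d > 0" "ball x d \<subseteq> S" using S openE by blast
    define e' where "e' = min e d"
    have e': "e' > 0" "e' \<le> e" "ball x e' \<subseteq> S" using d \<open>e > 0\<close> by (auto simp: e'_def)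
    \<comment> \<open>For \<open>s < r\<close> the whole parallelogram stays within
      \<open>e'\<close> of \<open>x\<close>. The summand 1 covers the case that \<open>u\<close> and
      \<open>v\<close> are both zero.\<close>
    define r where "r = e' / (norm u + norm v + 1)"
    have nn: "norm u + norm v + 1 > 0" by (simp add: add_nonneg_pos)
    have r: "r > 0" using e' nn by (simp add: r_def)
    have ball: "dist (x + a *\<^sub>R u + b *\<^sub>R v) x < e'" if "0 \<le> a" "a \<le> s" "0 \<le> b" "b \<le> s" "0 < s" "s < r" for a b s
    proof -
      have "norm (a *\<^sub>R u + b *\<^sub>R v) \<le> norm (a *\<^sub>R u) + norm (b *\<^sub>R v)" by (rule norm_triangle_ineq)
      also have "\<dots> \<le> s * norm u + s * norm v" using that by (auto intro!: add_mono mult_right_mono)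
      also have "\<dots> < s * (norm u + norm v + 1)" using that by (simp add: algebra_simps)
      also have "\<dots> < r * (norm u + norm v + 1)" using that nn by simp
      also have "\<dots> = e'" using nn by (simp add: r_def)
      finally show ?thesis by (simp add: dist_norm add.assoc)
    qed
    have inS: "x + a *\<^sub>R u + b *\<^sub>R v \<in> S" if "0 \<le> a" "a \<le> s" "0 \<le> b" "b \<le> s" "0 < s" "s < r" for a b s
      using ball[OF that] e'(3) by (auto simp: dist_commute)
    have "\<exists>y. dist y x < e \<and> 
      f (x + s *\<^sub>R u + s *\<^sub>R v) - f (x + s *\<^sub>R u) - f (x + s *\<^sub>R v) + f x = s * s * \<D> (\<lambda>y. \<D> f y u) y v"
      if s: "0 < s" "s < r" for s
    proof -
      have D1: "((\<lambda>a. f (x + a *\<^sub>R u + s *\<^sub>R v) - f (x + a *\<^sub>R u)) has_real_derivative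
         (\<D> f (x + a *\<^sub>R u + s *\<^sub>R v) u - \<D> f (x + a *\<^sub>R u) u)) (at a)" if a: "0 \<le> a" "a \<le> s" for a
      proof -
        have "((\<lambda>a. f (x + a *\<^sub>R u + b *\<^sub>R v)) has_real_derivative
          \<D> f (x + a *\<^sub>R u + b *\<^sub>R v) u) (at a)" if b: "0 \<le> b" "b \<le> s" for b
        proof -
          have fd: "(f has_derivative \<D> f (x + a *\<^sub>R u + b *\<^sub>R v)) (at (x + a *\<^sub>R u + b *\<^sub>R v))"
            by (rule smooth_on_has_derivative[OF f inS[OF a b s]])
          have "((\<lambda>a. f (x + a *\<^sub>R u + b *\<^sub>R v)) has_derivative (\<lambda>h. \<D> f (x + a *\<^sub>R u + b *\<^sub>R v) (h *\<^sub>R u))) (at a)"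
            by (rule has_derivative_compose[where f="\<lambda>a. x + a *\<^sub>R u + b *\<^sub>R v" and g=f, OF _ fd]) (auto intro!: derivative_eq_intros)
          then show ?thesis
            unfolding has_field_derivative_def
            by (rule has_derivative_eq_rhs)
              (auto simp: linear.scaleR[OF has_derivative_linear[OF fd]])
        qed
        from this[of s] this[of 0] s show ?thesis by (intro DERIV_diff) auto
      qed
      obtain a where a: "0 < a" "a < s" and aeq:
        "(f (x + s *\<^sub>R u + s *\<^sub>R v) - f (x + s *\<^sub>R u)) - (f (x + 0 *\<^sub>R u + s *\<^sub>R v) - f (x + 0 *\<^sub>R u)) =
          (s - 0) * (\<D> f (x + a *\<^sub>R u + s *\<^sub>R v) u - \<D> f (x + a *\<^sub>R u) u)"
        using MVT2[OF s(1) D1] by (metis)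
      have D2: "((\<lambda>b. \<D> f (x + a *\<^sub>R u + b *\<^sub>R v) u) has_real_derivative
         (\<D> (\<lambda>y. \<D> f y u) (x + a *\<^sub>R u + b *\<^sub>R v) v)) (at b)" if b: "0 \<le> b" "b \<le> s" for b
      proof -
        let ?y = "x + a *\<^sub>R u + b *\<^sub>R v"
        have fd: "((\<lambda>y. \<D> f y u) has_derivative \<D> (\<lambda>y. \<D> f y u) ?y) (at ?y)"
          by (rule smooth_on_has_derivative[OF smooth_on_deriv[OF f] inS[OF _ _ b s]]) (use a in auto)
        have "((\<lambda>b. \<D> f (x + a *\<^sub>R u + b *\<^sub>R v) u) has_derivative (\<lambda>h. \<D> (\<lambda>y. \<D> f y u) ?y (h *\<^sub>R v))) (at b)"
          by (rule has_derivative_compose[where f="\<lambda>b. x + a *\<^sub>R u + b *\<^sub>R v" and g="\<lambda>y. \<D> f y u", OF _ fd]) (auto intro!: derivative_eq_intros)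
        then show ?thesis
          unfolding has_field_derivative_def
          by (rule has_derivative_eq_rhs)
            (auto simp: linear.scaleR[OF has_derivative_linear[OF fd]])
      qed
      obtain b where b: "0 < b" "b < s" and beq:
        "\<D> f (x + a *\<^sub>R u + s *\<^sub>R v) u - \<D> f (x + a *\<^sub>R u + 0 *\<^sub>R v) u =
          (s - 0) * \<D> (\<lambda>y. \<D> f y u) (x + a *\<^sub>R u + b *\<^sub>R v) v"
        using MVT2[OF s(1) D2] by (metis)
      show ?thesis
        by (rule exI[of _ "x + a *\<^sub>R u + b *\<^sub>R v"])
          (use aeq beq ball[of a s b] a b s e'(2) in \<open>auto simp: algebra_simps\<close>)
    qed
    then show ?thesis using r by blast
  qed
  define A where "A = \<D> (\<lambda>y. \<D> f y u) x v"
  define B where "B = \<D> (\<lambda>y. \<D> f y v) x u"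
  have "\<bar>A - B\<bar> \<le> 2 * e" if "e > 0" for e
  proof -
    have cA: "continuous (at x) (\<lambda>y. \<D> (\<lambda>y. \<D> f y u) y v)" and cB: "continuous (at x) (\<lambda>y. \<D> (\<lambda>y. \<D> f y v) y u)"
      using smooth_on_continuous[OF smooth_on_deriv[OF smooth_on_deriv[OF f]]] S
      by (auto simp: continuous_on_eq_continuous_at)
    obtain dA where dA: "dA > 0" "\<And>y. dist y x < dA \<Longrightarrow> \<bar>\<D> (\<lambda>y. \<D> f y u) y v - A\<bar> < e"
      using cA[unfolded continuous_at_eps_delta, rule_format, OF \<open>e > 0\<close>]
      unfolding A_def dist_real_def by blast
    obtain dB where dB: "dB > 0" "\<And>y. dist y x < dB \<Longrightarrow> \<bar>\<D> (\<lambda>y. \<D> f y v) y u - B\<bar> < e"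
      using cB[unfolded continuous_at_eps_delta, rule_format, OF \<open>e > 0\<close>]
      unfolding B_def dist_real_def by blast
    obtain r1 r2 where r: "r1 > 0" "r2 > 0"
      "\<And>s. 0 < s \<Longrightarrow> s < r1 \<Longrightarrow> (\<exists>y. dist y x < dA \<and> 
      f (x + s *\<^sub>R u + s *\<^sub>R v) - f (x + s *\<^sub>R u) - f (x + s *\<^sub>R v) + f x = s * s * \<D> (\<lambda>y. \<D> f y u) y v)"
      "\<And>s. 0 < s \<Longrightarrow> s < r2 \<Longrightarrow> (\<exists>y. dist y x < dB \<and> 
      f (x + s *\<^sub>R v + s *\<^sub>R u) - f (x + s *\<^sub>R v) - f (x + s *\<^sub>R u) + f x = s * s * \<D> (\<lambda>y. \<D> f y v) y u)"
      using *[OF dA(1), of u v] *[OF dB(1), of v u] by blast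
    define s where "s = min r1 r2 / 2"
    have s: "0 < s" "s < r1" "s < r2" using r by (auto simp: s_def)
    obtain y1 y2 where y: "dist y1 x < dA" "dist y2 x < dB"
      "f (x + s *\<^sub>R u + s *\<^sub>R v) - f (x + s *\<^sub>R u) - f (x + s *\<^sub>R v) + f x = s * s * \<D> (\<lambda>y. \<D> f y u) y1 v"
      "f (x + s *\<^sub>R v + s *\<^sub>R u) - f (x + s *\<^sub>R v) - f (x + s *\<^sub>R u) + f x = s * s * \<D> (\<lambda>y. \<D> f y v) y2 u"
      using r(3)[OF s(1,2)] r(4)[OF s(1,3)] by blast
    have eq: "x + s *\<^sub>R v + s *\<^sub>R u = x + s *\<^sub>R u + s *\<^sub>R v" by simp
    have "s * s * \<D> (\<lambda>y. \<D> f y u) y1 v = s * s * \<D> (\<lambda>y. \<D> f y v) y2 u"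
      using y(3) y(4)[unfolded eq] by linarith
    then have "\<D> (\<lambda>y. \<D> f y u) y1 v = \<D> (\<lambda>y. \<D> f y v) y2 u" using s by simp
    then show ?thesis using dA(2)[OF y(1)] dB(2)[OF y(2)] by linarith
  qed
  from this[of "\<bar>A - B\<bar> / 4"] have "A = B" by (cases "A = B") auto
  then show ?thesis by (simp add: A_def B_def)
qed

lemma mixed_partials:
  fixes f :: "'a::real_normed_vector \<Rightarrow> 'b::euclidean_space"
  assumes S: "open S" "x \<in> S" and f: "smooth_on S f"
  shows "\<D> (\<lambda>y. \<D> f y v) x u = \<D> (\<lambda>y. \<D> f y u) x v"
proof (rule euclidean_eqI)
  fix b :: 'b assume "b \<in> Basis"
  have fb: "smooth_on S (\<lambda>y. f y \<bullet> b)"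
    by (rule smooth_on_bounded_linear[OF bounded_linear_inner_left S(1) f])
  have 1: "\<D> (\<lambda>y. f y \<bullet> b) y w = \<D> f y w \<bullet> b" if "y \<in> S" for y w
    by (rule has_derivative_along)
      (rule bounded_linear.has_derivative[OF bounded_linear_inner_left smooth_on_has_derivative[OF f that]])
  have 2: "\<D> (\<lambda>y. \<D> (\<lambda>y. f y \<bullet> b) y v) x u = \<D> (\<lambda>y. \<D> f y v) x u \<bullet> b" for u v
  proof (rule has_derivative_along, rule has_derivative_transform_within_open[OF _ S])
    show "((\<lambda>y. \<D> f y v \<bullet> b) has_derivative (\<lambda>u. \<D> (\<lambda>y. \<D> f y v) x u \<bullet> b)) (at x)"
      by (rule bounded_linear.has_derivative[OF bounded_linear_inner_left
          smooth_on_has_derivative[OF smooth_on_deriv[OF f] S(2)]])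
  qed (simp add: 1)
  show "\<D> (\<lambda>y. \<D> f y v) x u \<bullet> b = \<D> (\<lambda>y. \<D> f y u) x v \<bullet> b"
    using mixed_partials_real[OF S fb, of v u] by (simp add: 2)
qed

text \<open>Points of the level set near \<open>x + s w\<close> are found as \<open>x + s w + \<sigma> n\<close> with \<open>\<sigma> = o(s)\<close> by the
  intermediate value theorem, with \<open>n\<close> transverse to the level set.\<close>

lemma deriv_zero_on_level_set:
  fixes h :: "'a::real_normed_vector \<Rightarrow> real" and \<phi> :: "'a \<Rightarrow> 'b::real_normed_vector"
  assumes S: "open S" "x \<in> S" and h: "smooth_on S h"
    and n: "\<D> h x n \<noteq> 0" and w: "\<D> h x w = 0"
    and \<phi>: "(\<phi> has_derivative \<phi>') (at x)" and zero: "\<And>y. y \<in> S \<Longrightarrow> h y = h x \<Longrightarrow> \<phi> y = 0"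
  shows "\<phi>' w = 0"
proof -
  have main: "norm (\<phi>' w) \<le> e" if e: "e > 0" and n: "\<D> h x n > 0" for e n
  proof -
    have hd: "(h has_derivative \<D> h x) (at x)" by (rule smooth_on_has_derivative[OF h S(2)])
    have lh: "linear (\<D> h x)" and lp: "linear \<phi>'"
      using hd \<phi> has_derivative_linear by blast+
    \<comment> \<open>A correction by at most \<open>\<delta>\<close> along \<open>n\<close> changes
      the value of \<open>\<phi>'\<close> by at most \<open>e / 2\<close>.\<close>
    obtain \<delta> where \<delta>: "\<delta> > 0" "\<delta> \<le> 1" "\<delta> * norm (\<phi>' n) \<le> e / 2"
    proof
      show "min 1 (e / 2 / (norm (\<phi>' n) + 1)) > 0" using e by (simp add: add_nonneg_pos)
      have "min 1 (e / 2 / (norm (\<phi>' n) + 1)) * norm (\<phi>' n) \<le> e / 2 / (norm (\<phi>' n) + 1) * (norm (\<phi>' n) + 1)"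
        using e by (intro mult_mono) auto
      also have "\<dots> = e / 2" by (metis add_nonneg_pos less_irrefl nonzero_eq_divide_eq norm_ge_zero zero_less_one)
      finally show "min 1 (e / 2 / (norm (\<phi>' n) + 1)) * norm (\<phi>' n) \<le> e / 2" .
    qed auto
    define M where "M = norm w + norm n + 1"
    have M: "M > 0" by (simp add: M_def add_nonneg_pos)
    obtain d where d: "d > 0" "ball x d \<subseteq> S" using S openE by blast
    have a: "\<D> h x n * \<delta> / (2 * M) > 0" using n \<delta> M by simp
    obtain d1 where d1: "d1 > 0" "\<And>y. norm (y - x) < d1 \<Longrightarrow>
        norm (h y - h x - \<D> h x (y - x)) \<le> \<D> h x n * \<delta> / (2 * M) * norm (y - x)"
      using hd a unfolding has_derivative_at_alt by blast
    have a': "e / (2 * M) > 0" using e M by simp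
    obtain d2 where d2: "d2 > 0" "\<And>y. norm (y - x) < d2 \<Longrightarrow>
        norm (\<phi> y - \<phi> x - \<phi>' (y - x)) \<le> e / (2 * M) * norm (y - x)"
      using \<phi> a' unfolding has_derivative_at_alt by blast
    \<comment> \<open>Displacements are bounded by \<open>s * M\<close>, here half of the smallest
      of the three radii.\<close>
    define s where "s = min d (min d1 d2) / (2 * M)"
    have s: "s > 0" using d d1 d2 M by (simp add: s_def)
    have sM: "s * M < d" "s * M < d1" "s * M < d2" using d d1 d2 M by (auto simp: s_def)
    have nb: "norm (s *\<^sub>R w + (s * \<sigma>) *\<^sub>R n) \<le> s * M" if "\<bar>\<sigma>\<bar> \<le> \<delta>" for \<sigma>
    proof -
      have "norm (s *\<^sub>R w + (s * \<sigma>) *\<^sub>R n) \<le> s * norm w + s * \<bar>\<sigma>\<bar> * norm n"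
        using norm_triangle_ineq[of "s *\<^sub>R w" "(s * \<sigma>) *\<^sub>R n"] s by (simp add: abs_mult)
      also have "\<dots> \<le> s * norm w + s * 1 * norm n"
        using that \<delta>(2) s by (intro add_left_mono mult_right_mono mult_left_mono) auto
      also have "\<dots> \<le> s * M" using s by (simp add: M_def algebra_simps)
      finally show ?thesis .
    qed
    define g where "g \<sigma> = h (x + (s *\<^sub>R w + (s * \<sigma>) *\<^sub>R n)) - h x" for \<sigma>
    have inS: "x + (s *\<^sub>R w + (s * \<sigma>) *\<^sub>R n) \<in> S" if "\<bar>\<sigma>\<bar> \<le> \<delta>" for \<sigma>
      using le_less_trans[OF nb[OF that] sM(1)] subsetD[OF d(2), of "x + (s *\<^sub>R w + (s * \<sigma>) *\<^sub>R n)"]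
      by (metis add_diff_cancel_left' dist_norm dist_commute mem_ball)
    \<comment> \<open>The linearisation error is at most half of the leading term at
      \<open>\<sigma> = \<delta>\<close>, which fixes the signs of \<open>g\<close> at both ends of
      the interval.\<close>
    have gb: "\<bar>g \<sigma> - s * \<sigma> * \<D> h x n\<bar> \<le> s * (\<D> h x n * \<delta> / 2)" if "\<bar>\<sigma>\<bar> \<le> \<delta>" for \<sigma>
    proof -
      have "\<bar>g \<sigma> - s * \<sigma> * \<D> h x n\<bar> \<le> \<D> h x n * \<delta> / (2 * M) * norm (s *\<^sub>R w + (s * \<sigma>) *\<^sub>R n)"
        using d1(2)[of "x + (s *\<^sub>R w + (s * \<sigma>) *\<^sub>R n)"] nb[OF that] sM w
        by (simp add: g_def linear_add[OF lh] linear.scaleR[OF lh])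
      also have "\<dots> \<le> \<D> h x n * \<delta> / (2 * M) * (s * M)"
        using nb[OF that] a by (intro mult_left_mono) auto
      also have "\<dots> = s * (\<D> h x n * \<delta> / 2)" using M by simp
      finally show ?thesis .
    qed
    have pos: "s * (\<D> h x n * \<delta>) > 0" using s n \<delta> by simp
    have "s * (- \<delta>) * \<D> h x n = - (s * (\<D> h x n * \<delta>))" "s * \<delta> * \<D> h x n = s * (\<D> h x n * \<delta>)"
      "s * (\<D> h x n * \<delta> / 2) = s * (\<D> h x n * \<delta>) / 2" by simp_all
    then have "g (- \<delta>) \<le> 0" "g \<delta> \<ge> 0"
      using gb[of "- \<delta>"] gb[of \<delta>] \<delta>(1) pos by (simp_all only: abs_le_iff) linarith+
    moreover
    have "continuous_on {-\<delta>..\<delta>} g"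
      unfolding g_def using inS
      by (intro continuous_intros continuous_on_compose2[OF smooth_on_continuous[OF h]]) (auto simp: abs_le_iff)
    ultimately obtain \<sigma> where \<sigma>: "-\<delta> \<le> \<sigma>" "\<sigma> \<le> \<delta>" "g \<sigma> = 0"
      using IVT'[of g "-\<delta>" 0 \<delta>] \<delta>(1) by auto
    have \<sigma>': "\<bar>\<sigma>\<bar> \<le> \<delta>" using \<sigma> by auto
    define y where "y = x + (s *\<^sub>R w + (s * \<sigma>) *\<^sub>R n)"
    have "\<phi> y = 0" using zero[OF inS[OF \<sigma>']] \<sigma>(3) by (simp add: g_def y_def)
    moreover have "\<phi> x = 0" using zero[OF S(2)] by simp
    moreover have "norm (y - x) < d2" using nb[OF \<sigma>'] sM by (simp add: y_def)
    ultimately have "norm (\<phi>' (y - x)) \<le> e / (2 * M) * norm (y - x)" using d2(2)[of y] by simp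
    also have "\<dots> \<le> e / (2 * M) * (s * M)" using nb[OF \<sigma>'] a' by (intro mult_left_mono) (auto simp: y_def)
    also have "\<dots> = s * (e / 2)" using M by simp
    also have "\<phi>' (y - x) = s *\<^sub>R (\<phi>' w + \<sigma> *\<^sub>R \<phi>' n)"
      by (simp add: y_def linear_add[OF lp] linear.scaleR[OF lp] scaleR_add_right)
    finally have "norm (\<phi>' w + \<sigma> *\<^sub>R \<phi>' n) \<le> e / 2" using s by simp
    moreover have "norm (\<sigma> *\<^sub>R \<phi>' n) \<le> e / 2"
      using \<delta>(3) mult_right_mono[OF \<sigma>' norm_ge_zero[of "\<phi>' n"]] by simp
    ultimately show ?thesis
      using norm_triangle_ineq4[of "\<phi>' w + \<sigma> *\<^sub>R \<phi>' n" "\<sigma> *\<^sub>R \<phi>' n"] by simp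
  qed
  have lh: "linear (\<D> h x)" using smooth_on_linear_deriv[OF h S(2)] .
  obtain n where "\<D> h x n > 0"
    using n linear_neg[OF lh, of n] by (metis linorder_neqE_linordered_idom neg_0_less_iff_less)
  then have "norm (\<phi>' w) \<le> e" if "e > 0" for e using main[OF that] by blast
  then have "norm (\<phi>' w) \<le> 0" by (rule field_le_epsilon) simp
  then show ?thesis by simp
qed

section \<open>Differentiation rules for smooth maps\<close>

lemma deriv_cong:
  assumes "open S" "x \<in> S" "\<And>y. y \<in> S \<Longrightarrow> f y = g y" "smooth_on S f"
  shows "\<D> f x = \<D> g x"
  using has_derivative_along[OF has_derivative_transform_within_open[OF
    smooth_on_has_derivative[OF assms(4,2)] assms(1,2)]] assms(3) by (metis ext)

lemma deriv_add: "smooth_on S f \<Longrightarrow> smooth_on S g \<Longrightarrow> x \<in> S \<Longrightarrow> \<D> (\<lambda>y. f y + g y) x u = \<D> f x u + \<D> g x u"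
  by (rule has_derivative_along) (intro has_derivative_add smooth_on_has_derivative)

lemma deriv_diff: "smooth_on S f \<Longrightarrow> smooth_on S g \<Longrightarrow> x \<in> S \<Longrightarrow> \<D> (\<lambda>y. f y - g y) x u = \<D> f x u - \<D> g x u"
  by (rule has_derivative_along) (intro has_derivative_diff smooth_on_has_derivative)

lemma deriv_scaleR_const: "smooth_on S f \<Longrightarrow> x \<in> S \<Longrightarrow> \<D> (\<lambda>y. c *\<^sub>R f y) x u = c *\<^sub>R \<D> f x u"
  by (rule has_derivative_along) (intro has_derivative_scaleR_right smooth_on_has_derivative)

lemma deriv_mult:
  fixes f g :: "_ \<Rightarrow> real"
  shows "smooth_on S f \<Longrightarrow> smooth_on S g \<Longrightarrow> x \<in> S \<Longrightarrow> \<D> (\<lambda>y. f y * g y) x u = f x * \<D> g x u + \<D> f x u * g x"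
  by (rule has_derivative_along) (intro has_derivative_mult smooth_on_has_derivative)

lemma linear_deriv_family:
  assumes "open S" "x \<in> S" "\<And>y. y \<in> S \<Longrightarrow> linear (L y)" "\<And>v. smooth_on S (\<lambda>y. L y v)"
  shows "linear (\<lambda>v. \<D> (\<lambda>y. L y v) x u)"
proof (rule linearI)
  show "\<D> (\<lambda>y. L y (v + w)) x u = \<D> (\<lambda>y. L y v) x u + \<D> (\<lambda>y. L y w) x u" for v w
  proof -
    have "\<D> (\<lambda>y. L y (v + w)) x = \<D> (\<lambda>y. L y v + L y w) x"
      by (rule deriv_cong[OF assms(1,2)]) (use assms(4) linear_add[OF assms(3)] in auto)
    then show ?thesis by (simp add: deriv_add[OF assms(4,4,2)])
  qed
  show "\<D> (\<lambda>y. L y (c *\<^sub>R v)) x u = c *\<^sub>R \<D> (\<lambda>y. L y v) x u" for c v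
  proof -
    have "\<D> (\<lambda>y. L y (c *\<^sub>R v)) x = \<D> (\<lambda>y. c *\<^sub>R L y v) x"
      by (rule deriv_cong[OF assms(1,2)]) (use assms(4) linear.scaleR[OF assms(3)] in auto)
    then show ?thesis by (simp add: deriv_scaleR_const[OF assms(4,2)])
  qed
qed

subsection \<open>Inner products and symmetric operators\<close>

locale inner_form =
  fixes g :: "'a::euclidean_space \<Rightarrow> 'a \<Rightarrow> real"
  assumes bil: "bilinear g" and sym: "g u v = g v u" and pos: "u \<noteq> 0 \<Longrightarrow> g u u > 0"
begin

lemmas ladd = bilinear_ladd[OF bil] and radd = bilinear_radd[OF bil]
  and lsub = bilinear_lsub[OF bil] and rsub = bilinear_rsub[OF bil]
  and lzero = bilinear_lzero[OF bil] and rzero = bilinear_rzero[OF bil]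
  and lneg = bilinear_lneg[OF bil] and rneg = bilinear_rneg[OF bil]

lemma lmul: "g (c *\<^sub>R u) v = c * g u v" and rmul: "g u (c *\<^sub>R v) = c * g u v"
  using bilinear_lmul[OF bil, of c u v] bilinear_rmul[OF bil, of u c v] by auto

lemmas form_simps = ladd radd lsub rsub lzero rzero lneg rneg lmul rmul

lemma lin_right: "linear (g u)" using bil by (simp add: bilinear_def)
lemma lin_left: "linear (\<lambda>u. g u v)" using bil by (simp add: bilinear_def)

lemma lsum: "g (sum f A) v = (\<Sum>i\<in>A. g (f i) v)" by (rule linear_sum[OF lin_left])
lemma rsum: "g v (sum f A) = (\<Sum>i\<in>A. g v (f i))" by (rule linear_sum[OF lin_right])

lemma eqI: assumes "\<And>w. g u w = g v w" shows "u = v"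
  using pos[of "u - v"] assms[of "u - v"] by (force simp: form_simps)

lemma nonneg: "g u u \<ge> 0" using pos[of u] by (cases "u = 0") (auto simp: form_simps)

text \<open>The musical isomorphism, with the dual space identified with the space itself through
  the Euclidean inner product. As an endomorphism it falls under
  \<open>smooth_on_inverse_family\<close>.\<close>

definition flat :: "'a \<Rightarrow> 'a" where "flat w = (\<Sum>b\<in>Basis. g w b *\<^sub>R b)"

lemma flat_inner: "flat w \<bullet> v = g w v"
  using arg_cong[OF euclidean_representation[of v], of "g w"]
  unfolding flat_def inner_sum_left rsum by (simp add: rmul inner_commute mult.commute)

lemma linear_flat: "linear flat"
  unfolding flat_def by (rule linearI) (auto simp: form_simps sum.distrib algebra_simps scaleR_sum_right)

lemma bij_flat: "bij flat"
proof -
  have "inj flat" using eqI flat_inner by (metis injI)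
  then show ?thesis using linear_injective_imp_surjective[OF linear_flat] bij_def by blast
qed

lemma linear_inv_flat: "linear (inv flat)"
  using bij_flat linear_flat by (meson bij_def inj_linear_imp_inv_linear)

lemma inv_flat: "g (inv flat w) v = w \<bullet> v"
  using bij_flat flat_inner[of "inv flat w" v] by (simp add: bij_is_surj surj_f_inv_f)

lemma representation_of_linear: assumes "linear \<phi>" shows "g (inv flat (\<Sum>b\<in>Basis. \<phi> b *\<^sub>R b)) v = \<phi> v"
proof -
  have "\<phi> v = \<phi> (\<Sum>b\<in>Basis. (v \<bullet> b) *\<^sub>R b)" by (simp add: euclidean_representation)
  also have "\<dots> = (\<Sum>b\<in>Basis. \<phi> b *\<^sub>R b) \<bullet> v"
    unfolding inner_sum_left by (simp add: linear_sum[OF assms] linear.scaleR[OF assms] inner_commute mult.commute)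
  finally show ?thesis by (simp add: inv_flat)
qed

text \<open>A maximiser \<open>v\<close> of the Rayleigh quotient is an eigenvector: at the maximum
  \<open>s\<close> the form \<open>b\<close> is positive semidefinite on \<open>W\<close> and
  vanishes at \<open>v\<close>, hence \<open>b v u = 0\<close> for all \<open>u\<close> in
  \<open>W\<close>. The quotient is homogeneous of degree 0, so the maximum may be taken over the
  compact Euclidean unit sphere although the form is \<open>g\<close>.\<close>

lemma symmetric_has_eigenvector:
  assumes W: "subspace W" "W \<noteq> {0}" and A: "linear A" "A ` W \<subseteq> W"
    and sA: "\<And>u v. u \<in> W \<Longrightarrow> v \<in> W \<Longrightarrow> g (A u) v = g u (A v)"
  obtains v s where "v \<in> W" "v \<noteq> 0" "A v = s *\<^sub>R v"
proof -
  define K where "K = {v \<in> W. norm v = 1}"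
  have "K = W \<inter> sphere 0 1" by (auto simp: K_def)
  then have cK: "compact K" using closed_Int_compact[OF closed_subspace[OF W(1)]] by auto
  obtain w where w: "w \<in> W" "w \<noteq> 0" using W subspace_0 by blast
  then have "w /\<^sub>R norm w \<in> K" using W(1) by (auto simp: K_def subspace_scale)
  then have neK: "K \<noteq> {}" by blast
  have bb: "bounded_bilinear g" using bil bilinear_conv_bounded_bilinear by blast
  have blA: "bounded_linear A" using A(1) linear_conv_bounded_linear by blast
  have "continuous_on K (\<lambda>v. g (A v) v / g v v)"
    by (intro continuous_on_divide bounded_bilinear.continuous_on[OF bb]
        bounded_linear.continuous_on[OF blA] continuous_on_id)
      (metis (mono_tags, lifting) K_def less_irrefl mem_Collect_eq norm_zero pos zero_neq_one)
  then obtain v where v: "v \<in> K" and max: "\<And>u. u \<in> K \<Longrightarrow> g (A u) u / g u u \<le> g (A v) v / g v v"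
    using continuous_attains_sup[OF cK neK] by blast
  define s where "s = g (A v) v / g v v"
  have v': "v \<in> W" "v \<noteq> 0" using v by (auto simp: K_def)
  define b where "b u w = s * g u w - g (A u) w" for u w
  have b0: "b v v = 0" using pos[OF v'(2)] by (simp add: b_def s_def)
  have bpos: "b u u \<ge> 0" if "u \<in> W" for u
  proof (cases "u = 0")
    case False
    define u' where "u' = u /\<^sub>R norm u"
    have "u' \<in> K" using that False W(1) by (auto simp: K_def u'_def subspace_scale)
    then have "g (A u') u' / g u' u' \<le> s" using max by (simp add: s_def)
    moreover have "u' \<noteq> 0" using False by (simp add: u'_def)
    ultimately have "g (A u') u' \<le> s * g u' u'" using pos[of u'] by (simp add: divide_le_eq)
    moreover have "u = norm u *\<^sub>R u'" using False by (simp add: u'_def)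
    then have "b u u = norm u * norm u * (s * g u' u' - g (A u') u')"
      unfolding b_def by (metis (no_types, lifting) lmul rmul linear.scaleR[OF A(1)] mult.assoc mult.left_commute right_diff_distrib)
    ultimately show ?thesis by simp
  qed (simp add: b_def form_simps linear_0[OF A(1)])
  have bvu: "b v u = 0" if u: "u \<in> W" for u
  proof -
    have ineq: "2 * t * b v u + t * t * b u u \<ge> 0" for t
    proof -
      have "b (v + t *\<^sub>R u) (v + t *\<^sub>R u) \<ge> 0"
        by (rule bpos) (use W(1) v' u in \<open>auto intro: subspace_add subspace_scale\<close>)
      moreover have "b (v + t *\<^sub>R u) (v + t *\<^sub>R u) = b v v + 2 * t * b v u + t * t * b u u"
        using sA[OF u v'(1)] sym[of u v] sym[of u "A v"]
        by (simp add: b_def form_simps linear_add[OF A(1)] linear.scaleR[OF A(1)] algebra_simps)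
      ultimately show ?thesis using b0 by simp
    qed
    have bu: "b u u \<ge> 0" by (rule bpos[OF u])
    \<comment> \<open>Close to the minimiser \<open>- b v u / b u u\<close> of the quadratic. The
      added 1 keeps the denominator positive and still leaves a negative multiple of the square of
      \<open>b v u\<close>.\<close>
    define t where "t = - b v u / (b u u + 1)"
    define d where "d = b u u + 1"
    have td: "t * d = - b v u" using bu by (simp add: t_def d_def)
    have "0 \<le> (2 * t * b v u + t * t * b u u) * (d * d)"
      using ineq[of t] by (intro mult_nonneg_nonneg[OF _ zero_le_square])
    also have "\<dots> = 2 * (t * d) * b v u * d + (t * d) * (t * d) * b u u" by (simp add: algebra_simps)
    also have "\<dots> = - (b v u * b v u * (b u u + 2))" unfolding td by (simp add: d_def algebra_simps)
    finally have "b v u * b v u * (b u u + 2) \<le> 0" by simp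
    then have "b v u * b v u \<le> 0" using bu by (simp add: mult_le_0_iff)
    then show ?thesis by (simp add: mult_le_0_iff) linarith
  qed
  define u where "u = s *\<^sub>R v - A v"
  have "u \<in> W" using W(1) v' A(2) by (auto simp: u_def intro: subspace_diff subspace_scale)
  moreover have "b v w = g u w" for w by (simp add: b_def u_def form_simps)
  ultimately have "g u u = 0" using bvu by metis
  then have "A v = s *\<^sub>R v" using pos[of u] by (cases "u = 0") (auto simp: u_def)
  then show ?thesis using that v' by blast
qed

section \<open>Orthonormal eigenbases and dimensions of eigenspaces\<close>

definition orthonormal :: "'a set \<Rightarrow> bool" where
  "orthonormal B \<longleftrightarrow> finite B \<and> (\<forall>u\<in>B. \<forall>v\<in>B. g u v = (if u = v then 1 else 0))"

text \<open>Induction on the dimension: symmetry of \<open>A\<close> makes the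
  \<open>g\<close>-orthogonal complement of an eigenvector inside \<open>W\<close>
  invariant.\<close>

lemma symmetric_eigenbasis:
  assumes "subspace W" and A: "linear A" "A ` W \<subseteq> W"
    and sA: "\<And>u v. u \<in> W \<Longrightarrow> v \<in> W \<Longrightarrow> g (A u) v = g u (A v)"
  shows "\<exists>B. orthonormal B \<and> span B = W \<and> (\<forall>u\<in>B. \<exists>s. A u = s *\<^sub>R u)"
  using assms(1,3,4)
proof (induction "dim W" arbitrary: W rule: less_induct)
  case less
  show ?case
  proof (cases "W = {0}")
    case True
    then show ?thesis by (intro exI[of _ "{}"]) (auto simp: orthonormal_def)
  next
    case False
    obtain v s where v: "v \<in> W" "v \<noteq> 0" "A v = s *\<^sub>R v"
      using symmetric_has_eigenvector[OF less.prems(1) False A(1) less.prems(2,3)] by blast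
    define e where "e = (1 / sqrt (g v v)) *\<^sub>R v"
    have e: "e \<in> W" "A e = s *\<^sub>R e" "g e e = 1"
      using v pos[OF v(2)] less.prems(1) real_sqrt_pow2[of "g v v"]
      by (auto simp: e_def subspace_scale linear.scaleR[OF A(1)] form_simps power2_eq_square field_simps)
    define W' where "W' = {u \<in> W. g e u = 0}"
    have W': "subspace W'"
      using less.prems(1) by (auto simp: W'_def subspace_def form_simps)
    have "e \<notin> W'" using e by (simp add: W'_def)
    then have "W' \<subset> W" using e(1) by (auto simp: W'_def)
    then have d: "dim W' < dim W"
      by (intro dim_psubset) (metis W' less.prems(1) span_eq_iff)
    have AW': "A ` W' \<subseteq> W'"
    proof
      fix w assume "w \<in> A ` W'"
      then obtain u where u: "u \<in> W" "g e u = 0" "w = A u" by (auto simp: W'_def)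
      have "g e (A u) = g (A e) u" using less.prems(3)[OF e(1) u(1)] by simp
      then show "w \<in> W'" using u less.prems(2) e(2) by (auto simp: W'_def form_simps)
    qed
    have "\<exists>B. orthonormal B \<and> span B = W' \<and> (\<forall>u\<in>B. \<exists>s. A u = s *\<^sub>R u)"
      by (rule less.hyps[OF d W' AW']) (use less.prems(3) in \<open>auto simp: W'_def\<close>)
    then obtain B where B: "orthonormal B" "span B = W'" "\<forall>u\<in>B. \<exists>s. A u = s *\<^sub>R u" by blast
    have BW': "B \<subseteq> W'" using B(2) span_superset by blast
    then have "orthonormal (insert e B)"
      using B(1) e \<open>e \<notin> W'\<close> sym by (auto simp: orthonormal_def W'_def)
    moreover have "span (insert e B) = W"
    proof
      show "span (insert e B) \<subseteq> W"
        using less.prems(1) e(1) BW' \<open>W' \<subset> W\<close> by (intro span_minimal) auto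
      show "W \<subseteq> span (insert e B)"
      proof
        fix u assume u: "u \<in> W"
        have "u - g e u *\<^sub>R e \<in> W'"
          using u e less.prems(1) by (auto simp: W'_def form_simps intro: subspace_diff subspace_scale)
        then have "u - g e u *\<^sub>R e \<in> span B" using B(2) by simp
        then show "u \<in> span (insert e B)" unfolding span_insert by blast
      qed
    qed
    ultimately show ?thesis using B(3) e(2) by (intro exI[of _ "insert e B"]) auto
  qed
qed

lemma orthonormal_expand:
  assumes "orthonormal B" "v \<in> span B" shows "v = (\<Sum>b\<in>B. g v b *\<^sub>R b)"
proof -
  have fin: "finite B" using assms by (simp add: orthonormal_def)
  obtain c where c: "v = (\<Sum>b\<in>B. c b *\<^sub>R b)"
    using assms(2) span_finite[OF fin] by auto
  have "g v b = c b" if "b \<in> B" for b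
  proof -
    have "g v b = (\<Sum>a\<in>B. if a = b then c a else 0)"
      unfolding c lsum lmul using assms(1) that by (intro sum.cong) (auto simp: orthonormal_def)
    then show ?thesis using fin that by simp
  qed
  then show ?thesis using c by simp
qed

lemma orthonormal_parseval:
  assumes "orthonormal B" "v \<in> span B" shows "g v w = (\<Sum>b\<in>B. g v b * g w b)"
proof -
  have "g v w = g (\<Sum>b\<in>B. g v b *\<^sub>R b) w" using orthonormal_expand[OF assms] by simp
  then show ?thesis by (simp add: lsum lmul sym[of w])
qed

lemma orthonormal_independent: assumes "orthonormal B" shows "independent B"
proof -
  have fin: "finite B" using assms by (simp add: orthonormal_def)
  have "c b = 0" if s: "(\<Sum>b\<in>B. c b *\<^sub>R b) = 0" and b: "b \<in> B" for c b
  proof -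
    have "0 = g (\<Sum>b\<in>B. c b *\<^sub>R b) b" using s by (simp add: lzero)
    also have "\<dots> = (\<Sum>a\<in>B. if a = b then c a else 0)"
      unfolding lsum lmul using assms b by (intro sum.cong) (auto simp: orthonormal_def)
    finally show ?thesis using fin b by simp
  qed
  then show ?thesis using fin by (auto simp: dependent_finite)
qed

lemma eigenspace_eq_span:
  assumes B: "orthonormal B" and A: "linear A" and ev: "\<And>b. b \<in> B \<Longrightarrow> A b = \<sigma> b *\<^sub>R b"
  shows "{v \<in> span B. A v = \<mu> *\<^sub>R v} = span {b \<in> B. \<sigma> b = \<mu>}"
proof (intro equalityI subsetI)
  fix v assume v: "v \<in> {v \<in> span B. A v = \<mu> *\<^sub>R v}"
  have fin: "finite B" using B by (simp add: orthonormal_def)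
  have e: "v = (\<Sum>b\<in>B. g v b *\<^sub>R b)" using orthonormal_expand[OF B] v by blast
  have "g v b = 0" if b: "b \<in> B" "\<sigma> b \<noteq> \<mu>" for b
  proof -
    have "A v = (\<Sum>a\<in>B. (g v a * \<sigma> a) *\<^sub>R a)"
      by (subst e) (simp add: linear_sum[OF A] linear.scaleR[OF A] ev)
    then have "g (A v) b = (\<Sum>a\<in>B. if a = b then g v a * \<sigma> a else 0)"
      unfolding lsum lmul using B b by (simp add: lsum lmul) (intro sum.cong, auto simp: orthonormal_def)
    also have "\<dots> = g v b * \<sigma> b" using fin b by simp
    also have "g (A v) b = \<mu> * g v b" using v by (simp add: lmul)
    finally show ?thesis using b by (simp add: mult.commute)
  qed
  then have "v = (\<Sum>b\<in>{b \<in> B. \<sigma> b = \<mu>}. g v b *\<^sub>R b)"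
    by (subst e) (rule sum.mono_neutral_right, use fin in auto)
  then show "v \<in> span {b \<in> B. \<sigma> b = \<mu>}"
    by (metis (no_types, lifting) span_base span_scale span_sum)
next
  fix v assume v: "v \<in> span {b \<in> B. \<sigma> b = \<mu>}"
  have "span {b \<in> B. \<sigma> b = \<mu>} \<subseteq> {v. A v = \<mu> *\<^sub>R v}"
  proof (rule span_minimal)
    show "subspace {v. A v = \<mu> *\<^sub>R v}"
      unfolding subspace_def
      by (simp add: linear_add[OF A] linear.scaleR[OF A] linear_0[OF A] scaleR_add_right scaleR_left_commute)
  qed (use ev in auto)
  then show "v \<in> {v \<in> span B. A v = \<mu> *\<^sub>R v}" using v span_mono[of "{b \<in> B. \<sigma> b = \<mu>}" B] by blast
qed

text \<open>Turns multiplicities into counts of basis vectors, so that a sum weighted by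
  multiplicities becomes a sum over an eigenbasis.\<close>

lemma dim_eigenspace:
  assumes B: "orthonormal B" and A: "linear A" and ev: "\<And>b. b \<in> B \<Longrightarrow> A b = \<sigma> b *\<^sub>R b"
  shows "dim {v \<in> span B. A v = \<mu> *\<^sub>R v} = card {b \<in> B. \<sigma> b = \<mu>}"
proof -
  have "independent {b \<in> B. \<sigma> b = \<mu>}"
    by (rule independent_mono[OF orthonormal_independent[OF B]]) auto
  then have "dim (span {b \<in> B. \<sigma> b = \<mu>}) = card {b \<in> B. \<sigma> b = \<mu>}"
    unfolding dim_span by (rule dim_eq_card_independent)
  moreover have "{v \<in> span B. A v = \<mu> *\<^sub>R v} = span {b \<in> B. \<sigma> b = \<mu>}"
    by (rule eigenspace_eq_span[OF B A]) (rule ev)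
  ultimately show ?thesis by (simp only:)
qed

end

text \<open>Polarising \<open>zero\<close> makes \<open>D\<close> antisymmetric in the second and
  third arguments as well as in the first and second. It is then invariant under cyclic permutations
  of the first three, and the Bianchi identity reads \<open>3 * D x y z w = 0\<close>.\<close>

lemma curvature_tensor_eq_zero:
  fixes D :: "'a::ab_group_add \<Rightarrow> 'a \<Rightarrow> 'a \<Rightarrow> 'a \<Rightarrow> real"
  assumes add: "\<And>x x' y z w. D (x + x') y z w = D x y z w + D x' y z w"
      "\<And>x y y' z w. D x (y + y') z w = D x y z w + D x y' z w"
      "\<And>x y z z' w. D x y (z + z') w = D x y z w + D x y z' w"
      "\<And>x y z w w'. D x y z (w + w') = D x y z w + D x y z w'"
    and anti: "\<And>x y z w. D x y z w = - D y x z w" "\<And>x y z w. D x y z w = - D x y w z"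
    and bianchi: "\<And>x y z w. D x y z w + D y z x w + D z x y w = 0"
    and zero: "\<And>x y. D x y y x = 0"
  shows "D x y z w = 0"
proof -
  \<comment> \<open>Pair symmetry, from a combination of the Bianchi identities for the four cyclic
    rotations of the arguments.\<close>
  have pair: "D x y z w = D z w x y" for x y z w
    using bianchi[of x y z w] bianchi[of y z w x] bianchi[of z w x y] bianchi[of w x y z]
      anti(2)[of y z w x] anti(2)[of z w y x] anti(2)[of w x z y] anti(2)[of x y w z]
      anti(1)[of x z w y] anti(2)[of z x w y] anti(1)[of y w x z] anti(2)[of w y x z]
    by linarith
  have xyyz: "D x y y z = 0" for x y z
  proof -
    have "D (x + z) y y (x + z) = D x y y x + D z y y z + D x y y z + D z y y x" unfolding add by linarith
    moreover have "D z y y x = D x y y z"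
      using pair[of z y y x] anti(1)[of y x z y] anti(2)[of x y z y] by linarith
    ultimately show ?thesis using zero[of "x + z" y] zero[of x y] zero[of z y] by linarith
  qed
  have swap: "D x y z w = - D x z y w" for x y z w
    using xyyz[of x "y + z" w, unfolded add] xyyz[of x y w] xyyz[of x z w] by linarith
  show ?thesis
    using bianchi[of x y z w] swap[of y z x w] anti(1)[of x y z w] anti(1)[of z x y w] swap[of x y z w]
    by linarith
qed

subsection \<open>Riemannian metrics in a chart\<close>

text \<open>The difference of two candidates, paired with \<open>w\<close>, is symmetric in its
  first two arguments and antisymmetric in its last two, hence zero. Positivity is replaced by
  nondegeneracy so that the Lorentzian warped metric is covered.\<close>

lemma levi_civita_eqI:
  assumes G: "bilinear (G x)" "\<And>v w. G x v w = G x w v"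
    and nondeg: "\<And>v. (\<And>w. G x v w = 0) \<Longrightarrow> v = 0"
    and \<Gamma>: "bilinear \<Gamma>" "\<And>u v. \<Gamma> u v = \<Gamma> v u"
      "\<And>u v w. \<D> (\<lambda>y. G y v w) x u = G x (\<Gamma> u v) w + G x v (\<Gamma> u w)"
  shows "levi_civita G x = \<Gamma>"
  unfolding levi_civita_def
proof (rule the_equality)
  fix \<Gamma>' assume \<Gamma>': "bilinear \<Gamma>' \<and> (\<forall>u v. \<Gamma>' u v = \<Gamma>' v u) \<and>
    (\<forall>u v w. \<D> (\<lambda>y. G y v w) x u = G x (\<Gamma>' u v) w + G x v (\<Gamma>' u w))"
  define A where "A u v w = G x (\<Gamma>' u v - \<Gamma> u v) w" for u v w
  have anti: "A u v w = - A u w v" for u v w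
    using \<Gamma>(3)[of v w u] \<Gamma>' G(2)[of v "\<Gamma> u w"] G(2)[of v "\<Gamma>' u w"]
    by (simp add: A_def bilinear_lsub[OF G(1)])
  have symA: "A u v w = A v u w" for u v w
    using \<Gamma>(2)[of u v] \<Gamma>' by (simp add: A_def)
  have "A u v w = 0" for u v w
    using anti[of u v w] symA[of u w v] anti[of w u v] symA[of w v u] anti[of v w u] symA[of v u w] by linarith
  then have "\<Gamma>' u v = \<Gamma> u v" for u v using nondeg[of "\<Gamma>' u v - \<Gamma> u v"] by (simp add: A_def)
  then show "\<Gamma>' = \<Gamma>" by blast
qed (use \<Gamma> in blast)

locale riemannian_chart =
  fixes U :: "'a::euclidean_space set" and G :: "'a \<Rightarrow> 'a \<Rightarrow> 'a \<Rightarrow> real"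
  assumes open_U: "open U" and inner: "x \<in> U \<Longrightarrow> inner_form (G x)"
    and smooth_G: "\<And>v w. smooth_on U (\<lambda>x. G x v w)"
begin

lemma bilinear_G: "x \<in> U \<Longrightarrow> bilinear (G x)" using inner inner_form.bil by blast
lemma G_sym: "x \<in> U \<Longrightarrow> G x u v = G x v u" using inner inner_form.sym by blast

lemmas G_simps = inner_form.form_simps[OF inner]

lemma smooth_on_metric: "smooth_on U X \<Longrightarrow> smooth_on U Y \<Longrightarrow> smooth_on U (\<lambda>x. G x (X x) (Y x))"
  by (rule smooth_on_bilinear_family[OF open_U bilinear_G smooth_G])

definition sharp :: "'a \<Rightarrow> ('a \<Rightarrow> real) \<Rightarrow> 'a" where
  "sharp x \<phi> = inv (inner_form.flat (G x)) (\<Sum>b\<in>Basis. \<phi> b *\<^sub>R b)"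

lemma sharp: "x \<in> U \<Longrightarrow> linear \<phi> \<Longrightarrow> G x (sharp x \<phi>) v = \<phi> v"
  unfolding sharp_def by (rule inner_form.representation_of_linear[OF inner])

text \<open>The source of smoothness for objects defined by \<open>THE\<close>: gradients and
  Christoffel symbols are both of the form \<open>sharp\<close> of a functional with smooth
  coefficients.\<close>

lemma smooth_on_sharp:
  assumes "\<And>v. smooth_on U (\<lambda>x. \<phi> x v)" shows "smooth_on U (\<lambda>x. sharp x (\<phi> x))"
  unfolding sharp_def
proof (rule smooth_on_linear_family[OF open_U, where L="\<lambda>x. inv (inner_form.flat (G x))"])
  show "smooth_on U (\<lambda>x. inv (inner_form.flat (G x)) v)" for v
  proof (rule smooth_on_inverse_family[OF open_U])
    show "smooth_on U (\<lambda>x. inner_form.flat (G x) v)" for v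
      by (rule smooth_on_cong[OF open_U, of "\<lambda>x. \<Sum>b\<in>Basis. G x v b *\<^sub>R b"])
        (auto simp: inner_form.flat_def[OF inner] intro!: smooth_on_intros open_U smooth_G)
  qed (auto simp: inner_form.linear_flat[OF inner] inner_form.linear_inv_flat[OF inner]
      bij_is_surj bij_is_inj inner_form.bij_flat[OF inner] surj_f_inv_f)
  show "smooth_on U (\<lambda>x. \<Sum>b\<in>Basis. \<phi> x b *\<^sub>R b)"
    by (intro smooth_on_intros open_U assms)
qed (use inner_form.linear_inv_flat[OF inner] in auto)

text \<open>The Christoffel symbols of the first kind: the Koszul formula for constant fields, whose
  brackets vanish.\<close>

definition koszul :: "'a \<Rightarrow> 'a \<Rightarrow> 'a \<Rightarrow> 'a \<Rightarrow> real" where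
  "koszul x u v w = (\<D> (\<lambda>y. G y v w) x u + \<D> (\<lambda>y. G y u w) x v - \<D> (\<lambda>y. G y u v) x w) / 2"

lemma linear_dG:
  assumes "x \<in> U"
  shows "linear (\<lambda>u. \<D> (\<lambda>y. G y v w) x u)" "linear (\<lambda>v. \<D> (\<lambda>y. G y v w) x u)"
    "linear (\<lambda>w. \<D> (\<lambda>y. G y v w) x u)"
proof -
  show "linear (\<lambda>u. \<D> (\<lambda>y. G y v w) x u)" by (rule smooth_on_linear_deriv[OF smooth_G assms])
  show "linear (\<lambda>v. \<D> (\<lambda>y. G y v w) x u)"
    by (rule linear_deriv_family[OF open_U assms]) (auto simp: smooth_G inner_form.lin_left[OF inner])
  show "linear (\<lambda>w. \<D> (\<lambda>y. G y v w) x u)"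
    by (rule linear_deriv_family[OF open_U assms]) (auto simp: smooth_G inner_form.lin_right[OF inner])
qed

lemma linear_koszul:
  assumes "x \<in> U"
  shows "linear (\<lambda>u. koszul x u v w)" "linear (\<lambda>v. koszul x u v w)" "linear (\<lambda>w. koszul x u v w)"
  unfolding koszul_def
  by (rule linearI; simp add: linear_add[OF linear_dG(1)[OF assms]] linear_add[OF linear_dG(2)[OF assms]]
      linear_add[OF linear_dG(3)[OF assms]] linear.scaleR[OF linear_dG(1)[OF assms]]
      linear.scaleR[OF linear_dG(2)[OF assms]] linear.scaleR[OF linear_dG(3)[OF assms]] field_simps)+

abbreviation \<Gamma> :: "'a \<Rightarrow> 'a \<Rightarrow> 'a \<Rightarrow> 'a" where "\<Gamma> \<equiv> levi_civita G"

text \<open>Existence: raising the last index of \<open>koszul\<close> gives a symmetric connection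
  compatible with the metric, and \<open>levi_civita_eqI\<close> identifies it with the value of
  \<open>THE\<close>.\<close>

lemma levi_civita_eq:
  assumes "x \<in> U" shows "\<Gamma> x = (\<lambda>u v. sharp x (koszul x u v))"
    and bilinear_\<Gamma>: "bilinear (\<Gamma> x)"
    and \<Gamma>_sym: "\<Gamma> x u v = \<Gamma> x v u"
    and metric_compatible: "\<D> (\<lambda>y. G y v w) x u = G x (\<Gamma> x u v) w + G x v (\<Gamma> x u w)"
proof -
  interpret inner_form "G x" by (rule inner[OF assms])
  define C where "C u v = sharp x (koszul x u v)" for u v
  have C: "G x (C u v) w = koszul x u v w" for u v w
    unfolding C_def by (rule sharp[OF assms linear_koszul(3)[OF assms]])
  have bilC: "bilinear C"
    unfolding bilinear_def
    by (intro conjI allI linearI; rule eqI)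
      (simp_all add: C form_simps linear_add[OF linear_koszul(1)[OF assms]] linear_add[OF linear_koszul(2)[OF assms]]
        linear.scaleR[OF linear_koszul(1)[OF assms]] linear.scaleR[OF linear_koszul(2)[OF assms]])
  have dG_sym: "\<D> (\<lambda>y. G y v w) x = \<D> (\<lambda>y. G y w v) x" for v w
    by (rule deriv_cong[OF open_U assms G_sym smooth_G])
  have symC: "C u v = C v u" for u v
    by (rule eqI) (simp add: C koszul_def dG_sym[of v u])
  have compC: "\<D> (\<lambda>y. G y v w) x u = G x (C u v) w + G x v (C u w)" for u v w
    unfolding sym[of v "C u w"] C koszul_def using dG_sym[of w v] by (simp add: field_simps)
  have eq: "\<Gamma> x = C"
    by (rule levi_civita_eqI[OF bil sym _ bilC symC compC]) (use eqI[of _ 0] in \<open>auto simp: form_simps\<close>)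
  show "\<Gamma> x = (\<lambda>u v. sharp x (koszul x u v))" using eq by (simp add: C_def[abs_def])
  show "bilinear (\<Gamma> x)" "\<Gamma> x u v = \<Gamma> x v u"
    "\<D> (\<lambda>y. G y v w) x u = G x (\<Gamma> x u v) w + G x v (\<Gamma> x u w)"
    unfolding eq by (fact bilC symC compC)+
qed

lemma smooth_\<Gamma>: "smooth_on U (\<lambda>x. \<Gamma> x u v)"
proof (rule smooth_on_cong[OF open_U])
  have "smooth_on U (\<lambda>x. koszul x u v w)" for w
  proof -
    have "smooth_on U (\<lambda>x. (1/2) * (\<D> (\<lambda>y. G y v w) x u + \<D> (\<lambda>y. G y u w) x v - \<D> (\<lambda>y. G y u v) x w))"
      by (intro smooth_on_intros open_U smooth_on_deriv smooth_G)
    then show ?thesis by (simp add: koszul_def)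
  qed
  then show "smooth_on U (\<lambda>x. sharp x (koszul x u v))" by (rule smooth_on_sharp)
qed (simp add: levi_civita_eq)

lemmas \<Gamma>_simps = bilinear_ladd[OF bilinear_\<Gamma>] bilinear_radd[OF bilinear_\<Gamma>]
  bilinear_lsub[OF bilinear_\<Gamma>] bilinear_rsub[OF bilinear_\<Gamma>]
  bilinear_lmul[OF bilinear_\<Gamma>] bilinear_rmul[OF bilinear_\<Gamma>]
  bilinear_lzero[OF bilinear_\<Gamma>] bilinear_rzero[OF bilinear_\<Gamma>]

text \<open>The covariant derivative nabla_u Y with the direction as last argument, so that
  \<open>cov Y x\<close> is an endomorphism; for the unit normal it is the shape operator.\<close>

definition cov :: "('a \<Rightarrow> 'a) \<Rightarrow> 'a \<Rightarrow> 'a \<Rightarrow> 'a" where "cov Y x u = \<D> Y x u + \<Gamma> x u (Y x)"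

lemma linear_cov: "smooth_on U Y \<Longrightarrow> x \<in> U \<Longrightarrow> linear (cov Y x)"
  unfolding cov_def
  by (rule linear_compose_add[OF smooth_on_linear_deriv])
    (use bilinear_\<Gamma> in \<open>auto simp: bilinear_def\<close>)

lemma smooth_on_cov_const: "smooth_on U Y \<Longrightarrow> smooth_on U (\<lambda>x. cov Y x u)"
  unfolding cov_def
  by (intro smooth_on_add open_U smooth_on_deriv smooth_on_bilinear_family[OF open_U bilinear_\<Gamma> smooth_\<Gamma>]
     smooth_on_const)

lemma smooth_on_cov: "smooth_on U Y \<Longrightarrow> smooth_on U X \<Longrightarrow> smooth_on U (\<lambda>x. cov Y x (X x))"
  by (rule smooth_on_linear_family[OF open_U linear_cov smooth_on_cov_const])

lemma cov_metric:
  assumes "smooth_on U Y" "smooth_on U Z" "x \<in> U"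
  shows "\<D> (\<lambda>y. G y (Y y) (Z y)) x u = G x (cov Y x u) (Z x) + G x (Y x) (cov Z x u)"
  using deriv_bilinear_family[OF open_U bilinear_G smooth_G assms, of u]
  by (simp add: metric_compatible[OF assms(3)] cov_def G_simps[OF assms(3)])

lemma cov_diff: "smooth_on U Y \<Longrightarrow> smooth_on U Z \<Longrightarrow> x \<in> U \<Longrightarrow> cov (\<lambda>y. Y y - Z y) x u = cov Y x u - cov Z x u"
  by (simp add: cov_def deriv_diff \<Gamma>_simps)

lemma cov_scaleR_const: "smooth_on U Y \<Longrightarrow> x \<in> U \<Longrightarrow> cov (\<lambda>y. c *\<^sub>R Y y) x u = c *\<^sub>R cov Y x u"
  by (simp add: cov_def deriv_scaleR_const \<Gamma>_simps scaleR_add_right)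

lemma cov_linear_family:
  fixes L :: "'a \<Rightarrow> 'a \<Rightarrow> 'a"
  assumes "\<And>y. y \<in> U \<Longrightarrow> linear (L y)" "\<And>v. smooth_on U (\<lambda>y. L y v)" "smooth_on U Y" "x \<in> U"
  shows "cov (\<lambda>y. L y (Y y)) x u = cov (\<lambda>y. L y (Y x)) x u + L x (\<D> Y x u)"
  by (simp add: cov_def deriv_linear_family[OF open_U assms])

lemma curvature_eq:
  assumes "x \<in> U"
  shows "curvature G x u v w = cov (\<lambda>y. cov (\<lambda>_. w) y v) x u - cov (\<lambda>y. cov (\<lambda>_. w) y u) x v"
  by (simp add: curvature_def cov_deriv_def cov_deriv_along_def cov_def)

text \<open>The terms are sorted by their behaviour under exchange of \<open>u\<close> and
  \<open>X x\<close>: the second derivative of \<open>Y\<close> is symmetric, and so are the two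
  middle terms together. The derivative of \<open>\<Gamma>\<close> and the double
  \<open>\<Gamma>\<close> form the curvature, and the last term yields the bracket.\<close>

lemma second_cov:
  assumes Y: "smooth_on U Y" and X: "smooth_on U X" and x: "x \<in> U"
  shows "cov (\<lambda>y. cov Y y (X y)) x u = \<D> (\<lambda>y. \<D> Y y (X x)) x u + \<D> (\<lambda>y. \<Gamma> y (X x) (Y x)) x u
     + \<Gamma> x (X x) (\<D> Y x u) + \<Gamma> x u (\<D> Y x (X x)) + \<Gamma> x u (\<Gamma> x (X x) (Y x)) + cov Y x (\<D> X x u)"
proof -
  have 1: "\<D> (\<lambda>y. \<D> Y y (X y)) x u = \<D> (\<lambda>y. \<D> Y y (X x)) x u + \<D> Y x (\<D> X x u)"
    by (rule deriv_linear_family[OF open_U _ _ X x]) (use Y smooth_on_linear_deriv smooth_on_deriv in blast)+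
  have 2: "\<D> (\<lambda>y. \<Gamma> y (X y) (Y y)) x u =
     \<D> (\<lambda>y. \<Gamma> y (X x) (Y x)) x u + \<Gamma> x (\<D> X x u) (Y x) + \<Gamma> x (X x) (\<D> Y x u)"
    by (rule deriv_bilinear_family[OF open_U bilinear_\<Gamma> smooth_\<Gamma> X Y x])
  have 3: "\<D> (\<lambda>y. \<D> Y y (X y) + \<Gamma> y (X y) (Y y)) x u = \<D> (\<lambda>y. \<D> Y y (X y)) x u + \<D> (\<lambda>y. \<Gamma> y (X y) (Y y)) x u"
    by (rule deriv_add[OF _ _ x])
      (auto intro!: smooth_on_linear_family[OF open_U smooth_on_linear_deriv[OF Y] smooth_on_deriv[OF Y] X]
        smooth_on_bilinear_family[OF open_U bilinear_\<Gamma> smooth_\<Gamma> X Y])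
  show ?thesis unfolding cov_def 3 1 2 by (simp add: \<Gamma>_simps[OF x])
qed

text \<open>Extends the definition of \<open>curvature\<close> from constant fields to arbitrary
  ones. The bracket of \<open>X\<close> and \<open>Y\<close> is written as
  \<open>cov Y x (X x) - cov X x (Y x)\<close>, which is legitimate because the torsion
  vanishes.\<close>

lemma ricci_identity:
  assumes X: "smooth_on U X" and Y: "smooth_on U Y" and Z: "smooth_on U Z" and x: "x \<in> U"
  shows "curvature G x (X x) (Y x) (Z x) = cov (\<lambda>y. cov Z y (Y y)) x (X x) - cov (\<lambda>y. cov Z y (X y)) x (Y x)
     - cov Z x (cov Y x (X x) - cov X x (Y x))"
proof -
  have c: "smooth_on U (\<lambda>_. v)" for v :: 'a by (rule smooth_on_const[OF open_U])
  have "cov Y x (X x) - cov X x (Y x) = \<D> Y x (X x) - \<D> X x (Y x)"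
    by (simp add: cov_def \<Gamma>_sym[OF x, of "X x"])
  moreover have "\<D> (\<lambda>y. \<D> Z y (Y x)) x (X x) = \<D> (\<lambda>y. \<D> Z y (X x)) x (Y x)"
    by (rule mixed_partials[OF open_U x Z])
  ultimately show ?thesis
    unfolding curvature_eq[OF x] second_cov[OF c c x] second_cov[OF Z X x] second_cov[OF Z Y x]
    by (simp add: linear_diff[OF linear_cov[OF Z x]] linear_0[OF linear_cov[OF c x]] \<Gamma>_simps[OF x])
qed

section \<open>Symmetries of the curvature tensor and constant curvature\<close>

lemma curvature_expand:
  assumes x: "x \<in> U"
  shows "curvature G x u v w = \<D> (\<lambda>y. \<Gamma> y v w) x u - \<D> (\<lambda>y. \<Gamma> y u w) x v
    + \<Gamma> x u (\<Gamma> x v w) - \<Gamma> x v (\<Gamma> x u w)"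
proof -
  have c: "smooth_on U (\<lambda>_. v)" for v :: 'a by (rule smooth_on_const[OF open_U])
  show ?thesis
    unfolding curvature_eq[OF x] second_cov[OF c c x]
    by (simp add: linear_0[OF linear_cov[OF c x]] \<Gamma>_simps[OF x])
qed

lemma linear_d\<Gamma>:
  assumes "x \<in> U"
  shows "linear (\<lambda>v. \<D> (\<lambda>y. \<Gamma> y v w) x u)" "linear (\<lambda>w. \<D> (\<lambda>y. \<Gamma> y v w) x u)"
proof -
  show "linear (\<lambda>v. \<D> (\<lambda>y. \<Gamma> y v w) x u)"
    by (rule linear_deriv_family[OF open_U assms _ smooth_\<Gamma>]) (use bilinear_\<Gamma> in \<open>auto simp: bilinear_def\<close>)
  show "linear (\<lambda>w. \<D> (\<lambda>y. \<Gamma> y v w) x u)"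
    by (rule linear_deriv_family[OF open_U assms _ smooth_\<Gamma>]) (use bilinear_\<Gamma> in \<open>auto simp: bilinear_def\<close>)
qed

lemma curvature_add:
  assumes x: "x \<in> U"
  shows "curvature G x (u + u') v w = curvature G x u v w + curvature G x u' v w"
    "curvature G x u (v + v') w = curvature G x u v w + curvature G x u v' w"
    "curvature G x u v (w + w') = curvature G x u v w + curvature G x u v w'"
  unfolding curvature_expand[OF x]
  by (simp_all add: \<Gamma>_simps[OF x] linear_add[OF linear_d\<Gamma>(1)[OF x]] linear_add[OF linear_d\<Gamma>(2)[OF x]]
      linear_add[OF smooth_on_linear_deriv[OF smooth_\<Gamma> x]])

lemma curvature_scale:
  assumes x: "x \<in> U" shows "curvature G x (c *\<^sub>R u) v w = c *\<^sub>R curvature G x u v w"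
  unfolding curvature_expand[OF x]
  by (simp add: \<Gamma>_simps[OF x] linear.scaleR[OF linear_d\<Gamma>(1)[OF x]]
      linear.scaleR[OF smooth_on_linear_deriv[OF smooth_\<Gamma> x]] scaleR_diff_right scaleR_add_right)

lemma curvature_anti: "curvature G x u v w = - curvature G x v u w"
  by (simp add: curvature_def)

lemma curvature_bianchi:
  assumes x: "x \<in> U" shows "curvature G x u v w + curvature G x v w u + curvature G x w u v = 0"
proof -
  have s: "\<D> (\<lambda>y. \<Gamma> y v w) x = \<D> (\<lambda>y. \<Gamma> y w v) x" for v w
    by (rule deriv_cong[OF open_U x \<Gamma>_sym smooth_\<Gamma>])
  show ?thesis
    unfolding curvature_expand[OF x]
    by (simp add: s[of v u] s[of w v] s[of w u] \<Gamma>_sym[OF x, of v u] \<Gamma>_sym[OF x, of w v] \<Gamma>_sym[OF x, of w u])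
qed

text \<open>The second derivative of \<open>G y w z\<close> is symmetric in its two directions.
  Written out by metric compatibility, its antisymmetric part is the sum of the two curvature
  terms.\<close>

lemma curvature_metric_anti:
  assumes x: "x \<in> U" shows "G x (curvature G x u v w) z = - G x (curvature G x u v z) w"
proof -
  have c: "smooth_on U (\<lambda>_. v)" for v :: 'a by (rule smooth_on_const[OF open_U])
  have d: "\<D> (\<lambda>y. \<D> (\<lambda>y. G y w z) y v) x u =
    G x (cov (\<lambda>y. cov (\<lambda>_. w) y v) x u) z + G x (cov (\<lambda>_. w) x v) (cov (\<lambda>_. z) x u) +
    (G x (cov (\<lambda>_. w) x u) (cov (\<lambda>_. z) x v) + G x w (cov (\<lambda>y. cov (\<lambda>_. z) y v) x u))" for u v
  proof -
    note sc = smooth_on_cov_const[OF c]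
    have "\<D> (\<lambda>y. \<D> (\<lambda>y. G y w z) y v) x u = \<D> (\<lambda>y. G y (cov (\<lambda>_. w) y v) z + G y w (cov (\<lambda>_. z) y v)) x u"
      by (rule fun_cong[OF deriv_cong[OF open_U x cov_metric[OF c c] smooth_on_deriv[OF smooth_G]]])
    also have "\<dots> = \<D> (\<lambda>y. G y (cov (\<lambda>_. w) y v) z) x u + \<D> (\<lambda>y. G y w (cov (\<lambda>_. z) y v)) x u"
      by (rule deriv_add[OF smooth_on_metric[OF sc c] smooth_on_metric[OF c sc] x])
    finally show ?thesis using cov_metric[OF sc c x] cov_metric[OF c sc x] by simp
  qed
  have "G x (curvature G x u v w) z + G x (curvature G x u v z) w = 0"
    using mixed_partials[OF open_U x smooth_G, of w z v u]
    unfolding d curvature_eq[OF x] G_simps[OF x]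
    by (simp add: G_sym[OF x, of w])
  then show ?thesis by simp
qed

text \<open>The difference of the two sides is an algebraic curvature tensor whose sectional values
  vanish.\<close>

lemma constant_curvature:
  assumes x: "x \<in> U"
    and K: "\<And>u v. G x (curvature G x u v v) u = \<kappa> * (G x u u * G x v v - (G x u v)\<^sup>2)"
  shows "G x (curvature G x u v w) z = \<kappa> * (G x v w * G x u z - G x u w * G x v z)"
proof -
  define D where "D u v w z = G x (curvature G x u v w) z - \<kappa> * (G x v w * G x u z - G x u w * G x v z)" for u v w z
  note s = G_sym[OF x]
  have "D u v w z = 0"
  proof (rule curvature_tensor_eq_zero[of D])
    show "D u v z w = - D v u z w" for u v z w
      using curvature_anti[of x u v z] by (simp add: D_def G_simps[OF x] algebra_simps)
    show "D u v z w = - D u v w z" for u v z w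
      using curvature_metric_anti[OF x, of u v z w] by (simp add: D_def algebra_simps)
    show "D u v z w + D v z u w + D z u v w = 0" for u v z w
      using arg_cong[OF curvature_bianchi[OF x, of u v z], of "\<lambda>y. G x y w"]
      by (simp add: D_def G_simps[OF x] s[of z] s[of v u] algebra_simps)
    show "D u v v u = 0" for u v
      using K[of u v] s[of u v] by (simp add: D_def power2_eq_square algebra_simps)
  qed (simp_all add: D_def curvature_add[OF x] G_simps[OF x] algebra_simps)
  then show ?thesis by (simp add: D_def)
qed

end

subsection \<open>Level sets with unit normal and Cartan's identity\<close>

text \<open>\<open>deriv_a\<close> says that the 1-form \<open>a dh\<close> dual to
  \<open>\<nu>\<close> is closed. \<open>\<kappa>\<close> is a function because the sectional
  curvature of the base is prescribed point by point.\<close>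

locale unit_normal_chart = riemannian_chart U G for U :: "'a::euclidean_space set" and G +
  fixes h a b \<kappa> :: "'a \<Rightarrow> real" and \<nu> :: "'a \<Rightarrow> 'a"
  assumes smooth_h: "smooth_on U h" and smooth_a: "smooth_on U a" and smooth_\<nu>: "smooth_on U \<nu>"
    and a_nonzero: "x \<in> U \<Longrightarrow> a x \<noteq> 0"
    and normal: "x \<in> U \<Longrightarrow> G x (\<nu> x) v = a x * \<D> h x v"
    and unit: "x \<in> U \<Longrightarrow> G x (\<nu> x) (\<nu> x) = 1"
    and deriv_a: "x \<in> U \<Longrightarrow> \<D> a x u = b x * \<D> h x u"
    and sectional: "x \<in> U \<Longrightarrow> G x (curvature G x u v v) u = \<kappa> x * (G x u u * G x v v - (G x u v)\<^sup>2)"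
begin

abbreviation S :: "'a \<Rightarrow> 'a \<Rightarrow> 'a" where "S \<equiv> cov \<nu>"

abbreviation tangent :: "'a \<Rightarrow> 'a set" where "tangent x \<equiv> {u. \<D> h x u = 0}"

lemmas linear_S = linear_cov[OF smooth_\<nu>]
lemmas smooth_S = smooth_on_cov_const[OF smooth_\<nu>]

lemma tangent_iff: "x \<in> U \<Longrightarrow> u \<in> tangent x \<longleftrightarrow> G x (\<nu> x) u = 0"
  using a_nonzero normal by simp

lemma subspace_tangent: "x \<in> U \<Longrightarrow> subspace (tangent x)"
  using smooth_on_linear_deriv[OF smooth_h]
  by (auto simp: subspace_def linear_add linear.scaleR linear_0)

lemma S_normal: assumes x: "x \<in> U" shows "G x (S x u) (\<nu> x) = 0"
proof -
  have "\<D> (\<lambda>y. G y (\<nu> y) (\<nu> y)) x = \<D> (\<lambda>y. 1) x"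
    by (rule deriv_cong[OF open_U x unit smooth_on_metric[OF smooth_\<nu> smooth_\<nu>]])
  then show ?thesis
    using cov_metric[OF smooth_\<nu> smooth_\<nu> x, of u] G_sym[OF x, of "\<nu> x"] by simp
qed

lemma S_tangent: "x \<in> U \<Longrightarrow> S x u \<in> tangent x"
  using S_normal tangent_iff G_sym by metis

text \<open>\<open>G x (S x u) v\<close> is the covariant derivative of the closed 1-form
  \<open>a dh\<close>: the term with \<open>b\<close> is visibly symmetric, the rest by equality of
  mixed partials and absence of torsion.\<close>

lemma S_sym: assumes x: "x \<in> U" shows "G x (S x u) v = G x u (S x v)"
proof -
  have c: "smooth_on U (\<lambda>_. v)" for v :: 'a by (rule smooth_on_const[OF open_U])
  have "G x (S x u) v = b x * \<D> h x u * \<D> h x v + a x * \<D> (\<lambda>y. \<D> h y v) x u - G x (\<nu> x) (\<Gamma> x u v)" for u v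
  proof -
    have "\<D> (\<lambda>y. G y (\<nu> y) v) x = \<D> (\<lambda>y. a y * \<D> h y v) x"
      by (rule deriv_cong[OF open_U x normal smooth_on_metric[OF smooth_\<nu> c]])
    then show ?thesis
      using cov_metric[OF smooth_\<nu> c[of v] x, of u] deriv_mult[OF smooth_a smooth_on_deriv[OF smooth_h] x, of v u]
      by (simp add: cov_def deriv_a[OF x])
  qed
  note * = this[of u v] this[of v u]
  show ?thesis
    unfolding G_sym[OF x, of u] * using mixed_partials[OF open_U x smooth_h, of v u] by (simp add: \<Gamma>_sym[OF x, of u v])
qed

text \<open>The tensor (nabla_u S) v. For a constant field \<open>v\<close> the correction nabla_u v
  is \<open>\<Gamma> x u v\<close>.\<close>

definition dS :: "'a \<Rightarrow> 'a \<Rightarrow> 'a \<Rightarrow> 'a" where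
  "dS x u v = cov (\<lambda>y. S y v) x u - S x (\<Gamma> x u v)"

lemma cov_S_field:
  assumes Y: "smooth_on U Y" and x: "x \<in> U"
  shows "cov (\<lambda>y. S y (Y y)) x u = dS x u (Y x) + S x (cov Y x u)"
  using cov_linear_family[OF linear_S smooth_S Y x, of u]
  by (simp add: dS_def cov_def[of Y] linear_add[OF linear_S[OF x]])

text \<open>Both sides are the antisymmetrised second covariant derivative of
  \<open>\<nu>\<close>.\<close>

lemma codazzi: assumes x: "x \<in> U" shows "dS x u v - dS x v u = curvature G x u v (\<nu> x)"
proof -
  have c: "smooth_on U (\<lambda>_. v)" for v :: 'a by (rule smooth_on_const[OF open_U])
  show ?thesis
    using ricci_identity[OF c[of u] c[of v] smooth_\<nu> x]
    by (simp add: dS_def cov_def[of "\<lambda>_. _"] \<Gamma>_sym[OF x, of v u] linear_0[OF linear_S[OF x]])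
qed

lemma dS_sym: assumes x: "x \<in> U" shows "G x (dS x u v) w = G x (dS x u w) v"
proof -
  have c: "smooth_on U (\<lambda>_. v)" for v :: 'a by (rule smooth_on_const[OF open_U])
  have 1: "\<D> (\<lambda>y. G y (S y v) w) x u = \<D> (\<lambda>y. G y (S y w) v) x u"
    by (rule fun_cong[OF deriv_cong[OF open_U x _ smooth_on_metric[OF smooth_S c]]]) (use S_sym G_sym in metis)
  have 2: "\<D> (\<lambda>y. G y (S y v) w) x u
    = G x (dS x u v) w + G x (S x (\<Gamma> x u v)) w + G x (S x v) (\<Gamma> x u w)" for v w
    using cov_metric[OF smooth_S c x, of v w u] by (simp add: dS_def cov_def[of "\<lambda>_. _"] G_simps[OF x])
  show ?thesis
    using 1 2[of v w] 2[of w v] S_sym[OF x, of v "\<Gamma> x u w"] S_sym[OF x, of w "\<Gamma> x u v"]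
      G_sym[OF x, of v "S x (\<Gamma> x u w)"] G_sym[OF x, of w "S x (\<Gamma> x u v)"] by linarith
qed

text \<open>In constant curvature \<open>R(u,v) \<nu>\<close> is a combination of \<open>u\<close>
  and \<open>v\<close> with coefficients \<open>G x v (\<nu> x)\<close> and
  \<open>G x u (\<nu> x)\<close> up to sign, and these vanish on tangent vectors. With
  \<open>dS_sym\<close> the trilinear form becomes totally symmetric there.\<close>

lemma dS_total_sym:
  assumes x: "x \<in> U" and uvw: "u \<in> tangent x" "v \<in> tangent x" "w \<in> tangent x"
  shows "G x (dS x u v) w = G x (dS x v u) w"
proof -
  have "G x (curvature G x u v (\<nu> x)) w = 0"
    using constant_curvature[OF x sectional[OF x]] uvw tangent_iff[OF x] G_sym[OF x, of _ "\<nu> x"] by auto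
  then show ?thesis using arg_cong[OF codazzi[OF x, of u v], of "\<lambda>y. G x y w"] by (simp add: G_simps[OF x])
qed

lemma exists_eigenbasis:
  assumes x: "x \<in> U"
  shows "\<exists>B. inner_form.orthonormal (G x) B \<and> span B = tangent x \<and> (\<forall>u\<in>B. \<exists>s. S x u = s *\<^sub>R u)"
  by (rule inner_form.symmetric_eigenbasis[OF inner[OF x] subspace_tangent[OF x] linear_S[OF x]])
    (use S_tangent[OF x] S_sym[OF x] in auto)

text \<open>The basis spans only the tangent space of the level set; the unit normal supplies the
  missing direction.\<close>

lemma parseval:
  assumes x: "x \<in> U" and B: "inner_form.orthonormal (G x) B" "span B = tangent x"
  shows "G x u v = (\<Sum>g\<in>B. G x u g * G x v g) + G x u (\<nu> x) * G x v (\<nu> x)"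
proof -
  interpret inner_form "G x" by (rule inner[OF x])
  define u' where "u' = u - G x u (\<nu> x) *\<^sub>R \<nu> x"
  have "u' \<in> span B"
    unfolding B(2) tangent_iff[OF x] by (simp add: u'_def form_simps unit[OF x] sym)
  then have "G x u' v = (\<Sum>g\<in>B. G x u' g * G x v g)" by (rule orthonormal_parseval[OF B(1)])
  moreover have "G x u' g = G x u g" if "g \<in> B" for g
    using that span_base[of g B] B(2) tangent_iff[OF x, of g] by (auto simp: u'_def form_simps)
  ultimately have "G x u' v = (\<Sum>g\<in>B. G x u g * G x v g)" by simp
  then show ?thesis by (simp add: u'_def form_simps sym[of "\<nu> x" v])
qed

end

text \<open>The isoparametric hypothesis enters as one finite set containing all tangential
  eigenvalues along the level set. A fixed polynomial in \<open>S\<close> then projects onto an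
  eigenspace at all of its points.\<close>

locale isoparametric_chart = unit_normal_chart U G h a b \<kappa> \<nu>
  for U :: "'a::euclidean_space set" and G h a b \<kappa> \<nu> +
  fixes p :: 'a and \<Lambda> :: "real set"
  assumes p: "p \<in> U" and finite_\<Lambda>: "finite \<Lambda>"
    and spectrum: "x \<in> U \<Longrightarrow> h x = h p \<Longrightarrow> u \<noteq> 0 \<Longrightarrow> u \<in> tangent x \<Longrightarrow> S x u = s *\<^sub>R u \<Longrightarrow> s \<in> \<Lambda>"
begin

definition level :: "'a set" where "level = {x \<in> U. h x = h p}"

lemma level: "x \<in> level \<Longrightarrow> x \<in> U" "p \<in> level"
  using p by (auto simp: level_def)

text \<open>The means of differentiating an identity that holds only on the level set;
  \<open>\<nu> x\<close> serves as the transverse direction.\<close>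

lemma deriv_zero_on_level:
  fixes \<phi> :: "'a \<Rightarrow> 'b::real_normed_vector"
  assumes "smooth_on U \<phi>" and zero: "\<And>y. y \<in> level \<Longrightarrow> \<phi> y = 0" and x: "x \<in> level" and u: "u \<in> tangent x"
  shows "\<D> \<phi> x u = 0"
proof (rule deriv_zero_on_level_set[OF open_U level(1)[OF x] smooth_h])
  show "\<D> h x (\<nu> x) \<noteq> 0"
    using normal[OF level(1)[OF x], of "\<nu> x"] unit[OF level(1)[OF x]] by auto
  show "(\<phi> has_derivative \<D> \<phi> x) (at x)"
    by (rule smooth_on_has_derivative[OF assms(1) level(1)[OF x]])
qed (use zero x u in \<open>auto simp: level_def\<close>)

lemma cov_zero_on_level:
  assumes "smooth_on U W" "\<And>y. y \<in> level \<Longrightarrow> W y = 0" "x \<in> level" "u \<in> tangent x"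
  shows "cov W x u = 0"
  using deriv_zero_on_level[OF assms] assms(2)[OF assms(3)] \<Gamma>_simps[OF level(1)[OF assms(3)]]
  by (simp add: cov_def)

text \<open>Smoothness is required on the open set \<open>U\<close>, where \<open>cov\<close> makes
  sense, but the eigenvector equation only along one level set, since the eigenvalue may change from
  one level set to the next.\<close>

definition eigenfield :: "real \<Rightarrow> ('a \<Rightarrow> 'a) \<Rightarrow> bool" where
  "eigenfield s Y \<longleftrightarrow> smooth_on U Y \<and> (\<forall>x\<in>level. Y x \<in> tangent x \<and> S x (Y x) = s *\<^sub>R Y x)"

text \<open>Along the level set, \<open>\<Prod>\<^sub>k (S - k)/(s - k)\<close> over the other eigenvalues \<open>k\<close> projects onto the eigenspace
  of \<open>s\<close>. As the eigenvalues are constant there, applying it to a smooth field gives a smooth field.\<close>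

lemma eigenfield_through:
  assumes q: "q \<in> level" and v: "v \<in> tangent q" "S q v = s *\<^sub>R v"
  obtains Y where "eigenfield s Y" "Y q = v"
proof -
  \<comment> \<open>Tangent vectors belonging to an eigenvalue outside \<open>M\<close>. Each step
    of the induction adds one eigenvalue to \<open>M\<close>, until along the level set only
    \<open>s\<close> is left.\<close>
  define E where "E M x = {u \<in> tangent x. \<exists>k. k \<notin> M \<and> S x u = k *\<^sub>R u}" for M x
  have "\<exists>Y. smooth_on U Y \<and> Y q = v \<and> (\<forall>x\<in>level. Y x \<in> span (E M x))" if "finite M" "s \<notin> M" for M
    using that
  proof (induction M rule: finite_induct)
    case empty
    \<comment> \<open>The tangential part of the constant field \<open>v\<close>, which equals
      \<open>v\<close> at \<open>q\<close>.\<close>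
    define Y where "Y x = v - G x v (\<nu> x) *\<^sub>R \<nu> x" for x
    have "smooth_on U Y"
      unfolding Y_def
      by (intro smooth_on_diff smooth_on_scaleR open_U smooth_on_const smooth_\<nu> smooth_on_metric)
    moreover have "Y q = v"
      using v(1) tangent_iff[OF level(1)[OF q]] G_sym[OF level(1)[OF q]] by (simp add: Y_def)
    moreover have "Y x \<in> span (E {} x)" if "x \<in> level" for x
    proof -
      note x = level(1)[OF that]
      obtain B where B: "span B = tangent x" "\<forall>u\<in>B. \<exists>s. S x u = s *\<^sub>R u"
        using exists_eigenbasis[OF x] by blast
      have "Y x \<in> tangent x"
        unfolding tangent_iff[OF x] by (simp add: Y_def G_simps[OF x] unit[OF x] G_sym[OF x])
      moreover have "B \<subseteq> E {} x" using B span_superset[of B] by (auto simp: E_def)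
      ultimately show ?thesis using B(1) span_mono by blast
    qed
    ultimately show ?case by blast
  next
    case (insert k M)
    obtain Y where Y: "smooth_on U Y" "Y q = v" "\<And>x. x \<in> level \<Longrightarrow> Y x \<in> span (E M x)"
      using insert.IH insert.prems by auto
    have sk: "s - k \<noteq> 0" using insert.prems by auto
    \<comment> \<open>One factor of the projection: it multiplies an eigenvector for
      \<open>k'\<close> by \<open>(k' - k) / (s - k)\<close>, so it kills \<open>k\<close> and fixes
      \<open>s\<close>.\<close>
    define Z where "Z x = (1 / (s - k)) *\<^sub>R (S x (Y x) - k *\<^sub>R Y x)" for x
    have "smooth_on U Z"
      unfolding Z_def
      by (intro smooth_on_diff smooth_on_scaleR open_U smooth_on_const smooth_on_cov smooth_\<nu> Y(1))
    moreover have "Z q = v"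
      using sk by (simp add: Z_def Y(2) v(2) scaleR_diff_left[symmetric])
    moreover have "Z x \<in> span (E (insert k M) x)" if xl: "x \<in> level" for x
    proof -
      note x = level(1)[OF xl]
      define L where "L u = (1 / (s - k)) *\<^sub>R (S x u - k *\<^sub>R u)" for u
      have linL: "linear L"
        unfolding L_def
        by (rule linearI) (simp_all add: linear_add[OF linear_S[OF x]] linear.scaleR[OF linear_S[OF x]]
            algebra_simps)
      have "L u \<in> span (E (insert k M) x)" if "u \<in> E M x" for u
      proof -
        obtain k' where k': "u \<in> tangent x" "k' \<notin> M" "S x u = k' *\<^sub>R u" using \<open>u \<in> E M x\<close> by (auto simp: E_def)
        have Lu: "L u = ((k' - k) / (s - k)) *\<^sub>R u"
          by (simp add: L_def k'(3) scaleR_diff_left[symmetric])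
        show ?thesis
        proof (cases "k' = k")
          case True
          then show ?thesis using Lu by (simp add: span_zero)
        next
          case False
          then have "u \<in> E (insert k M) x" using k' by (auto simp: E_def)
          then show ?thesis unfolding Lu by (intro span_scale span_base)
        qed
      qed
      then have "L ` span (E M x) \<subseteq> span (E (insert k M) x)"
        unfolding linear_span_image[OF linL, symmetric] by (intro span_minimal) auto
      then show ?thesis using Y(3)[OF xl] by (auto simp: Z_def L_def)
    qed
    ultimately show ?case by blast
  qed
  from this[of "\<Lambda> - {s}"] finite_\<Lambda> obtain Y where
    Y: "smooth_on U Y" "Y q = v" "\<And>x. x \<in> level \<Longrightarrow> Y x \<in> span (E (\<Lambda> - {s}) x)" by auto
  have "Y x \<in> tangent x \<and> S x (Y x) = s *\<^sub>R Y x" if xl: "x \<in> level" for x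
  proof -
    note x = level(1)[OF xl]
    have sub: "subspace (tangent x \<inter> {u. S x u = s *\<^sub>R u})"
      by (rule subspace_inter[OF subspace_tangent[OF x]])
        (auto simp: subspace_def linear_add[OF linear_S[OF x]] linear.scaleR[OF linear_S[OF x]]
          linear_0[OF linear_S[OF x]] scaleR_add_right)
    have "E (\<Lambda> - {s}) x \<subseteq> tangent x \<inter> {u. S x u = s *\<^sub>R u}"
    proof
      fix u assume "u \<in> E (\<Lambda> - {s}) x"
      then obtain k where k: "u \<in> tangent x" "k \<notin> \<Lambda> - {s}" "S x u = k *\<^sub>R u" by (auto simp: E_def)
      show "u \<in> tangent x \<inter> {u. S x u = s *\<^sub>R u}"
      proof (cases "u = 0")
        case True
        then show ?thesis using subspace_0[OF sub] by simp
      next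
        case False
        then have "k \<in> \<Lambda>" using spectrum[OF x _ False k(1,3)] xl by (simp add: level_def)
        then show ?thesis using k by auto
      qed
    qed
    then show ?thesis using span_minimal[OF _ sub] Y(3)[OF xl] by blast
  qed
  then show ?thesis using that Y by (auto simp: eigenfield_def)
qed

text \<open>Differentiating \<open>S Y = s Y\<close> along the level set gives (nabla_u S) Y = s
  nabla_u Y - S (nabla_u Y). Pairing with \<open>z\<close> moves \<open>S\<close> to the other side,
  where it acts as \<open>k\<close>.\<close>

lemma dS_eigenfield:
  assumes Y: "eigenfield s Y" and x: "x \<in> level" and u: "u \<in> tangent x" and z: "S x z = k *\<^sub>R z"
  shows "G x (dS x u (Y x)) z = (s - k) * G x (cov Y x u) z"
proof -
  note xU = level(1)[OF x]
  have sY: "smooth_on U Y" and "\<And>y. y \<in> level \<Longrightarrow> S y (Y y) - s *\<^sub>R Y y = 0" using Y by (auto simp: eigenfield_def)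
  moreover have sS: "smooth_on U (\<lambda>y. S y (Y y))" by (rule smooth_on_cov[OF smooth_\<nu> sY])
  moreover have sc: "smooth_on U (\<lambda>y. s *\<^sub>R Y y)" by (intro smooth_on_scaleR open_U smooth_on_const sY)
  ultimately have "cov (\<lambda>y. S y (Y y) - s *\<^sub>R Y y) x u = 0"
    by (intro cov_zero_on_level[OF _ _ x u]) (auto intro: smooth_on_diff open_U)
  then have "dS x u (Y x) = s *\<^sub>R cov Y x u - S x (cov Y x u)"
    by (simp add: cov_diff[OF sS sc xU] cov_S_field[OF sY xU] cov_scaleR_const[OF sY xU] eq_diff_eq)
  moreover have "G x (S x (cov Y x u)) z = k * G x (cov Y x u) z"
    by (simp add: S_sym[OF xU] z G_simps[OF xU])
  ultimately show ?thesis by (simp add: G_simps[OF xU] left_diff_distrib)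
qed

text \<open>For an eigenfield through \<open>y\<close> the factor \<open>s - k\<close> of
  \<open>dS_eigenfield\<close> is zero.\<close>

lemma dS_same_eigenvalue:
  assumes x: "x \<in> level" and tan: "u \<in> tangent x" "y \<in> tangent x" and ev: "S x y = s *\<^sub>R y" "S x z = s *\<^sub>R z"
  shows "G x (dS x u y) z = 0"
proof -
  obtain Y where "eigenfield s Y" "Y x = y" using eigenfield_through[OF x tan(2) ev(1)] by blast
  then show ?thesis using dS_eigenfield[OF _ x tan(1) ev(2), of s Y] by simp
qed

text \<open>At \<open>p\<close> let \<open>A\<close>, \<open>C\<close>, \<open>P\<close>,
  \<open>Q\<close> be nabla_Y Y, nabla_X X, nabla_X Y, nabla_Y X, and \<open>w = P - Q\<close> the
  bracket of \<open>X\<close> and \<open>Y\<close>. The three terms of <R(X,Y)Y, X> are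
  \<open>- G p A C\<close>, \<open>G p P Q\<close> and \<open>- G p (cov Y p w) e\<close>; their
  values are \<open>- \<sigma> e * \<sigma> f\<close>, \<open>\<Theta>\<close> and
  \<open>\<Theta>\<close>.\<close>

lemma gauss:
  assumes B: "inner_form.orthonormal (G p) B" "span B = tangent p" and \<sigma>: "\<And>g. g \<in> B \<Longrightarrow> S p g = \<sigma> g *\<^sub>R g"
    and e: "e \<in> B" and f: "f \<in> B" and ne: "\<sigma> e \<noteq> \<sigma> f"
  shows "\<kappa> p + \<sigma> e * \<sigma> f = 2 * (\<Sum>g\<in>{g \<in> B. \<sigma> g \<noteq> \<sigma> e \<and> \<sigma> g \<noteq> \<sigma> f}.
     (G p (dS p e f) g)\<^sup>2 / ((\<sigma> f - \<sigma> g) * (\<sigma> e - \<sigma> g)))"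
proof -
  interpret g: inner_form "G p" by (rule inner[OF p])
  note pl = level(2)
  have finB: "finite B" and onB: "\<And>u v. u \<in> B \<Longrightarrow> v \<in> B \<Longrightarrow> G p u v = (if u = v then 1 else 0)"
    using B(1) by (auto simp: g.orthonormal_def)
  have tB: "u \<in> tangent p" if "u \<in> B" for u using that span_base B(2) by blast
  note te = tB[OF e] and tf = tB[OF f] and Se = \<sigma>[OF e] and Sf = \<sigma>[OF f]
  obtain X where X: "eigenfield (\<sigma> e) X" "X p = e" using eigenfield_through[OF pl te Se] by blast
  obtain Y where Y: "eigenfield (\<sigma> f) Y" "Y p = f" using eigenfield_through[OF pl tf Sf] by blast
  have sX: "smooth_on U X" and sY: "smooth_on U Y" using X Y by (auto simp: eigenfield_def)
  have Xl: "X x \<in> tangent x" "S x (X x) = \<sigma> e *\<^sub>R X x" and Yl: "Y x \<in> tangent x" "S x (Y x) = \<sigma> f *\<^sub>R Y x"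
    if "x \<in> level" for x using X Y that by (auto simp: eigenfield_def)
  have ef: "G p e f = 0" "G p e e = 1" "G p f f = 1" using onB e f ne by auto
  define A where "A = cov Y p f"
  define C where "C = cov X p e"
  define P where "P = cov Y p e"
  define Q where "Q = cov X p f"
  define T where "T g = G p (dS p e f) g" for g

  have normal_part: "G p (cov Z p u) (\<nu> p) = - G p (Z p) (S p u)"
    if "eigenfield s Z" "u \<in> tangent p" for s Z u
  proof -
    have sZ: "smooth_on U Z" and tZ: "\<And>y. y \<in> level \<Longrightarrow> G y (Z y) (\<nu> y) = 0"
      using that(1) level(1) tangent_iff G_sym by (auto simp: eigenfield_def)
    have "\<D> (\<lambda>y. G y (Z y) (\<nu> y)) p u = 0"
      by (rule deriv_zero_on_level[OF smooth_on_metric[OF sZ smooth_\<nu>] tZ pl that(2)])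
    then show ?thesis using cov_metric[OF sZ smooth_\<nu> p, of u] by simp
  qed

  have 1: "G p (cov (\<lambda>y. cov Y y (Y y)) p e) e = - G p A C"
  proof -
    \<comment> \<open>The form T(X,Y,Y) vanishes by \<open>dS_same_eigenvalue\<close> and equals
      T(Y,Y,X) by symmetry, which is a nonzero multiple of <nabla_Y Y, X>. This holds along the
      whole level set and can be differentiated along \<open>e\<close>.\<close>
    have z: "G x (cov Y x (Y x)) (X x) = 0" if "x \<in> level" for x
    proof -
      have "G x (dS x (Y x) (X x)) (Y x) = G x (dS x (X x) (Y x)) (Y x)"
        by (rule dS_total_sym[OF level(1)[OF that] Yl(1)[OF that] Xl(1)[OF that] Yl(1)[OF that]])
      then have "G x (dS x (Y x) (Y x)) (X x) = 0"
        using dS_same_eigenvalue[OF that Xl(1)[OF that] Yl(1)[OF that] Yl(2)[OF that] Yl(2)[OF that]]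
          dS_sym[OF level(1)[OF that], of "Y x" "Y x" "X x"] by simp
      then show ?thesis using dS_eigenfield[OF Y(1) that Yl(1)[OF that] Xl(2)[OF that]] ne by simp
    qed
    have "\<D> (\<lambda>y. G y (cov Y y (Y y)) (X y)) p e = 0"
      by (rule deriv_zero_on_level[OF smooth_on_metric[OF smooth_on_cov[OF sY sY] sX] z pl te])
    then show ?thesis
      using cov_metric[OF smooth_on_cov[OF sY sY] sX p, of e] X(2) Y(2) by (simp add: A_def C_def)
  qed
  have 2: "G p (cov (\<lambda>y. cov Y y (X y)) p f) e = - G p P Q"
  proof -
    have z: "G x (cov Y x (X x)) (X x) = 0" if "x \<in> level" for x
    proof -
      have "G x (dS x (X x) (Y x)) (X x) = G x (dS x (Y x) (X x)) (X x)"
        by (rule dS_total_sym[OF level(1)[OF that] Xl(1)[OF that] Yl(1)[OF that] Xl(1)[OF that]])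
      then have "G x (dS x (X x) (Y x)) (X x) = 0"
        using dS_same_eigenvalue[OF that Yl(1)[OF that] Xl(1)[OF that] Xl(2)[OF that] Xl(2)[OF that]] by simp
      then show ?thesis using dS_eigenfield[OF Y(1) that Xl(1)[OF that] Xl(2)[OF that]] ne by simp
    qed
    have "\<D> (\<lambda>y. G y (cov Y y (X y)) (X y)) p f = 0"
      by (rule deriv_zero_on_level[OF smooth_on_metric[OF smooth_on_cov[OF sY sX] sX] z pl tf])
    then show ?thesis
      using cov_metric[OF smooth_on_cov[OF sY sX] sX p, of f] X(2) Y(2) by (simp add: P_def Q_def)
  qed

  have Tfe: "G p (dS p f e) g = T g" if "g \<in> tangent p" for g
    using dS_total_sym[OF p te tf that] by (simp add: T_def)
  have Pg: "T g = (\<sigma> f - \<sigma> g) * G p P g" if "g \<in> B" for g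
    using dS_eigenfield[OF Y(1) pl te \<sigma>[OF that]] by (simp add: T_def Y(2) P_def)
  have Qg: "T g = (\<sigma> e - \<sigma> g) * G p Q g" if "g \<in> B" for g
    using dS_eigenfield[OF X(1) pl tf \<sigma>[OF that]] Tfe[OF tB[OF that]] by (simp add: X(2) Q_def)
  have T0: "T g = 0" if "g \<in> B" "\<sigma> g = \<sigma> e \<or> \<sigma> g = \<sigma> f" for g
    using Pg[OF that(1)] Qg[OF that(1)] that(2) by auto

  have A0: "G p A g = 0" if "g \<in> B" "\<sigma> g \<noteq> \<sigma> f" for g
  proof -
    have "G p (dS p f f) g = G p (dS p g f) f"
      using dS_total_sym[OF p tf tB[OF that(1)] tf] dS_sym[OF p, of f f g] by simp
    also have "\<dots> = 0" by (rule dS_same_eigenvalue[OF pl tB[OF that(1)] tf Sf Sf])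
    finally show ?thesis using dS_eigenfield[OF Y(1) pl tf \<sigma>[OF that(1)]] that(2) by (simp add: Y(2) A_def)
  qed
  have C0: "G p C g = 0" if "g \<in> B" "\<sigma> g \<noteq> \<sigma> e" for g
  proof -
    have "G p (dS p e e) g = G p (dS p g e) e"
      using dS_total_sym[OF p te tB[OF that(1)] te] dS_sym[OF p, of e e g] by simp
    also have "\<dots> = 0" by (rule dS_same_eigenvalue[OF pl tB[OF that(1)] te Se Se])
    finally show ?thesis using dS_eigenfield[OF X(1) pl te \<sigma>[OF that(1)]] that(2) by (simp add: X(2) C_def)
  qed
  \<comment> \<open>Tangentially \<open>A\<close> has components only for the eigenvalue of
    \<open>f\<close> and \<open>C\<close> only for that of \<open>e\<close>, so just the normal
    components contribute.\<close>
  have AC: "G p A C = \<sigma> e * \<sigma> f"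
  proof -
    have "G p A g * G p C g = 0" if "g \<in> B" for g using A0[OF that] C0[OF that] ne by (cases "\<sigma> g = \<sigma> e") auto
    then have "(\<Sum>g\<in>B. G p A g * G p C g) = 0" by (rule sum.neutral[OF ballI])
    moreover have "G p A (\<nu> p) = - \<sigma> f" "G p C (\<nu> p) = - \<sigma> e"
      using normal_part[OF Y(1) tf] normal_part[OF X(1) te]
      by (simp_all add: A_def C_def X(2) Y(2) Se Sf g.form_simps ef)
    ultimately show ?thesis by (subst parseval[OF p B]) simp
  qed

  have Pn: "G p P (\<nu> p) = 0" and Qn: "G p Q (\<nu> p) = 0"
    using normal_part[OF Y(1) te] normal_part[OF X(1) tf] ef
    by (simp_all add: P_def Q_def X(2) Y(2) Se Sf g.form_simps g.sym[of f e])
  let ?B' = "{g \<in> B. \<sigma> g \<noteq> \<sigma> e \<and> \<sigma> g \<noteq> \<sigma> f}"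
  define \<Theta> where "\<Theta> = (\<Sum>g\<in>?B'. (T g)\<^sup>2 / ((\<sigma> f - \<sigma> g) * (\<sigma> e - \<sigma> g)))"
  have PQ: "G p P Q = \<Theta>"
  proof -
    have "G p P Q = (\<Sum>g\<in>B. G p P g * G p Q g)" by (subst parseval[OF p B]) (simp add: Pn)
    also have "\<dots> = (\<Sum>g\<in>?B'. G p P g * G p Q g)"
    proof (rule sum.mono_neutral_right)
      show "\<forall>g\<in>B - ?B'. G p P g * G p Q g = 0"
      proof
        fix g assume g: "g \<in> B - ?B'"
        \<comment> \<open>Since \<open>\<sigma> e \<noteq> \<sigma> f\<close>, at least one of the
          two differences is nonzero, and the corresponding component vanishes.\<close>
        then have "(\<sigma> f - \<sigma> g) * G p P g = 0" "(\<sigma> e - \<sigma> g) * G p Q g = 0"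
          using T0[of g] Pg[of g] Qg[of g] by auto
        then show "G p P g * G p Q g = 0" using ne by auto
      qed
    qed (use finB in auto)
    also have "\<dots> = \<Theta>"
      unfolding \<Theta>_def
    proof (rule sum.cong)
      fix g assume g: "g \<in> ?B'"
      then have "G p P g = T g / (\<sigma> f - \<sigma> g)" "G p Q g = T g / (\<sigma> e - \<sigma> g)"
        using Pg[of g] Qg[of g] by (auto simp: eq_divide_eq mult.commute)
      then show "G p P g * G p Q g = (T g)\<^sup>2 / ((\<sigma> f - \<sigma> g) * (\<sigma> e - \<sigma> g))"
        by (simp add: power2_eq_square)
    qed simp
    finally show ?thesis .
  qed
  define w where "w = P - Q"
  have tw: "w \<in> tangent p"
    unfolding tangent_iff[OF p] by (simp add: w_def g.form_simps g.sym[of "\<nu> p"] Pn Qn)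
  \<comment> \<open>The eigenfield relation turns the bracket term into the trilinear form of
    \<open>w\<close>, \<open>f\<close>, \<open>e\<close>; total symmetry moves \<open>w\<close> to
    the last place, where it can be expanded in the eigenbasis.\<close>
  have W: "G p (cov Y p w) e = - \<Theta>"
  proof -
    have "(\<sigma> f - \<sigma> e) * G p (cov Y p w) e = G p (dS p w f) e"
      using dS_eigenfield[OF Y(1) pl tw Se] by (simp add: Y(2))
    also have "\<dots> = G p (dS p f w) e" by (rule dS_total_sym[OF p tw tf te])
    also have "\<dots> = G p (dS p f e) w" by (rule dS_sym[OF p])
    also have "\<dots> = (\<Sum>g\<in>B. G p (dS p f e) g * G p w g)"
      by (subst parseval[OF p B]) (simp add: w_def g.form_simps Pn Qn)
    also have "\<dots> = (\<Sum>g\<in>?B'. T g * G p w g)"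
      by (rule sum.mono_neutral_cong_right) (use finB T0 Tfe tB in auto)
    also have "\<dots> = (\<Sum>g\<in>?B'. - (\<sigma> f - \<sigma> e) * ((T g)\<^sup>2 / ((\<sigma> f - \<sigma> g) * (\<sigma> e - \<sigma> g))))"
    proof (rule sum.cong)
      fix g assume g: "g \<in> ?B'"
      have n: "\<sigma> f - \<sigma> g \<noteq> 0" "\<sigma> e - \<sigma> g \<noteq> 0" using g by auto
      have "G p P g = T g / (\<sigma> f - \<sigma> g)" "G p Q g = T g / (\<sigma> e - \<sigma> g)"
        using Pg[of g] Qg[of g] g n by (auto simp: eq_divide_eq mult.commute)
      \<comment> \<open>The components of \<open>P\<close> and \<open>Q\<close> are the same number
        divided by two different gaps. Subtracting the reciprocals produces the factor
        \<open>- (\<sigma> f - \<sigma> e)\<close>, which later cancels.\<close>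
      then have "T g * G p w g = T g * (T g / (\<sigma> f - \<sigma> g) - T g / (\<sigma> e - \<sigma> g))"
        by (simp add: w_def g.form_simps)
      also have "\<dots> = - (\<sigma> f - \<sigma> e) * ((T g)\<^sup>2 / ((\<sigma> f - \<sigma> g) * (\<sigma> e - \<sigma> g)))"
        using n by (simp add: divide_simps power2_eq_square) (simp add: algebra_simps)
      finally show "T g * G p w g = - (\<sigma> f - \<sigma> e) * ((T g)\<^sup>2 / ((\<sigma> f - \<sigma> g) * (\<sigma> e - \<sigma> g)))" .
    qed simp
    also have "\<dots> = (\<sigma> f - \<sigma> e) * (- \<Theta>)" unfolding \<Theta>_def sum_distrib_left[symmetric] by (rule minus_mult_commute)
    finally show ?thesis by (rule mult_left_cancel[THEN iffD1, rotated]) (use ne in simp)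
  qed
  have "\<kappa> p = G p (curvature G p e f f) e"
    using sectional[OF p, of e f] ef by simp
  also have "\<dots> = - G p A C + G p P Q - G p (cov Y p w) e"
    using ricci_identity[OF sX sY sY p] 1 2
    by (simp add: X(2) Y(2) g.form_simps w_def P_def Q_def)
  finally show ?thesis using AC PQ W unfolding \<Theta>_def T_def by simp
qed

lemma cartan_identity:
  assumes B: "inner_form.orthonormal (G p) B" "span B = tangent p" and \<sigma>: "\<And>g. g \<in> B \<Longrightarrow> S p g = \<sigma> g *\<^sub>R g"
    and e: "e \<in> B"
  shows "(\<Sum>f\<in>{f \<in> B. \<sigma> f \<noteq> \<sigma> e}. (\<kappa> p + \<sigma> e * \<sigma> f) / (\<sigma> e - \<sigma> f)) = 0"
proof -
  interpret g: inner_form "G p" by (rule inner[OF p])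
  have finB: "finite B" using B(1) by (auto simp: g.orthonormal_def)
  have tB: "u \<in> tangent p" if "u \<in> B" for u using that span_base B(2) by blast
  let ?C = "{f \<in> B. \<sigma> f \<noteq> \<sigma> e}"
  \<comment> \<open>The summand of \<open>gauss\<close> divided by
    \<open>\<sigma> e - \<sigma> f\<close>, set to 0 for equal eigenvalues so that both indices run
    over the same set \<open>?C\<close>.\<close>
  define q where "q f g = (if \<sigma> f = \<sigma> g then 0 else
     (G p (dS p e f) g)\<^sup>2 / ((\<sigma> f - \<sigma> g) * (\<sigma> e - \<sigma> g) * (\<sigma> e - \<sigma> f)))" for f g
  have "(\<kappa> p + \<sigma> e * \<sigma> f) / (\<sigma> e - \<sigma> f) = 2 * (\<Sum>g\<in>?C. q f g)" if f: "f \<in> ?C" for f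
  proof -
    have "(\<kappa> p + \<sigma> e * \<sigma> f) / (\<sigma> e - \<sigma> f) = 2 * (\<Sum>g\<in>{g \<in> B. \<sigma> g \<noteq> \<sigma> e \<and> \<sigma> g \<noteq> \<sigma> f}.
      (G p (dS p e f) g)\<^sup>2 / ((\<sigma> f - \<sigma> g) * (\<sigma> e - \<sigma> g)) / (\<sigma> e - \<sigma> f))"
      using gauss[OF B \<sigma> e, of f] f by (simp only: sum_divide_distrib[symmetric]) auto
    also have "(\<Sum>g\<in>{g \<in> B. \<sigma> g \<noteq> \<sigma> e \<and> \<sigma> g \<noteq> \<sigma> f}.
      (G p (dS p e f) g)\<^sup>2 / ((\<sigma> f - \<sigma> g) * (\<sigma> e - \<sigma> g)) / (\<sigma> e - \<sigma> f)) = (\<Sum>g\<in>?C. q f g)"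
      by (rule sum.mono_neutral_cong_left) (use finB in \<open>auto simp: q_def\<close>)
    finally show ?thesis .
  qed
  then have 1: "(\<Sum>f\<in>?C. (\<kappa> p + \<sigma> e * \<sigma> f) / (\<sigma> e - \<sigma> f)) = 2 * (\<Sum>f\<in>?C. \<Sum>g\<in>?C. q f g)"
    by (simp add: sum_distrib_left)
  have 2: "(\<Sum>f\<in>?C. \<Sum>g\<in>?C. q f g) = (\<Sum>f\<in>?C. \<Sum>g\<in>?C. q g f)"
    by (rule sum.swap)
  have anti: "q g f = - q f g" if "f \<in> ?C" "g \<in> ?C" for f g
  proof -
    \<comment> \<open>Exchanging \<open>f\<close> and \<open>g\<close> reverses the sign of the
      denominator and, by \<open>dS_sym\<close>, preserves the numerator.\<close>
    have "(\<sigma> g - \<sigma> f) * (\<sigma> e - \<sigma> f) * (\<sigma> e - \<sigma> g) = - ((\<sigma> f - \<sigma> g) * (\<sigma> e - \<sigma> g) * (\<sigma> e - \<sigma> f))"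
      by (simp add: algebra_simps)
    moreover have "G p (dS p e g) f = G p (dS p e f) g" by (rule dS_sym[OF p])
    ultimately show ?thesis unfolding q_def by (simp only: minus_divide_right) auto
  qed
  have 3: "(\<Sum>f\<in>?C. \<Sum>g\<in>?C. q g f) = - (\<Sum>f\<in>?C. \<Sum>g\<in>?C. q f g)"
    unfolding sum_negf[symmetric] by (intro sum.cong refl anti)
  show ?thesis using 1 2 3 by linarith
qed

end

subsection \<open>Curvature of the warped product\<close>

locale warped_chart = riemannian_chart U G for U :: "'a::euclidean_space set" and G +
  fixes I :: "real set" and \<rho> :: "real \<Rightarrow> real"
  assumes open_I: "open I" and smooth_\<rho>: "smooth_on I \<rho>" and \<rho>_pos: "t \<in> I \<Longrightarrow> \<rho> t > 0"
begin

abbreviation \<rho>' :: "real \<Rightarrow> real" where "\<rho>' \<equiv> deriv \<rho>"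

abbreviation G' :: "real \<times> 'a \<Rightarrow> real \<times> 'a \<Rightarrow> real \<times> 'a \<Rightarrow> real" where "G' \<equiv> warped_metric \<rho> G"

lemma \<rho>_deriv: "t \<in> I \<Longrightarrow> (\<rho> has_real_derivative \<rho>' t) (at t)"
  using smooth_on_has_derivative[OF smooth_\<rho>] DERIV_deriv_iff_real_differentiable
  by (metis differentiable_def)

lemma smooth_\<rho>': "smooth_on I \<rho>'"
proof (rule smooth_on_cong[OF open_I _ smooth_on_deriv[OF smooth_\<rho>, of 1]])
  show "\<D> \<rho> t 1 = \<rho>' t" if "t \<in> I" for t
    using has_derivative_along[OF \<rho>_deriv[OF that, unfolded has_field_derivative_def]] by simp
qed

lemma \<rho>'_deriv: "t \<in> I \<Longrightarrow> (\<rho>' has_derivative \<D> \<rho>' t) (at t)"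
  by (rule smooth_on_has_derivative[OF smooth_\<rho>'])

text \<open>The formula is checked against the characterisation in \<open>levi_civita_eqI\<close>.
  The time component carries a plus sign because the metric is \<open>- dt^2\<close> on
  \<open>I\<close>.\<close>

lemma levi_civita_warped:
  assumes t: "t \<in> I" and x: "x \<in> U"
  shows "levi_civita G' (t, x) (r, u) (s, v) =
    (\<rho> t * \<rho>' t * G x u v, \<Gamma> x u v + (\<rho>' t / \<rho> t) *\<^sub>R (r *\<^sub>R v + s *\<^sub>R u))"
proof -
  note [simp] = G_simps[OF x] \<Gamma>_simps[OF x]
  define L where "L = (\<lambda>(r, u) (s, v). (\<rho> t * \<rho>' t * G x u v, \<Gamma> x u v + (\<rho>' t / \<rho> t) *\<^sub>R (r *\<^sub>R v + s *\<^sub>R u)))"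
  have \<rho>0: "\<rho> t \<noteq> 0" using \<rho>_pos[OF t] by simp
  have "levi_civita G' (t, x) = L"
  proof (rule levi_civita_eqI)
    show "bilinear (G' (t, x))"
      unfolding bilinear_def warped_metric_def
      by (auto intro!: linearI simp: algebra_simps)
    show "G' (t, x) v w = G' (t, x) w v" for v w
      by (cases v; cases w) (simp add: warped_metric_def G_sym[OF x])
    show "v = 0" if "\<And>w. G' (t, x) v w = 0" for v
    proof -
      obtain r u where v: "v = (r, u)" by (cases v)
      have "r = 0" using that[of "(1, 0)"] by (simp add: v warped_metric_def)
      moreover have "G x u u = 0" using that[of "(0, u)"] \<rho>0 by (simp add: v warped_metric_def)
      then have "u = 0" using inner_form.pos[OF inner[OF x], of u] by auto
      ultimately show ?thesis by (simp add: v zero_prod_def)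
    qed
    show "bilinear L"
      unfolding bilinear_def L_def by (auto intro!: linearI simp: algebra_simps add_divide_distrib)
    show "L u v = L v u" for u v
      by (cases u; cases v) (simp add: L_def G_sym[OF x] \<Gamma>_sym[OF x] add.commute)
    show "\<D> (\<lambda>y. G' y v w) (t, x) u = G' (t, x) (L u v) w + G' (t, x) v (L u w)" for u v w
    proof -
      obtain ru u' rv v' rw w' where e: "u = (ru, u')" "v = (rv, v')" "w = (rw, w')" by (metis surj_pair)
      have g: "((\<lambda>p. G (snd p) v' w') has_derivative (\<lambda>q. \<D> (\<lambda>y. G y v' w') x (snd q))) (at (t, x))"
        by (rule has_derivative_compose[where f=snd and g="\<lambda>y. G y v' w'"])
          (use smooth_on_has_derivative[OF smooth_G x] in \<open>auto intro!: derivative_eq_intros\<close>)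
      have r: "((\<lambda>p. \<rho> (fst p)) has_derivative (\<lambda>q. \<rho>' t * fst q)) (at (t, x))"
        by (rule has_derivative_compose[where f=fst and g=\<rho>])
          (use \<rho>_deriv[OF t] in \<open>auto intro!: derivative_eq_intros simp: has_field_derivative_def\<close>)
      have "((\<lambda>p. - (rv * rw) + (\<rho> (fst p))\<^sup>2 * G (snd p) v' w') has_derivative
        (\<lambda>q. (\<rho> t)\<^sup>2 * \<D> (\<lambda>y. G y v' w') x (snd q) + 2 * (\<rho>' t * fst q) * \<rho> t * G x v' w')) (at (t, x))"
        by (rule derivative_eq_intros g r refl | simp)+
      then have "\<D> (\<lambda>p. - (rv * rw) + (\<rho> (fst p))\<^sup>2 * G (snd p) v' w') (t, x) u =
         2 * \<rho> t * \<rho>' t * ru * G x v' w' + (\<rho> t)\<^sup>2 * \<D> (\<lambda>y. G y v' w') x u'"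
        by (simp add: has_derivative_along e)
      then show ?thesis
        using \<rho>0
        by (simp add: e warped_metric_def L_def case_prod_unfold metric_compatible[OF x] G_sym[OF x, of _ u']
            power2_eq_square field_simps)
    qed
  qed
  then show ?thesis by (simp add: L_def)
qed

text \<open>The Gauss equation of a slice of constant time. The extra term arises because nabla_v w
  has time component \<open>\<rho> t * \<rho>' t * G x v w\<close>, which nabla_u turns into a
  multiple of \<open>u\<close> with factor \<open>\<rho>' t / \<rho> t\<close>.\<close>

lemma curvature_warped:
  assumes t: "t \<in> I" and x: "x \<in> U"
  shows "snd (curvature G' (t, x) (0, u) (0, v) (0, w)) =
    curvature G x u v w + (\<rho>' t)\<^sup>2 *\<^sub>R (G x v w *\<^sub>R u - G x u w *\<^sub>R v)"
proof -
  have \<rho>0: "\<rho> t \<noteq> 0" using \<rho>_pos[OF t] by simp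
  have c: "cov_deriv G' v (\<lambda>_. w) = (\<lambda>y. levi_civita G' y v w)" for v w
    by (simp add: cov_deriv_def cov_deriv_along_def)
  have d: "snd (cov_deriv G' (0, u) (cov_deriv G' (0, v) (\<lambda>_. (0, w))) (t, x)) =
      \<D> (\<lambda>y. \<Gamma> y v w) x u + \<Gamma> x u (\<Gamma> x v w) + (\<rho>' t)\<^sup>2 *\<^sub>R (G x v w *\<^sub>R u)" for u v
  proof -
    have g: "((\<lambda>p. G (snd p) v w) has_derivative (\<lambda>q. \<D> (\<lambda>y. G y v w) x (snd q))) (at (t, x))"
      by (rule has_derivative_compose[where f=snd and g="\<lambda>y. G y v w"])
        (use smooth_on_has_derivative[OF smooth_G x] in \<open>auto intro!: derivative_eq_intros\<close>)
    have \<Gamma>: "((\<lambda>p. \<Gamma> (snd p) v w) has_derivative (\<lambda>q. \<D> (\<lambda>y. \<Gamma> y v w) x (snd q))) (at (t, x))"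
      by (rule has_derivative_compose[where f=snd and g="\<lambda>y. \<Gamma> y v w"])
        (use smooth_on_has_derivative[OF smooth_\<Gamma> x] in \<open>auto intro!: derivative_eq_intros\<close>)
    have r: "((\<lambda>p. \<rho> (fst p)) has_derivative (\<lambda>q. \<rho>' t * fst q)) (at (t, x))"
      by (rule has_derivative_compose[where f=fst and g=\<rho>])
        (use \<rho>_deriv[OF t] in \<open>auto intro!: derivative_eq_intros simp: has_field_derivative_def\<close>)
    have r': "((\<lambda>p. \<rho>' (fst p)) has_derivative (\<lambda>q. \<D> \<rho>' t (fst q))) (at (t, x))"
      by (rule has_derivative_compose[where f=fst and g=\<rho>'])
        (use \<rho>'_deriv[OF t] in \<open>auto intro!: derivative_eq_intros\<close>)
    have "((\<lambda>p. (\<rho> (fst p) * \<rho>' (fst p) * G (snd p) v w, \<Gamma> (snd p) v w)) has_derivative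
      (\<lambda>q. ((\<rho> t * \<rho>' t) * \<D> (\<lambda>y. G y v w) x (snd q) + (\<rho> t * \<D> \<rho>' t (fst q) + (\<rho>' t * fst q) * \<rho>' t) * G x v w,
        \<D> (\<lambda>y. \<Gamma> y v w) x (snd q)))) (at (t, x))"
      using has_derivative_Pair[OF has_derivative_mult[OF has_derivative_mult[OF r r'] g] \<Gamma>] by simp
    then have "((\<lambda>p. levi_civita G' p (0, v) (0, w)) has_derivative
      (\<lambda>q. ((\<rho> t * \<rho>' t) * \<D> (\<lambda>y. G y v w) x (snd q) + (\<rho> t * \<D> \<rho>' t (fst q) + (\<rho>' t * fst q) * \<rho>' t) * G x v w,
        \<D> (\<lambda>y. \<Gamma> y v w) x (snd q)))) (at (t, x))"
      by (rule has_derivative_transform_within_open[OF _ open_Times[OF open_I open_U]])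
        (use t x in \<open>auto simp: levi_civita_warped\<close>)
    then show ?thesis
      using \<rho>0
      by (simp add: cov_deriv_def[of _ "(0, u)"] cov_deriv_along_def c has_derivative_along
          levi_civita_warped[OF t x] power2_eq_square mult.assoc)
  qed
  show ?thesis
    unfolding curvature_def[of G'] snd_diff d curvature_expand[OF x]
    by (simp add: algebra_simps)
qed

text \<open>The ambient hypothesis is applied to planes tangent to a slice. It says nothing about
  dependent pairs, for which both sides are shown to vanish.\<close>

lemma sectional_base:
  assumes t: "t \<in> I" and x: "x \<in> U"
    and K: "\<And>u v. nondegenerate_pair G' (t, x) u v \<Longrightarrow> sectional_curvature G' (t, x) u v = c"
  shows "G x (curvature G x u v v) u = (c * (\<rho> t)\<^sup>2 - (\<rho>' t)\<^sup>2) * (G x u u * G x v v - (G x u v)\<^sup>2)"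
proof (cases "G x u u * G x v v - (G x u v)\<^sup>2 = 0")
  case True
  have "G x (curvature G x u v v) u = 0"
  proof (cases "v = 0")
    case True
    then show ?thesis
      using curvature_scale[OF x, of 0 v u v] curvature_anti[of x u v v] by (simp add: G_simps[OF x])
  next
    case False
    then have v: "G x v v \<noteq> 0" using inner_form.pos[OF inner[OF x], of v] by simp
    \<comment> \<open>The equality case of Cauchy-Schwarz: the part of \<open>u\<close> orthogonal
      to \<open>v\<close> has length zero, so \<open>u\<close> is a multiple of
      \<open>v\<close>.\<close>
    define q where "q = G x u v / G x v v"
    have "G x (u - q *\<^sub>R v) (u - q *\<^sub>R v) = G x u u - q * G x u v"
      using v by (simp add: G_simps[OF x] G_sym[OF x, of v u] q_def algebra_simps)
    also have "\<dots> = 0" using True v by (simp add: q_def field_simps power2_eq_square)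
    finally have "u = q *\<^sub>R v" using inner_form.pos[OF inner[OF x], of "u - q *\<^sub>R v"] by (metis eq_iff_diff_eq_0 less_irrefl)
    moreover have "curvature G x v v v = 0" by (simp add: curvature_def)
    ultimately show ?thesis by (simp add: curvature_scale[OF x] G_simps[OF x])
  qed
  then show ?thesis using True by simp
next
  case False
  have \<rho>0: "\<rho> t \<noteq> 0" using \<rho>_pos[OF t] by simp
  have w: "G' (t, x) (0, u) (0, v) = (\<rho> t)\<^sup>2 * G x u v" for u v by (simp add: warped_metric_def)
  have w': "G' (t, x) y (0, v) = (\<rho> t)\<^sup>2 * G x (snd y) v" for y v by (cases y) (simp add: warped_metric_def)
  let ?d = "G x u u * G x v v - (G x u v)\<^sup>2"
  have d: "G' (t, x) (0, u) (0, u) * G' (t, x) (0, v) (0, v) - (G' (t, x) (0, u) (0, v))\<^sup>2 = (\<rho> t)^4 * ?d"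
    unfolding w by (simp add: power2_eq_square power4_eq_xxxx algebra_simps)
  have "sectional_curvature G' (t, x) (0, u) (0, v) = c"
    by (rule K) (use d False \<rho>0 in \<open>simp add: nondegenerate_pair_def\<close>)
  then have "(\<rho> t)\<^sup>2 * (G x (curvature G x u v v) u + (\<rho>' t)\<^sup>2 * ?d) = c * ((\<rho> t)^4 * ?d)"
    unfolding sectional_curvature_def d w' curvature_warped[OF t x]
    using False \<rho>0 by (simp add: divide_eq_eq G_simps[OF x] G_sym[OF x, of v u] power2_eq_square power4_eq_xxxx algebra_simps)
  moreover have "c * ((\<rho> t)^4 * ?d) = (\<rho> t)\<^sup>2 * (c * (\<rho> t)\<^sup>2 * ?d)"
    by (simp add: power2_eq_square power4_eq_xxxx)
  ultimately have "G x (curvature G x u v v) u + (\<rho>' t)\<^sup>2 * ?d = c * (\<rho> t)\<^sup>2 * ?d"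
    using \<rho>0 by (metis mult_left_cancel power_not_zero)
  then show ?thesis by (simp add: left_diff_distrib)
qed

end

subsection \<open>The screen shape operator of a transnormal graph\<close>

lemma riemannian_manifold_chart:
  assumes "riemannian_manifold F" shows "riemannian_chart (coord_image F i) (metric F i)"
  using assms unfolding riemannian_manifold_def smooth_manifold_def
  by unfold_locales (auto simp: inner_form_def)

locale transnormal_graph =
  fixes F :: "('m::{t2_space,second_countable_topology}, 'i, 'a::euclidean_space) metric_manifold"
    and I :: "real set" and \<rho> :: "real \<Rightarrow> real" and f :: "'m \<Rightarrow> real" and c :: real and k :: 'i
  assumes riemannian: "riemannian_manifold F" and I: "open I"
    and \<rho>_smooth: "smooth_on I \<rho>" and \<rho>_positive: "\<And>t. t \<in> I \<Longrightarrow> \<rho> t > 0"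
    and curv: "constant_sectional_curvature (warped_product I \<rho> F) c"
    and transnormal: "transnormal I \<rho> F f"
begin

abbreviation U :: "'a set" where "U \<equiv> coord_image F k"
abbreviation G :: "'a \<Rightarrow> 'a \<Rightarrow> 'a \<Rightarrow> real" where "G \<equiv> metric F k"
abbreviation h :: "'a \<Rightarrow> real" where "h \<equiv> local_rep F k f"
abbreviation grad :: "'a \<Rightarrow> 'a" where "grad \<equiv> gradient G h"

sublocale warped_chart U G I \<rho>
  by (intro warped_chart.intro riemannian_manifold_chart riemannian warped_chart_axioms.intro)
    (use I \<rho>_smooth \<rho>_positive in auto)

lemma coord_inv: "p \<in> patch F k \<Longrightarrow> coord_inv F k (coord F k p) = p"
  using riemannian unfolding riemannian_manifold_def smooth_manifold_def homeomorphism_def by blast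

lemma h_coord: "p \<in> patch F k \<Longrightarrow> h (coord F k p) = f p"
  by (simp add: local_rep_def coord_inv)

lemma smooth_on_h: "smooth_on U h"
  using transnormal by (simp add: transnormal_def smooth_function_def)

lemma h_in_I: "x \<in> U \<Longrightarrow> h x \<in> I"
  using transnormal h_coord by (fastforce simp: transnormal_def coord_image_def points_def)

lemma gradient_eq_sharp: assumes x: "x \<in> U" shows "grad x = sharp x (\<D> h x)"
  unfolding gradient_def
proof (rule the_equality)
  show 1: "\<forall>v. G x (sharp x (\<D> h x)) v = \<D> h x v"
    using sharp[OF x smooth_on_linear_deriv[OF smooth_on_h x]] by blast
  show "w = sharp x (\<D> h x)" if "\<forall>v. G x w v = \<D> h x v" for w
    using that 1 by (intro inner_form.eqI[OF inner[OF x]]) auto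
qed

lemma gradient: "x \<in> U \<Longrightarrow> G x (grad x) v = \<D> h x v"
  unfolding gradient_eq_sharp by (rule sharp[OF _ smooth_on_linear_deriv[OF smooth_on_h]])

lemma smooth_on_gradient: "smooth_on U grad"
  by (rule smooth_on_cong[OF open_U _ smooth_on_sharp[OF smooth_on_deriv[OF smooth_on_h]]])
    (simp add: gradient_eq_sharp)

lemma norm_gradient: assumes x: "x \<in> U" shows "G x (grad x) (grad x) = (\<rho> (h x))\<^sup>2"
proof -
  obtain p where p: "p \<in> patch F k" "x = coord F k p" using x by (auto simp: coord_image_def)
  have "sqrt (G x (grad x) (grad x)) = \<rho> (h x)"
    using transnormal p h_coord[OF p(1)] by (auto simp: transnormal_def Let_def)
  then show ?thesis using inner_form.nonneg[OF inner[OF x], of "grad x"] by (metis real_sqrt_pow2)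
qed

definition a :: "'a \<Rightarrow> real" where "a x = inverse (\<rho> (h x))"
definition \<nu> :: "'a \<Rightarrow> 'a" where "\<nu> x = a x *\<^sub>R grad x"
definition \<kappa> :: "'a \<Rightarrow> real" where "\<kappa> x = c * (\<rho> (h x))\<^sup>2 - (\<rho>' (h x))\<^sup>2"

lemma \<rho>h_pos: "x \<in> U \<Longrightarrow> \<rho> (h x) > 0" using \<rho>_positive h_in_I by blast

text \<open>Transnormality acts twice: it makes \<open>\<nu>\<close> a unit field, and it makes the
  normalising factor \<open>a\<close> a function of \<open>h\<close>, namely
  \<open>1 / \<rho>\<close>, whose derivative is the coefficient given for \<open>b\<close>.\<close>

sublocale unit_normal_chart U G h a "\<lambda>x. - \<rho>' (h x) / (\<rho> (h x))\<^sup>2" \<kappa> \<nu>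
proof
  show "smooth_on U h" by (rule smooth_on_h)
  show a: "smooth_on U a"
    unfolding a_def[abs_def]
    by (rule smooth_on_inverse_real[OF open_U smooth_on_compose_real[OF open_U smooth_\<rho> smooth_on_h]])
      (use \<rho>h_pos h_in_I in force)+
  show "smooth_on U \<nu>"
    unfolding \<nu>_def[abs_def] by (rule smooth_on_scaleR[OF open_U a smooth_on_gradient])
  fix x u v assume x: "x \<in> U"
  show "a x \<noteq> 0" using \<rho>h_pos[OF x] by (simp add: a_def)
  show "G x (\<nu> x) v = a x * \<D> h x v" by (simp add: \<nu>_def G_simps[OF x] gradient[OF x])
  show "G x (\<nu> x) (\<nu> x) = 1"
    using \<rho>h_pos[OF x] by (simp add: \<nu>_def G_simps[OF x] norm_gradient[OF x] a_def power2_eq_square mult.assoc[symmetric])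
  show "\<D> a x u = - \<rho>' (h x) / (\<rho> (h x))\<^sup>2 * \<D> h x u"
  proof -
    have "((\<lambda>y. \<rho> (h y)) has_derivative (\<lambda>u. \<rho>' (h x) * \<D> h x u)) (at x)"
      by (rule has_derivative_compose[OF smooth_on_has_derivative[OF smooth_on_h x]])
        (use \<rho>_deriv[OF h_in_I[OF x]] in \<open>simp add: has_field_derivative_def\<close>)
    then have "(a has_derivative (\<lambda>u. - (inverse (\<rho> (h x)) * (\<rho>' (h x) * \<D> h x u) * inverse (\<rho> (h x))))) (at x)"
      unfolding a_def[abs_def] using \<rho>h_pos[OF x] by (intro Deriv.has_derivative_inverse) auto
    then show ?thesis by (simp add: has_derivative_along divide_inverse power2_eq_square)
  qed
  show "G x (curvature G x u v v) u = \<kappa> x * (G x u u * G x v v - (G x u v)\<^sup>2)"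
    unfolding \<kappa>_def
  proof (rule sectional_base[OF h_in_I[OF x] x])
    have "(h x, x) \<in> coord_image (warped_product I \<rho> F) k"
      using x h_in_I[OF x] by (force simp: coord_image_def warped_product_def)
    then show "sectional_curvature (warped_metric \<rho> G) (h x, x) u v = c"
      if "nondegenerate_pair (warped_metric \<rho> G) (h x, x) u v" for u v
      using curv[unfolded constant_sectional_curvature_def, rule_format, of "(h x, x)" k u v] that
      by (simp add: warped_product_def)
  qed
qed

section \<open>Null fields, induced connection and screen shape operator\<close>

lemma deriv_graph_map: "x \<in> U \<Longrightarrow> \<D> (graph_map F f k) x u = (\<D> h x u, u)"
  unfolding graph_map_def
  by (rule has_derivative_along) (intro has_derivative_Pair smooth_on_has_derivative[OF smooth_on_h] has_derivative_ident)

lemma tangent_M_eq: "x \<in> U \<Longrightarrow> tangent_M F f k x = {(\<D> h x u, u) |u. True}"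
  by (auto simp: tangent_M_def deriv_graph_map image_def)

lemma screen_eq: "x \<in> U \<Longrightarrow> screen F f k x = Pair 0 ` tangent x"
  by (auto simp: screen_def tangent_M_eq)

lemma xi_eq: "xi \<rho> F f k x = (1 / sqrt 2) *\<^sub>R (1, a x *\<^sub>R \<nu> x)"
  and nu_eq: "nu \<rho> F f k x = (1 / sqrt 2) *\<^sub>R (- 1, a x *\<^sub>R \<nu> x)"
  by (simp_all add: xi_def nu_def \<nu>_def a_def power2_eq_square divide_inverse)

text \<open>\<open>xi\<close> and \<open>nu\<close> differ only in the sign of their time component,
  so one computation with \<open>\<epsilon>\<close> serves both. Along the level set
  \<open>a\<close> is constant, and the constant time component contributes the multiple of
  \<open>u\<close> through the warping.\<close>

lemma ambient_deriv_null:
  assumes x: "x \<in> U" and u: "u \<in> tangent x"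
  shows "ambient_deriv \<rho> F f k (\<lambda>y. (1 / sqrt 2) *\<^sub>R (\<epsilon>, a y *\<^sub>R \<nu> y)) x (0, u)
    = (0, (1 / sqrt 2) *\<^sub>R (a x *\<^sub>R (S x u + (\<epsilon> * \<rho>' (h x)) *\<^sub>R u)))"
proof -
  have \<nu>u: "G x u (\<nu> x) = 0" using u tangent_iff[OF x] G_sym[OF x] by simp
  have "((\<lambda>y. (1 / sqrt 2) *\<^sub>R (\<epsilon>, a y *\<^sub>R \<nu> y)) has_derivative
    (\<lambda>u. (1 / sqrt 2) *\<^sub>R (0, a x *\<^sub>R \<D> \<nu> x u + \<D> a x u *\<^sub>R \<nu> x))) (at x)"
    by (intro has_derivative_scaleR_right has_derivative_Pair has_derivative_const has_derivative_scaleR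
        smooth_on_has_derivative[OF smooth_a x] smooth_on_has_derivative[OF smooth_\<nu> x])
  then have "\<D> (\<lambda>y. (1 / sqrt 2) *\<^sub>R (\<epsilon>, a y *\<^sub>R \<nu> y)) x u = (0, (1 / sqrt 2) *\<^sub>R (a x *\<^sub>R \<D> \<nu> x u))"
    using u deriv_a[OF x, of u] by (simp add: has_derivative_along)
  then show ?thesis
    using u \<nu>u
    by (simp add: ambient_deriv_def cov_deriv_along_def deriv_graph_map[OF x] graph_map_def
        levi_civita_warped[OF h_in_I[OF x] x] G_simps[OF x] \<Gamma>_simps[OF x] cov_def a_def
        divide_inverse scaleR_add_right mult.commute mult.left_commute)
qed

text \<open>In a screen direction the derivative of \<open>nu\<close> has no time part and is
  tangent to the level set, hence orthogonal to \<open>xi\<close>.\<close>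

lemma tau_eq_zero:
  assumes x: "x \<in> U" and u: "u \<in> tangent x" shows "tau \<rho> F f k x (0, u) = 0"
proof -
  have "G x u (\<nu> x) = 0" "G x (S x u) (\<nu> x) = 0"
    using u tangent_iff[OF x] G_sym[OF x] S_normal[OF x] by simp_all
  then show ?thesis
    unfolding tau_def nu_eq[abs_def] ambient_deriv_null[OF x u] xi_eq
    by (simp add: graph_map_def warped_metric_def G_simps[OF x])
qed

lemma induced_deriv_xi:
  assumes x: "x \<in> U" and u: "u \<in> tangent x"
  shows "induced_deriv \<rho> F f k (xi \<rho> F f k) x (0, u) = (0, (1 / sqrt 2) *\<^sub>R (a x *\<^sub>R (S x u + \<rho>' (h x) *\<^sub>R u)))"
    (is "_ = (0, ?w)")
proof -
  note lin = smooth_on_linear_deriv[OF smooth_on_h x]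
  have "?w \<in> tangent x"
    using S_tangent[OF x, of u] u by (simp add: linear.scaleR[OF lin] linear_add[OF lin])
  then have w: "(0, ?w) \<in> tangent_M F f k x" by (auto simp: tangent_M_eq[OF x])
  have amb: "ambient_deriv \<rho> F f k (xi \<rho> F f k) x (0, u) = (0, ?w)"
    unfolding xi_eq[abs_def] using ambient_deriv_null[OF x u, of 1] by simp
  \<comment> \<open>Transversality of \<open>nu\<close>: its space part has \<open>\<D> h\<close>
    equal to \<open>1 / sqrt 2\<close>, whereas its time component is the negative of that, so it is
    not tangent to the graph.\<close>
  have a\<nu>: "a x * \<D> h x (\<nu> x) = 1" using unit[OF x] normal[OF x] by simp
  show ?thesis
    unfolding induced_deriv_def amb
  proof (rule the_equality)
    show "(0, ?w) \<in> tangent_M F f k x \<and> (\<exists>b. (0, ?w) = (0, ?w) + b *\<^sub>R nu \<rho> F f k x)"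
      using w by (auto intro: exI[of _ 0])
    fix Y assume "Y \<in> tangent_M F f k x \<and> (\<exists>b. (0, ?w) = Y + b *\<^sub>R nu \<rho> F f k x)"
    then obtain v b where Y: "Y = (\<D> h x v, v)" and b: "(0, ?w) = Y + b *\<^sub>R nu \<rho> F f k x"
      by (auto simp: tangent_M_eq[OF x])
    have "?w = v + (b / sqrt 2) *\<^sub>R (a x *\<^sub>R \<nu> x)" and v: "\<D> h x v = b / sqrt 2"
      using b by (simp_all add: Y nu_eq)
    then have "\<D> h x ?w = \<D> h x v + (b / sqrt 2) * (a x * \<D> h x (\<nu> x))"
      by (simp add: linear_add[OF lin] linear.scaleR[OF lin])
    then have "b = 0" using v a\<nu> \<open>?w \<in> tangent x\<close> by simp
    then show "Y = (0, ?w)" using b by simp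
  qed
qed

lemma screen_shape_eq:
  assumes x: "x \<in> U" and u: "u \<in> tangent x"
  shows "screen_shape \<rho> F f k x (0, u) = (0, - (1 / sqrt 2) *\<^sub>R (a x *\<^sub>R (S x u + \<rho>' (h x) *\<^sub>R u)))"
  unfolding screen_shape_def induced_deriv_xi[OF x u] tau_eq_zero[OF x u]
proof (rule the_equality)
  note lin = smooth_on_linear_deriv[OF smooth_on_h x]
  have "- (1 / sqrt 2) *\<^sub>R (a x *\<^sub>R (S x u + \<rho>' (h x) *\<^sub>R u)) \<in> tangent x"
    using S_tangent[OF x, of u] u by (simp add: linear_neg[OF lin] linear.scaleR[OF lin] linear_add[OF lin])
  then show "(0, - (1 / sqrt 2) *\<^sub>R (a x *\<^sub>R (S x u + \<rho>' (h x) *\<^sub>R u))) \<in> screen F f k x \<and>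
    (0, (1 / sqrt 2) *\<^sub>R (a x *\<^sub>R (S x u + \<rho>' (h x) *\<^sub>R u))) =
    - (0, - (1 / sqrt 2) *\<^sub>R (a x *\<^sub>R (S x u + \<rho>' (h x) *\<^sub>R u))) - 0 *\<^sub>R xi \<rho> F f k x"
    unfolding screen_eq[OF x] by (auto intro: imageI)
  fix Y assume "Y \<in> screen F f k x \<and>
    (0, (1 / sqrt 2) *\<^sub>R (a x *\<^sub>R (S x u + \<rho>' (h x) *\<^sub>R u))) = - Y - 0 *\<^sub>R xi \<rho> F f k x"
  then have "- Y = (0, (1 / sqrt 2) *\<^sub>R (a x *\<^sub>R (S x u + \<rho>' (h x) *\<^sub>R u)))" by simp
  then have "Y = - (0, (1 / sqrt 2) *\<^sub>R (a x *\<^sub>R (S x u + \<rho>' (h x) *\<^sub>R u)))" by (metis minus_minus)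
  then show "Y = (0, - (1 / sqrt 2) *\<^sub>R (a x *\<^sub>R (S x u + \<rho>' (h x) *\<^sub>R u)))" by simp
qed

text \<open>The eigenvalue of \<open>S = \<nabla>\<nu>\<close> that corresponds to the screen principal curvature \<open>\<mu>\<close>.\<close>

definition level_curvature :: "real \<Rightarrow> real \<Rightarrow> real" where
  "level_curvature t \<mu> = - (sqrt 2 * \<rho> t * \<mu> + \<rho>' t)"

lemma screen_eigenspace_eq:
  assumes p: "snd z \<in> patch F k" and x: "x = coord F k (snd z)"
  shows "screen_eigenspace \<rho> F f k z \<mu> = Pair 0 ` {u \<in> tangent x. S x u = level_curvature (h x) \<mu> *\<^sub>R u}"
proof -
  have xU: "x \<in> U" using p by (auto simp: x coord_image_def)
  have *: "- (1 / sqrt 2) *\<^sub>R (a x *\<^sub>R (S x u + \<rho>' (h x) *\<^sub>R u)) = \<mu> *\<^sub>R u \<longleftrightarrow> S x u = level_curvature (h x) \<mu> *\<^sub>R u"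
    for u
  proof -
    have r: "sqrt 2 * \<rho> (h x) \<noteq> 0" using \<rho>h_pos[OF xU] by simp
    have "- (1 / sqrt 2) *\<^sub>R (a x *\<^sub>R (S x u + \<rho>' (h x) *\<^sub>R u)) = \<mu> *\<^sub>R u \<longleftrightarrow>
      (- (sqrt 2 * \<rho> (h x))) *\<^sub>R (- (1 / sqrt 2) *\<^sub>R (a x *\<^sub>R (S x u + \<rho>' (h x) *\<^sub>R u))) =
      (- (sqrt 2 * \<rho> (h x))) *\<^sub>R (\<mu> *\<^sub>R u)"
      using r by (metis neg_equal_0_iff_equal scaleR_left_imp_eq)
    also have "\<dots> \<longleftrightarrow> S x u + \<rho>' (h x) *\<^sub>R u = - (sqrt 2 * \<rho> (h x) * \<mu>) *\<^sub>R u"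
      using \<rho>h_pos[OF xU] by (simp add: a_def add.commute)
    also have "\<dots> \<longleftrightarrow> S x u = - (sqrt 2 * \<rho> (h x) * \<mu>) *\<^sub>R u - \<rho>' (h x) *\<^sub>R u"
      by (simp only: eq_diff_eq)
    also have "\<dots> \<longleftrightarrow> S x u = level_curvature (h x) \<mu> *\<^sub>R u"
      by (simp add: level_curvature_def scaleR_left_distrib scaleR_diff_left)
    finally show ?thesis .
  qed
  have "screen_shape \<rho> F f k x (0, u) = \<mu> *\<^sub>R (0, u) \<longleftrightarrow> S x u = level_curvature (h x) \<mu> *\<^sub>R u"
    if "u \<in> tangent x" for u
    unfolding screen_shape_eq[OF xU that] *[symmetric]
    by (simp only: scaleR_Pair scaleR_zero_right prod.inject simp_thms)
  then show ?thesis
    unfolding screen_eigenspace_def Let_def x[symmetric] screen_eq[OF xU] by blast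
qed

lemma screen_multiplicity_eq:
  assumes "snd z \<in> patch F k" and "x = coord F k (snd z)"
  shows "screen_multiplicity \<rho> F f k z \<mu> = dim {u \<in> tangent x. S x u = level_curvature (h x) \<mu> *\<^sub>R u}"
proof -
  have "linear (Pair 0 :: 'a \<Rightarrow> real \<times> 'a)" by (rule linearI) auto
  then show ?thesis
    unfolding screen_multiplicity_def screen_eigenspace_eq[OF assms] by (rule dim_image_eq) (simp add: inj_on_def)
qed

text \<open>Points of a level set of \<open>h\<close> lie over the same slice, where multiplicities
  agree; a nonzero multiplicity at \<open>x\<close> therefore forces an eigenvector at
  \<open>p\<close>.\<close>

lemma screen_isoparametric_spectrum:
  assumes iso: "screen_isoparametric \<rho> F f" and p: "p \<in> U" and x: "x \<in> U" "h x = h p"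
    and u: "u \<noteq> 0" "u \<in> tangent x" "S x u = s *\<^sub>R u"
  shows "\<exists>v \<in> tangent p. v \<noteq> 0 \<and> S p v = s *\<^sub>R v"
proof -
  obtain P X where P: "P \<in> patch F k" "p = coord F k P" and X: "X \<in> patch F k" "x = coord F k X"
    using p x by (auto simp: coord_image_def)
  \<comment> \<open>The screen curvature corresponding to \<open>s\<close>. Because
    \<open>h x = h p\<close>, the same affine change of eigenvalue applies at both points.\<close>
  define \<mu> where "\<mu> = - (s + \<rho>' (h p)) / (sqrt 2 * \<rho> (h p))"
  have s: "level_curvature (h p) \<mu> = s" using \<rho>h_pos[OF p] by (simp add: level_curvature_def \<mu>_def)
  have "f P = h p" "f X = h p" using h_coord P X x(2) by auto
  then have "(h p, P) \<in> slice F f (h p)" "(h p, X) \<in> slice F f (h p)"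
    using P X by (auto simp: slice_def graph_of_def points_def)
  then have "screen_multiplicity \<rho> F f k (h p, P) \<mu> = screen_multiplicity \<rho> F f k (h p, X) \<mu>"
    using iso P(1) X(1) unfolding screen_isoparametric_def by (metis snd_conv)
  then have "dim {u \<in> tangent p. S p u = s *\<^sub>R u} = dim {u \<in> tangent x. S x u = s *\<^sub>R u}"
    using screen_multiplicity_eq[of "(h p, P)" p \<mu>] screen_multiplicity_eq[of "(h p, X)" x \<mu>] P X x(2) s by simp
  moreover have "dim {u \<in> tangent x. S x u = s *\<^sub>R u} \<noteq> 0" using u by (auto simp: dim_eq_0)
  ultimately have "\<not> {u \<in> tangent p. S p u = s *\<^sub>R u} \<subseteq> {0}" by (simp only: dim_eq_0[symmetric]) simp
  then show ?thesis by blast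
qed

end

section \<open>Translation of Cartan's identity to screen principal curvatures\<close>

theorem theorem4p4:
  fixes F :: "('m::{t2_space,second_countable_topology}, 'i, 'a::euclidean_space) metric_manifold"
    and I :: "real set" and \<rho> :: "real \<Rightarrow> real" and f :: "'m \<Rightarrow> real"
    and c :: real and n l i :: nat and \<psi> :: real
    and z :: "real \<times> 'm" and k :: 'i
    and lam :: "nat \<Rightarrow> real" and m :: "nat \<Rightarrow> nat"
  assumes "DIM('a) = n + 1"
    and "riemannian_manifold F"
    and "is_interval I" and "open I"
    and "smooth_on I \<rho>" and "\<And>t. t \<in> I \<Longrightarrow> \<rho> t > 0"
    and "c \<in> {-1, 0, 1}"
    and "constant_sectional_curvature (warped_product I \<rho> F) c"
    and "transnormal I \<rho> F f"
    and "screen_isoparametric \<rho> F f"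
    and "z \<in> graph_of F f" and "snd z \<in> patch F k"
    and "bij_betw lam {1..l} (screen_principal_curvatures \<rho> F f k z)"
    and "\<And>j. j \<in> {1..l} \<Longrightarrow> m j = screen_multiplicity \<rho> F f k z (lam j)"
    and "\<psi> = sqrt 2 * (deriv \<rho> (fst z) / \<rho> (fst z))"
    and "l > 1" and "i \<in> {1..l}"
  shows "(\<Sum>j \<in> {1..l} - {i}.
           real (m j) * ((c + 2 * lam i * lam j + \<psi> * (lam i + lam j)) / (lam i - lam j))) = 0"
proof -
  interpret T: transnormal_graph F I \<rho> f c k by unfold_locales (fact assms)+
  define p where "p = coord F k (snd z)"
  have p: "p \<in> T.U" using assms(12) by (auto simp: p_def coord_image_def)
  have fz: "fst z = T.h p" using assms(11) T.h_coord[OF assms(12)] by (auto simp: p_def graph_of_def)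
  define r where "r = \<rho> (fst z)"
  define r' where "r' = deriv \<rho> (fst z)"
  have r: "r > 0" unfolding r_def fz by (rule T.\<rho>h_pos[OF p])
  interpret g: inner_form "T.G p" by (rule T.inner[OF p])
  obtain B \<sigma> where B: "g.orthonormal B" "span B = T.tangent p" and \<sigma>: "\<And>u. u \<in> B \<Longrightarrow> T.S p u = \<sigma> u *\<^sub>R u"
    using T.exists_eigenbasis[OF p] by metis
  have finB: "finite B" and B0: "0 \<notin> B"
    using B(1) g.lzero by (auto simp: g.orthonormal_def) (metis zero_neq_one)
  have eig: "dim {u \<in> T.tangent p. T.S p u = s *\<^sub>R u} = card {b \<in> B. \<sigma> b = s}" for s
    using g.dim_eigenspace[OF B(1) T.linear_S[OF p] \<sigma>, of s] by (simp add: B(2))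
  have spec: "s \<in> \<sigma> ` B" if "v \<in> T.tangent p" "v \<noteq> 0" "T.S p v = s *\<^sub>R v" for v s
  proof -
    have "card {b \<in> B. \<sigma> b = s} \<noteq> 0" unfolding eig[symmetric] using that by (auto simp: dim_eq_0)
    then have "{b \<in> B. \<sigma> b = s} \<noteq> {}" by (metis card.empty)
    then show ?thesis by blast
  qed
  \<comment> \<open>The eigenvalues at \<open>p\<close> serve as the finite set: every eigenvalue
    met along the level set also occurs at \<open>p\<close>.\<close>
  interpret C: isoparametric_chart T.U T.G T.h T.a "\<lambda>x. - deriv \<rho> (T.h x) / (\<rho> (T.h x))\<^sup>2" T.\<kappa> T.\<nu> p "\<sigma> ` B"
    by unfold_locales
      (use p finB spec T.screen_isoparametric_spectrum[OF assms(10) p] in \<open>blast+\<close>)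
  define s where "s j = T.level_curvature (T.h p) (lam j)" for j
  have s_lam: "s j = - (sqrt 2 * r * lam j + r')" for j
    by (simp add: s_def T.level_curvature_def r_def r'_def fz)
  have "T.level_curvature (T.h p) ` screen_principal_curvatures \<rho> F f k z = \<sigma> ` B"
  proof (intro equalityI subsetI)
    fix t assume "t \<in> T.level_curvature (T.h p) ` screen_principal_curvatures \<rho> F f k z"
    then obtain \<mu> X where "t = T.level_curvature (T.h p) \<mu>" "X \<in> screen_eigenspace \<rho> F f k z \<mu>" "X \<noteq> 0"
      by (auto simp: screen_principal_curvatures_def)
    then show "t \<in> \<sigma> ` B"
      using T.screen_eigenspace_eq[OF assms(12) p_def] spec by (auto simp: zero_prod_def)
  next
    fix t assume "t \<in> \<sigma> ` B"
    then obtain b where b: "b \<in> B" "t = \<sigma> b" by blast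
    define \<mu> where "\<mu> = - (t + r') / (sqrt 2 * r)"
    have t: "T.level_curvature (T.h p) \<mu> = t"
      using r by (simp add: T.level_curvature_def \<mu>_def r_def r'_def fz)
    have "(0, b) \<in> screen_eigenspace \<rho> F f k z \<mu>"
      using T.screen_eigenspace_eq[OF assms(12) p_def, of \<mu>] b \<sigma>[OF b(1)] t span_base[OF b(1)] B(2) by auto
    moreover have "(0, b) \<noteq> (0::real \<times> 'a)" using b B0 by (auto simp: zero_prod_def)
    ultimately show "t \<in> T.level_curvature (T.h p) ` screen_principal_curvatures \<rho> F f k z"
      unfolding screen_principal_curvatures_def using t by blast
  qed
  then have s_image: "s ` {1..l} = \<sigma> ` B"
    using assms(13) by (metis bij_betw_imp_surj_on image_image s_def image_cong)
  have s_inj: "inj_on s {1..l}"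
  proof (rule inj_onI)
    fix j j' assume j: "j \<in> {1..l}" "j' \<in> {1..l}" and "s j = s j'"
    then have "sqrt 2 * r * lam j = sqrt 2 * r * lam j'" by (simp add: s_lam)
    then have "lam j = lam j'" using r by simp
    then show "j = j'" using j bij_betw_imp_inj_on[OF assms(13)] by (simp add: inj_onD)
  qed
  have m: "m j = card {b \<in> B. \<sigma> b = s j}" if "j \<in> {1..l}" for j
    using assms(14)[OF that] T.screen_multiplicity_eq[OF assms(12) p_def] eig by (simp add: s_def)
  obtain e where e: "e \<in> B" "\<sigma> e = s i" using s_image assms(17) by (metis imageE imageI)
  have \<kappa>: "T.\<kappa> p = c * r\<^sup>2 - r'\<^sup>2" by (simp add: T.\<kappa>_def r_def r'_def fz)
  let ?q = "\<lambda>t. (T.\<kappa> p + s i * t) / (s i - t)"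
  have img: "\<sigma> ` {b \<in> B. \<sigma> b \<noteq> s i} = s ` ({1..l} - {i})"
  proof -
    have "\<sigma> ` {b \<in> B. \<sigma> b \<noteq> s i} = s ` {1..l} - {s i}" unfolding s_image by auto
    also have "\<dots> = s ` ({1..l} - {i})"
      using inj_on_image_set_diff[OF s_inj, of "{1..l}" "{i}"] assms(17) by simp
    finally show ?thesis .
  qed
  have "0 = (\<Sum>b\<in>{b \<in> B. \<sigma> b \<noteq> s i}. ?q (\<sigma> b))"
    using C.cartan_identity[OF B \<sigma> e(1)] by (simp add: e(2))
  \<comment> \<open>Basis vectors are grouped by eigenvalue; the group belonging to
    \<open>s j\<close> has \<open>m j\<close> members.\<close>
  also have "\<dots> = (\<Sum>t\<in>s ` ({1..l} - {i}). \<Sum>b\<in>{b \<in> {b \<in> B. \<sigma> b \<noteq> s i}. \<sigma> b = t}. ?q (\<sigma> b))"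
    unfolding img[symmetric] by (rule sum.image_gen) (use finB in simp)
  also have "\<dots> = (\<Sum>j\<in>{1..l} - {i}. \<Sum>b\<in>{b \<in> {b \<in> B. \<sigma> b \<noteq> s i}. \<sigma> b = s j}. ?q (\<sigma> b))"
    by (subst sum.reindex) (use s_inj in \<open>auto intro: inj_on_subset\<close>)
  also have "\<dots> = (\<Sum>j\<in>{1..l} - {i}. real (m j) * ?q (s j))"
  proof (rule sum.cong)
    fix j assume j: "j \<in> {1..l} - {i}"
    then have "s j \<noteq> s i" using inj_onD[OF s_inj, of j i] assms(17) by blast
    then have "{b \<in> {b \<in> B. \<sigma> b \<noteq> s i}. \<sigma> b = s j} = {b \<in> B. \<sigma> b = s j}" by auto
    then show "(\<Sum>b\<in>{b \<in> {b \<in> B. \<sigma> b \<noteq> s i}. \<sigma> b = s j}. ?q (\<sigma> b)) = real (m j) * ?q (s j)"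
      using m j by simp
  qed simp
  also have "\<dots> = (\<Sum>j\<in>{1..l} - {i}. - (r / sqrt 2) *
     (real (m j) * ((c + 2 * lam i * lam j + \<psi> * (lam i + lam j)) / (lam i - lam j))))"
  proof (rule sum.cong)
    fix j assume "j \<in> {1..l} - {i}"
    then have ne: "lam i - lam j \<noteq> 0"
      using inj_onD[OF bij_betw_imp_inj_on[OF assms(13)], of i j] assms(17) by auto
    \<comment> \<open>The product of the two shifts by \<open>r'\<close> cancels against
      \<open>- r'\<^sup>2\<close> in \<open>T.\<kappa> p\<close>, and \<open>sqrt 2 * r * r'\<close>
      equals \<open>r\<^sup>2 * \<psi>\<close>. Division by \<open>s i - s j\<close> leaves the
      common factor \<open>- (r / sqrt 2)\<close>.\<close>
    have "T.\<kappa> p + s i * s j = r\<^sup>2 * (c + 2 * lam i * lam j + \<psi> * (lam i + lam j))"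
      using r unfolding \<kappa> s_lam assms(15) r_def[symmetric] r'_def[symmetric]
      by (simp add: field_simps power2_eq_square)
    moreover have "s i - s j = - (sqrt 2 * r) * (lam i - lam j)" by (simp add: s_lam algebra_simps)
    ultimately have "?q (s j) = - (r / sqrt 2) * ((c + 2 * lam i * lam j + \<psi> * (lam i + lam j)) / (lam i - lam j))"
      using r ne by (simp add: power2_eq_square divide_simps)
    then show "real (m j) * ?q (s j) = - (r / sqrt 2) *
     (real (m j) * ((c + 2 * lam i * lam j + \<psi> * (lam i + lam j)) / (lam i - lam j)))"
      by (simp only: mult.left_commute)
  qed simp
  also have "\<dots> = - (r / sqrt 2) * (\<Sum>j\<in>{1..l} - {i}.
     real (m j) * ((c + 2 * lam i * lam j + \<psi> * (lam i + lam j)) / (lam i - lam j)))"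
    by (rule sum_distrib_left[symmetric])
  finally show ?thesis using r by simp
qed

end
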